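(* Let $n\ge1$, $d\ge0$ and let $\lambda\in P^{++}$ (dominant and typical). Then the functor $F_\lambda:\mathcal O(\mathfrak q(n))\to\mathcal H(d)\text{-mod}$ is exact.
   Context: Everything is over $\mathbb C$ and $\mathbb Z_2$-graded, with the usual sign rule. $\mathcal H(d)$ is the degenerate affine Hecke-Clifford algebra: even generators $s_1,\dots,s_{d-1},x_1,\dots,x_d$, odd generators $c_1,\dots,c_d$; as a vector space $\mathbb C[x_1,\dots,x_d]\otimes\mathcal C\ell(d)\otimes\mathbb CS_d$; the $x_i$ commute, the $s_i$ satisfy the Coxeter relations of $S_d$, $c_i^2=-1$, $c_ic_j=-c_jc_i$ ($i\neq j$), $s_ic_i=c_{i+1}s_i$, $s_ic_{i+1}=c_is_i$, $s_ic_j=c_js_i$ ($j\ne i,i+1$), $c_ix_i=-x_ic_i$, $c_jx_i=x_ic_j$ ($j\neq i$), $s_ix_i=x_{i+1}s_i-1+c_ic_{i+1}$, $s_ix_j=x_js_i$ ($j\ne i,i+1$). $P=\mathbb Z^n$, $P^{++}=\{\lambda\in P:\lambda_1\ge\dots\ge\lambda_n,\ \lambda_i+\lambda_j\neq0\text{ for all }1\le i,j\le n\}$. Let $I=\{\pm1,\dots,\pm n\}$, $I^+=\{1,\dots,n\}$; $V=\mathbb C^{n|n}$ has basis $v_i$ ($i\in I$), $v_k$ even and $v_{-k}$ odd for $k\in I^+$, matrix units $E_{ij}$. For $i,j\in I^+$: $e_{ij}=E_{ij}+E_{-i,-j}$, $f_{ij}=E_{-i,j}+E_{i,-j}$, $\bar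 e_{ij}=E_{ij}-E_{-i,-j}$, $\bar f_{ij}=E_{-i,j}-E_{i,-j}$; $\mathfrak q(n)=\operatorname{span}\{e_{ij},f_{ij}\}$. $\mathfrak h_{\bar0}=\operatorname{span}\{e_{ii}\}$, $\mathfrak h=\operatorname{span}\{e_{ii},f_{ii}\}$, $\mathfrak n^+=\operatorname{span}\{e_{ij},f_{ij}:i<j\}$, $\mathfrak b=\mathfrak h\oplus\mathfrak n^+$. $\lambda\in P$ is viewed as a weight of $\mathfrak h_{\bar0}$ via $\lambda(e_{ii})=\lambda_i$. $\mathcal O(\mathfrak q(n))$ is the category of finitely generated $\mathfrak q(n)$-supermodules that are locally finite dimensional over $\mathfrak b$ and are direct sums of weight spaces $M_\lambda=\{v:hv=\lambda(h)v\ \forall h\in\mathfrak h_{\bar0}\}$, $\lambda\in P$. For any $\mathfrak q(n)$-supermodule $M$, $\mathcal H(d)$ acts on $M\otimes V^{\otimes d}$ (factors numbered $0,\dots,d$), commuting with $\mathfrak q(n)$, by $c_i\mapsto C_i$, $s_i\mapsto S_{i,i+1}$, $x_i\mapsto\Omega_{0i}+\sum_{1\le j<i}(1-C_jC_i)S_{ji}$, where $C_i$ is $C=\sum_{k\in I^+}\bar f_{kk}$ in factor $i$, $S_{ij}$ is $S=\sum_{k,l\in I}\operatorname{sgn}(l)E_{kl}\otimes E_{lk}$ in factors $i,j$, and $\Omega_{0i}$ is $\Omega=\sum_{k,l\in I^+}(e_{kl}\otimes\bar e_{lk}-f_{kl}\otimes\bar f_{lk})$ in factors $0,i$. The functor is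 $F_\lambda M=\{m\in M\otimes V^{\otimes d}:\mathfrak n^+m=0,\ m\in(M\otimes V^{\otimes d})_\lambda\}$ with the induced $\mathcal H(d)$-action. *)

theory Defs
  imports Complex_Main "HOL-Library.Function_Algebras" "HOL-Library.Z2"
begin

section \<open>Complex vector spaces\<close>

class complex_vector = ab_group_add +
  fixes scaleC :: "complex \<Rightarrow> 'a \<Rightarrow> 'a"  (infixr \<open>*\<^sub>C\<close> 75)
  assumes scaleC_add_right: "c *\<^sub>C (x + y) = c *\<^sub>C x + c *\<^sub>C y"
    and scaleC_add_left: "(b + c) *\<^sub>C x = b *\<^sub>C x + c *\<^sub>C x"
    and scaleC_scaleC: "b *\<^sub>C c *\<^sub>C x = (b * c) *\<^sub>C x"
    and scaleC_one: "1 *\<^sub>C x = x"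

global_interpretation cvec: vector_space "scaleC :: complex \<Rightarrow> 'a \<Rightarrow> 'a::complex_vector"
  by standard (rule scaleC_add_right scaleC_add_left scaleC_scaleC scaleC_one)+

instantiation complex :: complex_vector
begin
definition scaleC_complex :: "complex \<Rightarrow> complex \<Rightarrow> complex"
  where "scaleC_complex c z = c * z"
instance by standard (simp_all add: scaleC_complex_def algebra_simps)
end

instantiation "fun" :: (type, complex_vector) complex_vector
begin
definition scaleC_fun :: "complex \<Rightarrow> ('a \<Rightarrow> 'b) \<Rightarrow> 'a \<Rightarrow> 'b"
  where "scaleC_fun c f = (\<lambda>x. c *\<^sub>C f x)"
instance
  by standard (simp_all add: scaleC_fun_def fun_eq_iff scaleC_add_right scaleC_add_left
      scaleC_scaleC scaleC_one)
end

definition linear_on :: "'a::complex_vector set \<Rightarrow> ('a \<Rightarrow> 'b::complex_vector) \<Rightarrow> bool" where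
  "linear_on A f \<longleftrightarrow>
     (\<forall>x\<in>A. \<forall>y\<in>A. f (x + y) = f x + f y) \<and> (\<forall>c. \<forall>x\<in>A. f (c *\<^sub>C x) = c *\<^sub>C f x)"

section \<open>Superspaces\<close>

text \<open>Parities are elements of \<^typ>\<open>bit\<close>, the integers modulo 2.  A structure lives on a
  subspace \<open>mcarrier\<close> of an ambient type; \<open>act\<close> gives the operators of a set of
  acting symbols \<open>'x\<close> (elements of a Lie superalgebra, or generators of a superalgebra).
  All operators and maps are only relevant on the carrier.\<close>

record ('x, 'a) supermod =
  mcarrier :: "'a set"
  grade :: "bit \<Rightarrow> 'a set"
  act :: "'x \<Rightarrow> 'a \<Rightarrow> 'a"

definition koszul :: "bit \<Rightarrow> bit \<Rightarrow> complex" where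
  "koszul p q = (if p = 1 \<and> q = 1 then - 1 else 1)"

definition superspace :: "('x, 'a::complex_vector) supermod \<Rightarrow> bool" where
  "superspace M \<longleftrightarrow>
     (\<forall>p. cvec.subspace (grade M p)) \<and>
     grade M 0 \<inter> grade M 1 = {0} \<and>
     mcarrier M = {a + b | a b. a \<in> grade M 0 \<and> b \<in> grade M 1}"

definition graded_map ::
  "bit \<Rightarrow> ('x, 'a::complex_vector) supermod \<Rightarrow> ('y, 'b::complex_vector) supermod \<Rightarrow> ('a \<Rightarrow> 'b) \<Rightarrow> bool"
  where "graded_map p M N f \<longleftrightarrow>
     linear_on (mcarrier M) f \<and> (\<forall>r. f ` grade M r \<subseteq> grade N (r + p))"

definition hcomp :: "('x, 'a::complex_vector) supermod \<Rightarrow> bit \<Rightarrow> 'a \<Rightarrow> 'a" where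
  "hcomp M r m = (THE a. a \<in> grade M r \<and> m - a \<in> grade M (r + 1))"

text \<open>For homogeneous \<open>m\<close> this is the sign rule factor \<open>(-1)\<^bsup>p|m|\<^esup> m\<close>.\<close>

definition twist :: "('x, 'a::complex_vector) supermod \<Rightarrow> bit \<Rightarrow> 'a \<Rightarrow> 'a" where
  "twist M p m = hcomp M 0 m + koszul p 1 *\<^sub>C hcomp M 1 m"

section \<open>The Lie superalgebra q(n)\<close>

definition idx :: "nat \<Rightarrow> int set" where
  "idx n = {i. i \<noteq> 0 \<and> \<bar>i\<bar> \<le> int n}"

definition ipar :: "int \<Rightarrow> bit" where
  "ipar i = (if i > 0 then 0 else 1)"

text \<open>Elements of \<open>gl(n|n)\<close> are matrices with rows and columns indexed by \<^term>\<open>idx n\<close>.\<close>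

type_synonym smatrix = "int \<Rightarrow> int \<Rightarrow> complex"

definition E_mat :: "int \<Rightarrow> int \<Rightarrow> smatrix" where
  "E_mat i j = (\<lambda>k l. if k = i \<and> l = j then 1 else 0)"

definition e_mat :: "int \<Rightarrow> int \<Rightarrow> smatrix" where "e_mat i j = E_mat i j + E_mat (- i) (- j)"
definition f_mat :: "int \<Rightarrow> int \<Rightarrow> smatrix" where "f_mat i j = E_mat (- i) j + E_mat i (- j)"
definition e_bar :: "int \<Rightarrow> int \<Rightarrow> smatrix" where "e_bar i j = E_mat i j - E_mat (- i) (- j)"
definition f_bar :: "int \<Rightarrow> int \<Rightarrow> smatrix" where "f_bar i j = E_mat (- i) j - E_mat i (- j)"

definition q_part :: "nat \<Rightarrow> bit \<Rightarrow> smatrix set" where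
  "q_part n p = cvec.span {(if p = 0 then e_mat i j else f_mat i j) | i j.
                             i \<in> {1..int n} \<and> j \<in> {1..int n}}"

definition q_alg :: "nat \<Rightarrow> smatrix set" where
  "q_alg n = cvec.span ({e_mat i j | i j. i \<in> {1..int n} \<and> j \<in> {1..int n}} \<union>
                        {f_mat i j | i j. i \<in> {1..int n} \<and> j \<in> {1..int n}})"

definition cartan0 :: "nat \<Rightarrow> smatrix set" where
  "cartan0 n = cvec.span {e_mat i i | i. i \<in> {1..int n}}"

definition cartan :: "nat \<Rightarrow> smatrix set" where
  "cartan n = cvec.span ({e_mat i i | i. i \<in> {1..int n}} \<union> {f_mat i i | i. i \<in> {1..int n}})"

definition nplus :: "nat \<Rightarrow> smatrix set" where
  "nplus n = cvec.span ({e_mat i j | i j. 1 \<le> i \<and> i < j \<and> j \<le> int n} \<union>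
                        {f_mat i j | i j. 1 \<le> i \<and> i < j \<and> j \<le> int n})"

definition borel_sub :: "nat \<Rightarrow> smatrix set" where
  "borel_sub n = {h + x | h x. h \<in> cartan n \<and> x \<in> nplus n}"

definition mmul :: "nat \<Rightarrow> smatrix \<Rightarrow> smatrix \<Rightarrow> smatrix" where
  "mmul n x y = (\<lambda>i j. \<Sum>k\<in>idx n. x i k * y k j)"

definition sbracket :: "nat \<Rightarrow> bit \<Rightarrow> bit \<Rightarrow> smatrix \<Rightarrow> smatrix \<Rightarrow> smatrix" where
  "sbracket n p q x y = mmul n x y - koszul p q *\<^sub>C mmul n y x"

section \<open>Supermodules over q(n) and the category O\<close>

definition q_supermodule :: "nat \<Rightarrow> (smatrix, 'a::complex_vector) supermod \<Rightarrow> bool" where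
  "q_supermodule n M \<longleftrightarrow>
     superspace M \<and>
     (\<forall>m\<in>mcarrier M. linear_on (q_alg n) (\<lambda>x. act M x m)) \<and>
     (\<forall>p. \<forall>x\<in>q_part n p. graded_map p M M (act M x)) \<and>
     (\<forall>p q. \<forall>x\<in>q_part n p. \<forall>y\<in>q_part n q. \<forall>m\<in>mcarrier M.
        act M (sbracket n p q x y) m = act M x (act M y m) - koszul p q *\<^sub>C act M y (act M x m))"

definition q_hom :: "nat \<Rightarrow> bit \<Rightarrow> (smatrix, 'a::complex_vector) supermod \<Rightarrow>
    (smatrix, 'b::complex_vector) supermod \<Rightarrow> ('a \<Rightarrow> 'b) \<Rightarrow> bool" where
  "q_hom n p M N \<phi> \<longleftrightarrow>
     graded_map p M N \<phi> \<and>
     (\<forall>r. \<forall>x\<in>q_part n r. \<forall>m\<in>mcarrier M. \<phi> (act M x m) = koszul p r *\<^sub>C act N x (\<phi> m))"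

text \<open>Weights \<open>P = \<int>\<^sup>n\<close> are integer functions supported on \<open>{1..n}\<close>.\<close>

definition wt_lattice :: "nat \<Rightarrow> (int \<Rightarrow> int) set" where
  "wt_lattice n = {lam. \<forall>i. i \<notin> {1..int n} \<longrightarrow> lam i = 0}"

definition dominant_typical :: "nat \<Rightarrow> (int \<Rightarrow> int) set" where
  "dominant_typical n = {lam \<in> wt_lattice n. (\<forall>i\<in>{1..int n}. \<forall>j\<in>{1..int n}. i \<le> j \<longrightarrow> lam i \<ge> lam j) \<and>
                      (\<forall>i\<in>{1..int n}. \<forall>j\<in>{1..int n}. lam i + lam j \<noteq> 0)}"

definition weight :: "nat \<Rightarrow> (int \<Rightarrow> int) \<Rightarrow> smatrix \<Rightarrow> complex" where
  "weight n lam h = (\<Sum>i\<in>{1..int n}. of_int (lam i) * h i i)"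

definition weight_space ::
  "nat \<Rightarrow> (smatrix, 'a::complex_vector) supermod \<Rightarrow> (int \<Rightarrow> int) \<Rightarrow> 'a set" where
  "weight_space n M lam = {v \<in> mcarrier M. \<forall>h\<in>cartan0 n. act M h v = weight n lam h *\<^sub>C v}"

definition stable :: "'x set \<Rightarrow> ('x, 'a::complex_vector) supermod \<Rightarrow> 'a set \<Rightarrow> bool" where
  "stable X M N \<longleftrightarrow>
     cvec.subspace N \<and> N \<subseteq> mcarrier M \<and> (\<forall>x\<in>X. \<forall>v\<in>N. act M x v \<in> N)"

definition category_O :: "nat \<Rightarrow> (smatrix, 'a::complex_vector) supermod \<Rightarrow> bool" where
  "category_O n M \<longleftrightarrow>
     q_supermodule n M \<and>
     (\<exists>G. finite G \<and> G \<subseteq> mcarrier M \<and> (\<forall>N. stable (q_alg n) M N \<and> G \<subseteq> N \<longrightarrow> N = mcarrier M)) \<and>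
     (\<forall>m\<in>mcarrier M. \<exists>N. stable (borel_sub n) M N \<and> m \<in> N \<and> (\<exists>B. finite B \<and> N = cvec.span B)) \<and>
     (\<forall>m\<in>mcarrier M. \<exists>!u. (\<forall>\<mu>\<in>wt_lattice n. u \<mu> \<in> weight_space n M \<mu>) \<and> (\<forall>\<mu>. \<mu> \<notin> wt_lattice n \<longrightarrow> u \<mu> = 0) \<and>
        finite {\<mu>. u \<mu> \<noteq> 0} \<and> m = (\<Sum>\<mu> | u \<mu> \<noteq> 0. u \<mu>))"

section \<open>Supermodules over the degenerate affine Hecke-Clifford algebra\<close>

text \<open>The algebra \<open>H(d)\<close> is given by generators and relations, so that a supermodule is
  a superspace with operators for the generators, of the right parity, that satisfy
  the relations.\<close>

datatype hecke_gen = s_gen nat | x_gen nat | c_gen nat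

definition hecke_gens :: "nat \<Rightarrow> hecke_gen set" where
  "hecke_gens d = s_gen ` {1..<d} \<union> x_gen ` {1..d} \<union> c_gen ` {1..d}"

fun gen_par :: "hecke_gen \<Rightarrow> bit" where
  "gen_par (s_gen i) = 0"
| "gen_par (x_gen i) = 0"
| "gen_par (c_gen i) = 1"

definition hecke_relations ::
  "nat \<Rightarrow> (nat \<Rightarrow> 'a \<Rightarrow> 'a) \<Rightarrow> (nat \<Rightarrow> 'a \<Rightarrow> 'a) \<Rightarrow> (nat \<Rightarrow> 'a \<Rightarrow> 'a) \<Rightarrow> 'a::complex_vector \<Rightarrow> bool"
  where "hecke_relations d s x c m \<longleftrightarrow>
    (\<forall>i\<in>{1..d}. \<forall>j\<in>{1..d}. x i (x j m) = x j (x i m)) \<and>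
    (\<forall>i\<in>{1..<d}. s i (s i m) = m) \<and>
    (\<forall>i\<in>{1..<d}. \<forall>j\<in>{1..<d}. j = i + 1 \<longrightarrow> s i (s j (s i m)) = s j (s i (s j m))) \<and>
    (\<forall>i\<in>{1..<d}. \<forall>j\<in>{1..<d}. j > i + 1 \<longrightarrow> s i (s j m) = s j (s i m)) \<and>
    (\<forall>i\<in>{1..d}. c i (c i m) = - m) \<and>
    (\<forall>i\<in>{1..d}. \<forall>j\<in>{1..d}. i \<noteq> j \<longrightarrow> c i (c j m) = - c j (c i m)) \<and>
    (\<forall>i\<in>{1..<d}. s i (c i m) = c (i + 1) (s i m)) \<and>
    (\<forall>i\<in>{1..<d}. s i (c (i + 1) m) = c i (s i m)) \<and>
    (\<forall>i\<in>{1..<d}. \<forall>j\<in>{1..d}. j \<noteq> i \<and> j \<noteq> i + 1 \<longrightarrow> s i (c j m) = c j (s i m)) \<and>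
    (\<forall>i\<in>{1..d}. c i (x i m) = - x i (c i m)) \<and>
    (\<forall>i\<in>{1..d}. \<forall>j\<in>{1..d}. j \<noteq> i \<longrightarrow> c j (x i m) = x i (c j m)) \<and>
    (\<forall>i\<in>{1..<d}. s i (x i m) = x (i + 1) (s i m) - m + c i (c (i + 1) m)) \<and>
    (\<forall>i\<in>{1..<d}. \<forall>j\<in>{1..d}. j \<noteq> i \<and> j \<noteq> i + 1 \<longrightarrow> s i (x j m) = x j (s i m))"

definition hecke_supermodule :: "nat \<Rightarrow> (hecke_gen, 'a::complex_vector) supermod \<Rightarrow> bool" where
  "hecke_supermodule d M \<longleftrightarrow>
     superspace M \<and>
     (\<forall>g\<in>hecke_gens d. graded_map (gen_par g) M M (act M g)) \<and>
     (\<forall>m\<in>mcarrier M. hecke_relations d (\<lambda>i. act M (s_gen i)) (\<lambda>i. act M (x_gen i))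
                                       (\<lambda>i. act M (c_gen i)) m)"

definition hecke_hom :: "nat \<Rightarrow> bit \<Rightarrow> (hecke_gen, 'a::complex_vector) supermod \<Rightarrow>
    (hecke_gen, 'b::complex_vector) supermod \<Rightarrow> ('a \<Rightarrow> 'b) \<Rightarrow> bool" where
  "hecke_hom d p M N \<phi> \<longleftrightarrow>
     graded_map p M N \<phi> \<and>
     (\<forall>g\<in>hecke_gens d. \<forall>m\<in>mcarrier M. \<phi> (act M g m) = koszul p (gen_par g) *\<^sub>C act N g (\<phi> m))"

section \<open>The tensor product of M with the d-th tensor power of V\<close>

text \<open>The function \<open>u\<close> stands for the sum over all words \<open>w\<close> of length \<open>d\<close> of
  \<open>u w \<otimes> v\<^bsub>w!0\<^esub> \<otimes> \<dots> \<otimes> v\<^bsub>w!(d-1)\<^esub>\<close>; tensor factor \<open>i \<ge> 1\<close> corresponds to the letter \<open>w ! (i - 1)\<close>.\<close>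

definition tensor_words :: "nat \<Rightarrow> nat \<Rightarrow> int list set" where
  "tensor_words n d = {w. length w = d \<and> set w \<subseteq> idx n}"

definition word_par :: "int list \<Rightarrow> bit" where
  "word_par w = (\<Sum>i\<leftarrow>w. ipar i)"

text \<open>The operators of \<open>x\<close> in factor 0 and of a matrix \<open>A\<close> in factor \<open>i \<ge> 1\<close>.  By the sign rule a
  homogeneous \<open>A\<close> picks up \<open>(-1)\<^bsup>|A|(|m| + |w\<^sub>1| + \<dots>)\<^esup>\<close> from the factors to its left; the entry of
  \<open>A\<close> in row \<open>k\<close> and column \<open>j\<close> has parity \<^term>\<open>ipar k + ipar j\<close>.\<close>

definition at0 :: "(smatrix, 'a::complex_vector) supermod \<Rightarrow> smatrix \<Rightarrow>
    (int list \<Rightarrow> 'a) \<Rightarrow> int list \<Rightarrow> 'a" where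
  "at0 M x u = (\<lambda>w. act M x (u w))"

definition at_factor :: "nat \<Rightarrow> nat \<Rightarrow> (smatrix, 'a::complex_vector) supermod \<Rightarrow> nat \<Rightarrow> smatrix \<Rightarrow>
    (int list \<Rightarrow> 'a) \<Rightarrow> int list \<Rightarrow> 'a" where
  "at_factor n d M i A u = (\<lambda>w.
     if w \<in> tensor_words n d
     then let k = w ! (i - 1) in
       \<Sum>j\<in>idx n. (A k j * koszul (ipar k + ipar j) (word_par (take (i - 1) w)))
                    *\<^sub>C twist M (ipar k + ipar j) (u (w[i - 1 := j]))
     else 0)"

definition tensor_module :: "nat \<Rightarrow> nat \<Rightarrow> (smatrix, 'a::complex_vector) supermod \<Rightarrow>
    (smatrix, int list \<Rightarrow> 'a) supermod" where
  "tensor_module n d M = \<lparr>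
     mcarrier = {u. \<forall>w. if w \<in> tensor_words n d then u w \<in> mcarrier M else u w = 0},
     grade = (\<lambda>p. {u. \<forall>w. if w \<in> tensor_words n d then u w \<in> grade M (p + word_par w) else u w = 0}),
     act = (\<lambda>x u. at0 M x u + (\<Sum>i\<in>{1..d}. at_factor n d M i x u)) \<rparr>"

definition C_mat :: "nat \<Rightarrow> smatrix" where
  "C_mat n = (\<Sum>k\<in>{1..int n}. f_bar k k)"

definition C_op :: "nat \<Rightarrow> nat \<Rightarrow> (smatrix, 'a::complex_vector) supermod \<Rightarrow> nat \<Rightarrow>
    (int list \<Rightarrow> 'a) \<Rightarrow> int list \<Rightarrow> 'a" where
  "C_op n d M i = at_factor n d M i (C_mat n)"

text \<open>An operator \<open>a \<otimes> b\<close> on the factors \<open>i < j\<close> is \<open>a\<close> in factor \<open>i\<close> applied after \<open>b\<close> in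
  factor \<open>j\<close>, which is the sign rule for \<open>(a \<otimes> 1)(1 \<otimes> b)\<close>.\<close>

definition S_op :: "nat \<Rightarrow> nat \<Rightarrow> (smatrix, 'a::complex_vector) supermod \<Rightarrow> nat \<Rightarrow> nat \<Rightarrow>
    (int list \<Rightarrow> 'a) \<Rightarrow> int list \<Rightarrow> 'a" where
  "S_op n d M i j u = (\<Sum>k\<in>idx n. \<Sum>l\<in>idx n.
     of_int (sgn l) *\<^sub>C at_factor n d M i (E_mat k l) (at_factor n d M j (E_mat l k) u))"

definition Omega_op :: "nat \<Rightarrow> nat \<Rightarrow> (smatrix, 'a::complex_vector) supermod \<Rightarrow> nat \<Rightarrow>
    (int list \<Rightarrow> 'a) \<Rightarrow> int list \<Rightarrow> 'a" where
  "Omega_op n d M i u = (\<Sum>k\<in>{1..int n}. \<Sum>l\<in>{1..int n}.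
     at0 M (e_mat k l) (at_factor n d M i (e_bar l k) u) -
     at0 M (f_mat k l) (at_factor n d M i (f_bar l k) u))"

definition X_op :: "nat \<Rightarrow> nat \<Rightarrow> (smatrix, 'a::complex_vector) supermod \<Rightarrow> nat \<Rightarrow>
    (int list \<Rightarrow> 'a) \<Rightarrow> int list \<Rightarrow> 'a" where
  "X_op n d M i u = Omega_op n d M i u +
     (\<Sum>j\<in>{1..<i}. S_op n d M j i u - C_op n d M j (C_op n d M i (S_op n d M j i u)))"

fun hecke_act :: "nat \<Rightarrow> nat \<Rightarrow> (smatrix, 'a::complex_vector) supermod \<Rightarrow> hecke_gen \<Rightarrow>
    (int list \<Rightarrow> 'a) \<Rightarrow> int list \<Rightarrow> 'a" where
  "hecke_act n d M (s_gen i) = S_op n d M i (i + 1)"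
| "hecke_act n d M (x_gen i) = X_op n d M i"
| "hecke_act n d M (c_gen i) = C_op n d M i"

section \<open>The functor\<close>

definition F_space :: "nat \<Rightarrow> nat \<Rightarrow> (int \<Rightarrow> int) \<Rightarrow> (smatrix, 'a::complex_vector) supermod \<Rightarrow>
    (int list \<Rightarrow> 'a) set" where
  "F_space n d lam M =
     {u \<in> weight_space n (tensor_module n d M) lam. \<forall>x\<in>nplus n. act (tensor_module n d M) x u = 0}"

definition F_obj :: "nat \<Rightarrow> nat \<Rightarrow> (int \<Rightarrow> int) \<Rightarrow> (smatrix, 'a::complex_vector) supermod \<Rightarrow>
    (hecke_gen, int list \<Rightarrow> 'a) supermod" where
  "F_obj n d lam M = \<lparr>
     mcarrier = F_space n d lam M,
     grade = (\<lambda>p. F_space n d lam M \<inter> grade (tensor_module n d M) p),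
     act = hecke_act n d M \<rparr>"

text \<open>The map \<open>\<phi> \<otimes> id\<close>; there is no sign since \<open>\<phi>\<close> acts on the leftmost factor.\<close>

definition F_map :: "('a \<Rightarrow> 'b) \<Rightarrow> (int list \<Rightarrow> 'a) \<Rightarrow> int list \<Rightarrow> 'b" where
  "F_map \<phi> u = (\<lambda>w. \<phi> (u w))"

definition short_exact :: "('x, 'a::complex_vector) supermod \<Rightarrow> ('a \<Rightarrow> 'b) \<Rightarrow>
    ('x, 'b::complex_vector) supermod \<Rightarrow> ('b \<Rightarrow> 'c) \<Rightarrow> ('x, 'c::complex_vector) supermod \<Rightarrow> bool" where
  "short_exact L \<phi> M \<psi> N \<longleftrightarrow>
     inj_on \<phi> (mcarrier L) \<and>
     \<phi> ` mcarrier L = {m \<in> mcarrier M. \<psi> m = 0} \<and>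
     \<psi> ` mcarrier M = mcarrier N"

end

theory Submission
  imports Defs "HOL-Computational_Algebra.Polynomial_FPS" "HOL-Library.Multiset"
begin

text \<open>
  Let \<open>T = M \<otimes> V\<^sup>d\<close>, where \<open>V\<^sup>d\<close> is the tensor power.  There are two things to see: that the Hecke-Clifford
  generators satisfy their relations on \<open>T\<close> and preserve the singular vectors of weight \<open>\<lambda>\<close>, and that
  singular vectors of weight \<open>\<lambda>\<close> lift along surjections.  Everything else about exactness is formal.

  \<^bold>\<open>The action.\<close>  The sign rule is removed by passing to the ring of linear operators on \<open>T\<close>, in which
  factor \<open>i\<close> contributes matrix units \<open>m i a b\<close> and factor \<open>0\<close> contributes operators \<open>x a b\<close>, the images
  of the elements \<open>E\<^bsub>ab\<^esub> + E\<^bsub>-a,-b\<^esub>\<close> of \<open>q(n)\<close> for signed indices \<open>a\<close>, \<open>b\<close>.  One construction,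
  \<open>flip x m = \<Sum> (-1)\<^bsup>|l|\<^esup> x\<^bsub>kl\<^esub> m\<^bsub>lk\<^esub>\<close>, yields \<open>S\<close> if both families are matrix units and \<open>\<Omega>\<close> if the first one
  is an action of \<open>q(n)\<close>.  For the action of \<open>q(n)\<close> on a second copy of \<open>V\<close> it yields
  \<open>(1 - C\<^sub>jC\<^sub>i)S\<^bsub>ji\<^esub>\<close> (\<open>flip_dbl\<close>); therefore \<open>x\<^sub>i\<close> acts as \<open>\<Omega>\<close> for the tensor product of the factors before \<open>i\<close>
  with factor \<open>i\<close>.  That operator commutes with \<open>q(n)\<close> acting on the factors up to \<open>i\<close>
  (\<open>casimir_commute\<close>), hence with all later \<open>x\<^sub>j\<close>; the remaining
  relations hold because \<open>S\<close> permutes the factors and \<open>C\<close> supercommutes with \<open>q(n)\<close>.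

  \<^bold>\<open>Lifting.\<close>  Given a singular vector \<open>v\<close> of weight \<open>\<lambda>\<close> in \<open>N \<otimes> V\<^sup>d\<close>, first choose a preimage \<open>u\<close> that is merely
  a weight vector (\<open>weight_vector_lift\<close>).  By local finiteness, long words in the raising operators
  annihilate \<open>u\<close> (\<open>exists_killed\<close>).  The Sergeev elements \<open>Z t\<close> commute with \<open>q(n)\<close> and act on singular vectors of
  weight \<open>\<mu>\<close> by scalars \<open>\<chi>\<^sub>t(\<mu>)\<close> (\<open>Z_eigen\<close>) with
  \<open>1 - 2 \<Sum>\<^sub>t \<chi>\<^sub>t(\<mu>) z\<^bsup>t+1\<^esup> = \<Prod>\<^sub>i (1 - \<mu>\<^sub>i(\<mu>\<^sub>i + 1)z) / (1 - \<mu>\<^sub>i(\<mu>\<^sub>i - 1)z)\<close> (\<open>tail_fps_prod\<close>).  This product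
  determines, for each \<open>K \<ge> 1\<close>, how many more entries \<open>K\<close> than entries \<open>-K\<close> the weight has.  A typical weight
  does not have both, nor an entry \<open>0\<close>; so if \<open>\<lambda>\<close> is typical, \<open>\<chi>(\<mu>) = \<chi>(\<lambda>)\<close> forces \<open>\<mu>\<close> to be a permutation
  of \<open>\<lambda>\<close>, and no permutation of a dominant weight lies strictly above it (\<open>chi_separates\<close>).  Hence
  a suitable product of operators
  \<open>Z t - \<chi>\<^sub>t(\<mu>)\<close> annihilates all vectors reached from \<open>u\<close> by raising operators, and so makes \<open>u\<close> singular
  (\<open>singular_projection\<close>), while it multiplies \<open>v\<close> by a nonzero scalar (\<open>zprod_eigen\<close>).  After rescaling it
  turns \<open>u\<close> into a singular preimage of \<open>v\<close>.
\<close>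

section \<open>Signs, matrix units and the Casimir operator\<close>

(* Parities are elements of the field with two elements here, not bit strings. *)
declare add_bit_eq_xor [simp del] mult_bit_eq_and [simp del]

text \<open>The sign \<open>(-1)\<^sup>p\<close> is an operation rather than a ring element, because the rings of operators
  used below may be trivial and so need not have a unit different from zero.\<close>

definition sg :: "bit \<Rightarrow> 'r::ab_group_add \<Rightarrow> 'r" where
  "sg p x = (if p = 1 then - x else x)"

lemma sg_0 [simp]: "sg 0 x = x" and sg_1 [simp]: "sg 1 x = - x"
  by (simp_all add: sg_def)

lemma sg_sg [simp]: "sg p (sg q x) = sg (p + q) x"
  by (cases p; cases q) simp_all

lemma sg_zero [simp]: "sg p 0 = 0"
  by (simp add: sg_def)

lemma sg_add: "sg p (x + y) = sg p x + sg p y"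
  by (simp add: sg_def)

lemma sg_diff: "sg p (x - y) = sg p x - sg p y"
  by (simp add: sg_def)

lemma sg_minus: "sg p (- x) = - sg p x"
  by (simp add: sg_def)

lemma sg_sum: "sg p (\<Sum>i\<in>A. f i) = (\<Sum>i\<in>A. sg p (f i))"
  by (simp add: sg_def sum_negf)

lemma sg_mult_left [simp]: "sg p x * y = sg p (x * y)"
  and sg_mult_right [simp]: "x * sg p y = sg p (x * y)" for x y :: "'r::ring"
  by (simp_all add: sg_def)

lemma sg_plus_1 [simp]: "sg (p + 1) x = - sg p x" "sg (1 + p) x = - sg p x"
  by (cases p; simp)+

lemma bit_add_self [simp]: "p + p = (0::bit)" "p + (p + q) = (q::bit)"
  by (cases p; cases q; simp)+

lemma bit_mult_self [simp]: "p * p = (p::bit)"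
  by (cases p) simp_all

lemma finite_idx [simp]: "finite (idx n)"
proof -
  have "idx n \<subseteq> {- int n..int n}" by (auto simp: idx_def)
  then show ?thesis by (rule finite_subset) simp
qed

lemma uminus_idx [simp]: "- a \<in> idx n \<longleftrightarrow> a \<in> idx n"
  by (auto simp: idx_def)

lemma idx_nonzero: "a \<in> idx n \<Longrightarrow> a \<noteq> 0"
  by (auto simp: idx_def)

lemma ipar_uminus: "a \<in> idx n \<Longrightarrow> ipar (- a) = ipar a + 1"
  by (auto simp: idx_def ipar_def)

lemma sum_idx_uminus: "(\<Sum>a\<in>idx n. f (- a)) = (\<Sum>a\<in>idx n. f a)"
  by (rule sum.reindex_bij_witness[of _ uminus uminus]) auto

lemma of_int_sgn_eq_sg: "l \<in> idx n \<Longrightarrow> of_int (sgn l) *\<^sub>C x = sg (ipar l) (x::'a::complex_vector)"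
  by (auto simp: idx_def ipar_def cvec.scale_minus_left)

definition matrix_units :: "nat \<Rightarrow> (int \<Rightarrow> int \<Rightarrow> 'r::ring) \<Rightarrow> bool" where
  "matrix_units n m \<longleftrightarrow> (\<forall>a\<in>idx n. \<forall>b\<in>idx n. \<forall>c\<in>idx n. \<forall>e\<in>idx n.
     m a b * m c e = (if b = c then m a e else 0))"

definition supercommute :: "nat \<Rightarrow> (int \<Rightarrow> int \<Rightarrow> 'r::ring) \<Rightarrow> (int \<Rightarrow> int \<Rightarrow> 'r) \<Rightarrow> bool" where
  "supercommute n x y \<longleftrightarrow> (\<forall>a\<in>idx n. \<forall>b\<in>idx n. \<forall>c\<in>idx n. \<forall>e\<in>idx n.
     x a b * y c e = sg ((ipar a + ipar b) * (ipar c + ipar e)) (y c e * x a b))"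

text \<open>The family \<open>x\<close> stands for the images of \<open>E\<^bsub>ab\<^esub> + E\<^bsub>-a,-b\<^esub>\<close>, an element of \<open>q(n)\<close> of parity \<open>|a| + |b|\<close>
  for signed indices.  Thus \<open>e\<^sub>i\<^sub>j\<close> is \<open>x i j\<close>, \<open>f\<^sub>i\<^sub>j\<close> is \<open>x (- i) j\<close>, and the four kinds of brackets of \<open>q(n)\<close>
  become a single formula.\<close>

definition q_rep :: "nat \<Rightarrow> (int \<Rightarrow> int \<Rightarrow> 'r::ring) \<Rightarrow> bool" where
  "q_rep n x \<longleftrightarrow>
     (\<forall>a b. x (- a) (- b) = x a b) \<and>
     (\<forall>a\<in>idx n. \<forall>b\<in>idx n. \<forall>c\<in>idx n. \<forall>e\<in>idx n.
       x a b * x c e = sg ((ipar a + ipar b) * (ipar c + ipar e)) (x c e * x a b)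
         + (if b = c then x a e else 0) + (if b = - c then x a (- e) else 0)
         - sg ((ipar a + ipar b) * (ipar c + ipar e))
             ((if a = e then x c b else 0) + (if a = - e then x c (- b) else 0)))"

definition dbl :: "(int \<Rightarrow> int \<Rightarrow> 'r::ring) \<Rightarrow> int \<Rightarrow> int \<Rightarrow> 'r" where
  "dbl m a b = m a b + m (- a) (- b)"

text \<open>For two families of matrix units this is the super flip \<open>S\<close> of two factors.  For an action \<open>x\<close> of
  \<open>q(n)\<close> it is \<open>\<Omega>\<close>: because \<open>x (- k) (- l) = x k l\<close>, the four terms with indices \<open>\<plusminus>k\<close>, \<open>\<plusminus>l\<close> combine to
  \<open>e\<^bsub>kl\<^esub> \<otimes> (m\<^bsub>lk\<^esub> - m\<^bsub>-l,-k\<^esub>) - f\<^bsub>kl\<^esub> \<otimes> (m\<^bsub>-l,k\<^esub> - m\<^bsub>l,-k\<^esub>)\<close>.\<close>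

definition flip :: "nat \<Rightarrow> (int \<Rightarrow> int \<Rightarrow> 'r::ring) \<Rightarrow> (int \<Rightarrow> int \<Rightarrow> 'r) \<Rightarrow> 'r" where
  "flip n x m = (\<Sum>k\<in>idx n. \<Sum>l\<in>idx n. sg (ipar l) (x k l * m l k))"

text \<open>The odd operator \<open>C\<close>: the matrix \<open>\<Sum>\<^sub>k f_bar k k\<close> written over signed indices.\<close>

definition cliff :: "nat \<Rightarrow> (int \<Rightarrow> int \<Rightarrow> 'r::ring) \<Rightarrow> 'r" where
  "cliff n m = (\<Sum>a\<in>idx n. sg (ipar a) (m (- a) a))"

lemma matrix_unitsD:
  "matrix_units n m \<Longrightarrow> a \<in> idx n \<Longrightarrow> b \<in> idx n \<Longrightarrow> c \<in> idx n \<Longrightarrow> e \<in> idx n \<Longrightarrow>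
     m a b * m c e = (if b = c then m a e else 0)"
  by (simp add: matrix_units_def)

lemma matrix_unitsD3:
  "matrix_units n m \<Longrightarrow> a \<in> idx n \<Longrightarrow> b \<in> idx n \<Longrightarrow> c \<in> idx n \<Longrightarrow> e \<in> idx n \<Longrightarrow>
     m a b * (m c e * z) = (if b = c then m a e * z else 0)"
  by (simp add: matrix_units_def flip: mult.assoc)

lemma supercommuteD:
  "supercommute n x y \<Longrightarrow> a \<in> idx n \<Longrightarrow> b \<in> idx n \<Longrightarrow> c \<in> idx n \<Longrightarrow> e \<in> idx n \<Longrightarrow>
     x a b * y c e = sg ((ipar a + ipar b) * (ipar c + ipar e)) (y c e * x a b)"
  by (simp add: supercommute_def)

lemma supercommuteD3:
  "supercommute n x y \<Longrightarrow> a \<in> idx n \<Longrightarrow> b \<in> idx n \<Longrightarrow> c \<in> idx n \<Longrightarrow> e \<in> idx n \<Longrightarrow>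
     x a b * (y c e * z) = sg ((ipar a + ipar b) * (ipar c + ipar e)) (y c e * (x a b * z))"
  using supercommuteD[of n x y a b c e] by (simp flip: mult.assoc)

lemma supercommute_sym:
  assumes "supercommute n x y"
  shows "supercommute n y x"
  unfolding supercommute_def
proof (intro ballI)
  fix a b c e assume "a \<in> idx n" "b \<in> idx n" "c \<in> idx n" "e \<in> idx n"
  then show "y a b * x c e = sg ((ipar a + ipar b) * (ipar c + ipar e)) (x c e * y a b)"
    using supercommuteD[OF assms, of c e a b] by (simp add: mult.commute[of "_::bit"])
qed

lemma supercommute_add:
  "supercommute n x z \<Longrightarrow> supercommute n y z \<Longrightarrow> supercommute n (\<lambda>a b. x a b + y a b) z"
  by (simp add: supercommute_def distrib_left[of "_::'a::ring"] distrib_right[of "_::'a::ring"] sg_add)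

lemma supercommute_sum:
  "finite J \<Longrightarrow> (\<And>j. j \<in> J \<Longrightarrow> supercommute n (x j) z) \<Longrightarrow> supercommute n (\<lambda>a b. \<Sum>j\<in>J. x j a b) z"
  by (simp add: supercommute_def sum_distrib_left sum_distrib_right sg_sum)

lemma ipar_add_uminus: "a \<in> idx n \<Longrightarrow> b \<in> idx n \<Longrightarrow> ipar (- a) + ipar (- b) = ipar a + ipar b"
  by (simp only: ipar_uminus) (cases "ipar a"; cases "ipar b"; simp)

lemma supercommute_dbl:
  assumes "supercommute n m z"
  shows "supercommute n (dbl m) z"
  unfolding supercommute_def dbl_def
proof (intro ballI)
  fix a b c e assume I: "a \<in> idx n" "b \<in> idx n" "c \<in> idx n" "e \<in> idx n"
  then have "- a \<in> idx n" "- b \<in> idx n" by simp_all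
  from supercommuteD[OF assms this I(3,4)] supercommuteD[OF assms I]
  show "(m a b + m (- a) (- b)) * z c e
      = sg ((ipar a + ipar b) * (ipar c + ipar e)) (z c e * (m a b + m (- a) (- b)))"
    unfolding ipar_add_uminus[OF I(1,2)] distrib_right[of "m _ _"] distrib_left[of "z _ _"] sg_add
    by simp
qed

lemma q_rep_uminus: "q_rep n x \<Longrightarrow> x (- a) (- b) = x a b"
  unfolding q_rep_def by blast

lemma q_rep_uminus': "q_rep n x \<Longrightarrow> x (- a) b = x a (- b)"
  using q_rep_uminus[of n x a "- b"] by simp

lemma q_repD:
  "q_rep n x \<Longrightarrow> a \<in> idx n \<Longrightarrow> b \<in> idx n \<Longrightarrow> c \<in> idx n \<Longrightarrow> e \<in> idx n \<Longrightarrow>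
     x a b * x c e = sg ((ipar a + ipar b) * (ipar c + ipar e)) (x c e * x a b)
         + (if b = c then x a e else 0) + (if b = - c then x a (- e) else 0)
         - sg ((ipar a + ipar b) * (ipar c + ipar e))
             ((if a = e then x c b else 0) + (if a = - e then x c (- b) else 0))"
  unfolding q_rep_def by blast

lemma if_add_zero: "(if P then x + y else 0) = (if P then x else 0) + (if P then y else (0::'r::ab_group_add))"
  by simp

lemma q_rep_add:
  assumes "q_rep n x" "q_rep n y" "supercommute n x y"
  shows "q_rep n (\<lambda>a b. x a b + y a b)"
proof -
  have yx: "supercommute n y x" using assms(3) by (rule supercommute_sym)
  show ?thesis
    unfolding q_rep_def
  proof (intro conjI allI ballI)
    fix a b c e assume I: "a \<in> idx n" "b \<in> idx n" "c \<in> idx n" "e \<in> idx n"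
    let ?p = "(ipar a + ipar b) * (ipar c + ipar e)"
    have "(x a b + y a b) * (x c e + y c e) = x a b * x c e + x a b * y c e + (y a b * x c e + y a b * y c e)"
      by (simp only: distrib_left distrib_right add.assoc add.commute add.left_commute)
    also have "\<dots> = sg ?p ((x c e + y c e) * (x a b + y a b))
         + (if b = c then x a e + y a e else 0) + (if b = - c then x a (- e) + y a (- e) else 0)
         - sg ?p
             ((if a = e then x c b + y c b else 0) + (if a = - e then x c (- b) + y c (- b) else 0))"
      unfolding q_repD[OF assms(1) I] q_repD[OF assms(2) I] supercommuteD[OF assms(3) I]
        supercommuteD[OF yx I] if_add_zero
      by (cases ?p) (simp_all only: sg_0 sg_1 algebra_simps minus_add_distrib minus_diff_eq diff_conv_add_uminus minus_minus)
    finally show "(x a b + y a b) * (x c e + y c e) = \<dots>" .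
  qed (simp add: q_rep_uminus[OF assms(1)] q_rep_uminus[OF assms(2)])
qed

text \<open>The natural representation of \<open>q(n)\<close> on \<open>V\<close>.\<close>

lemma q_rep_dbl:
  assumes "matrix_units n m"
  shows "q_rep n (dbl m)"
  unfolding q_rep_def dbl_def
proof (intro conjI allI ballI)
  fix a b c e assume I: "a \<in> idx n" "b \<in> idx n" "c \<in> idx n" "e \<in> idx n"
  then have J: "- a \<in> idx n" "- b \<in> idx n" "- c \<in> idx n" "- e \<in> idx n" by simp_all
  show "(m a b + m (- a) (- b)) * (m c e + m (- c) (- e)) = sg ((ipar a + ipar b) * (ipar c + ipar e))
          ((m c e + m (- c) (- e)) * (m a b + m (- a) (- b)))
         + (if b = c then m a e + m (- a) (- e) else 0) + (if b = - c then m a (- e) + m (- a) (- (- e)) else 0)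
         - sg ((ipar a + ipar b) * (ipar c + ipar e))
             ((if a = e then m c b + m (- c) (- b) else 0) + (if a = - e then m c (- b) + m (- c) (- (- b)) else 0))"
    unfolding distrib_left distrib_right matrix_unitsD[OF assms I] matrix_unitsD[OF assms J]
      matrix_unitsD[OF assms I(1,2) J(3,4)] matrix_unitsD[OF assms J(1,2) I(3,4)]
      matrix_unitsD[OF assms I(3,4,1,2)] matrix_unitsD[OF assms J(3,4,1,2)]
      matrix_unitsD[OF assms I(3,4) J(1,2)] matrix_unitsD[OF assms J(3,4) I(1,2)]
    using I[THEN idx_nonzero] by (auto simp: sg_def)
qed (simp add: add.commute)

lemma q_rep_add_sum_dbl:
  assumes "finite J" "q_rep n x" "\<And>j. j \<in> J \<Longrightarrow> matrix_units n (m j)"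
    "\<And>j. j \<in> J \<Longrightarrow> supercommute n x (m j)"
    "\<And>i j. i \<in> J \<Longrightarrow> j \<in> J \<Longrightarrow> i \<noteq> j \<Longrightarrow> supercommute n (m i) (m j)"
  shows "q_rep n (\<lambda>a b. x a b + (\<Sum>j\<in>J. dbl (m j) a b))"
  using assms
proof (induction J rule: finite_induct)
  case (insert i J)
  let ?y = "\<lambda>a b. x a b + (\<Sum>j\<in>J. dbl (m j) a b)"
  have "supercommute n ?y (m i)"
  proof (intro supercommute_add supercommute_sum supercommute_dbl)
    show "supercommute n x (m i)" by (rule insert.prems(3)) simp
    show "supercommute n (m j) (m i)" if "j \<in> J" for j
      using that insert.hyps(2) by (intro insert.prems(4)) auto
  qed (rule insert.hyps)
  then have "supercommute n ?y (dbl (m i))"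
    by (rule supercommute_sym[OF supercommute_dbl[OF supercommute_sym]])
  moreover have "q_rep n ?y"
    using insert.prems by (intro insert.IH) simp_all
  moreover have "q_rep n (dbl (m i))"
    by (rule q_rep_dbl, rule insert.prems(2)) simp
  ultimately have "q_rep n (\<lambda>a b. ?y a b + dbl (m i) a b)"
    by (rule q_rep_add[of n ?y "dbl (m i)", rotated 2])
  moreover have "(\<lambda>a b. ?y a b + dbl (m i) a b) = (\<lambda>a b. x a b + (\<Sum>j\<in>insert i J. dbl (m j) a b))"
    by (intro ext) (simp add: insert.hyps ac_simps)
  ultimately show ?case by simp
qed simp

lemma flip_mult_right:
  assumes "matrix_units n m" "a \<in> idx n" "b \<in> idx n"
  shows "flip n x m * m a b = (\<Sum>l\<in>idx n. sg (ipar l) (x a l * m l b))"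
proof -
  have "flip n x m * m a b = (\<Sum>k\<in>idx n. \<Sum>l\<in>idx n. if k = a then sg (ipar l) (x k l * m l b) else 0)"
    unfolding flip_def
    by (simp add: sum_distrib_right mult.assoc matrix_unitsD[OF assms(1)] assms if_distrib[of "sg _"]
        if_distrib[of "\<lambda>x. _ * x"] cong: sum.cong_simp if_cong)
  also have "\<dots> = (\<Sum>l\<in>idx n. sg (ipar l) (x a l * m l b))"
    by (subst sum.swap) (simp add: assms)
  finally show ?thesis .
qed

lemma flip_mult_left:
  assumes "matrix_units n m" "supercommute n x m" "a \<in> idx n" "b \<in> idx n"
  shows "m a b * flip n x m = (\<Sum>k\<in>idx n. sg (ipar b + (ipar a + ipar b) * (ipar k + ipar b)) (x k b * m a k))"
  unfolding flip_def
  by (simp add: sum_distrib_left supercommuteD3[OF supercommute_sym[OF assms(2)]]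
      matrix_unitsD[OF assms(1)] assms if_distrib[of "sg _"] if_distrib[of "\<lambda>x. _ * x"] cong: sum.cong_simp if_cong)

lemma flip_mult_right':
  assumes "matrix_units n m" "matrix_units n m'" "supercommute n m m'" "a \<in> idx n" "b \<in> idx n"
  shows "flip n m m' * m a b = (\<Sum>k\<in>idx n. sg (ipar a + (ipar a + ipar k) * (ipar a + ipar b)) (m k b * m' a k))"
  unfolding flip_def
  by (simp add: sum_distrib_right mult.assoc supercommuteD[OF supercommute_sym[OF assms(3)]]
      matrix_unitsD3[OF assms(1)] assms if_distrib[of "sg _"] cong: sum.cong_simp if_cong)

lemma flip_sign: "a + (a + b) * (k + a) = b + (a + b) * (k + b)" for a b k :: bit
  by (cases a; cases b; cases k) simp_all

text \<open>Conjugation by the super flip exchanges the two factors.  No sign appears because the flip is even;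
  in coordinates this is the identity \<open>flip_sign\<close> between the exponents.\<close>

lemma flip_intertwine:
  assumes "matrix_units n m" "matrix_units n m'" "supercommute n m m'" "a \<in> idx n" "b \<in> idx n"
  shows "flip n m m' * m a b = m' a b * flip n m m'"
  unfolding flip_mult_left[OF assms(2-)] flip_mult_right'[OF assms]
  by (subst flip_sign[symmetric]) (simp add: ac_simps)

lemma flip_intertwine':
  assumes "matrix_units n m" "matrix_units n m'" "a \<in> idx n" "b \<in> idx n"
  shows "flip n m m' * m' a b = m a b * flip n m m'"
proof -
  have "m a b * flip n m m' = (\<Sum>k\<in>idx n. \<Sum>l\<in>idx n. if k = b then sg (ipar l) (m a l * m' l k) else 0)"
    unfolding flip_def sum_distrib_left
    by (intro sum.cong refl) (simp add: matrix_unitsD3[OF assms(1)] assms(3,4))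
  also have "\<dots> = (\<Sum>l\<in>idx n. sg (ipar l) (m a l * m' l b))"
    by (subst sum.swap) (simp add: assms)
  finally show ?thesis
    unfolding flip_mult_right[OF assms(2-)] by simp
qed

lemma supercommute_flip:
  assumes "supercommute n x m" "supercommute n x m'" "a \<in> idx n" "b \<in> idx n"
  shows "flip n m m' * x a b = x a b * flip n m m'"
  unfolding flip_def
  by (simp add: sum_distrib_left sum_distrib_right mult.assoc supercommuteD3[OF assms(1)]
      supercommuteD[OF assms(2)] assms(3,4) add.commute mult.commute[of "_::bit"] cong: sum.cong_simp)

text \<open>Moving one flip through the matrix units of the other one leaves \<open>\<Sum> m\<^bsub>bb\<^esub> m'\<^bsub>aa\<^esub>\<close>, the product of
  the identities of the two factors.\<close>

lemma flip_square:
  assumes "matrix_units n m" "matrix_units n m'" "supercommute n m m'"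
  shows "flip n m m' * flip n m m' = (\<Sum>k\<in>idx n. m k k) * (\<Sum>l\<in>idx n. m' l l)"
proof -
  have "flip n m m' * flip n m m' = (\<Sum>a\<in>idx n. \<Sum>b\<in>idx n. sg (ipar b) ((flip n m m' * m a b) * m' b a))"
    by (subst (2) flip_def) (simp add: sum_distrib_left mult.assoc)
  also have "\<dots> = (\<Sum>a\<in>idx n. \<Sum>b\<in>idx n. m b b * m' a a)"
  proof (intro sum.cong refl)
    fix a b assume I: "a \<in> idx n" "b \<in> idx n"
    have "flip n m m' * m a b * m' b a
        = (\<Sum>k\<in>idx n. if k = b then sg (ipar a + (ipar a + ipar b) * (ipar a + ipar b)) (m b b * m' a a) else 0)"
      unfolding flip_mult_right'[OF assms I] sum_distrib_right
      by (intro sum.cong refl) (auto simp: mult.assoc matrix_unitsD[OF assms(2)] I)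
    then show "sg (ipar b) (flip n m m' * m a b * m' b a) = m b b * m' a a"
      using I by (cases "ipar a"; cases "ipar b") simp_all
  qed
  also have "\<dots> = (\<Sum>k\<in>idx n. m k k) * (\<Sum>l\<in>idx n. m' l l)"
    by (simp add: sum_distrib_left sum_distrib_right)
  finally show ?thesis .
qed

lemma cliff_mult:
  assumes "matrix_units n m" "a \<in> idx n" "b \<in> idx n"
  shows "cliff n m * m a b = sg (ipar a) (m (- a) b)"
  and "m a b * cliff n m = - sg (ipar b) (m a (- b))"
proof -
  show "cliff n m * m a b = sg (ipar a) (m (- a) b)"
    unfolding cliff_def by (simp add: sum_distrib_right matrix_unitsD[OF assms(1)] assms if_distrib[of "sg _"] cong: sum.cong_simp if_cong)
  have "m a b * cliff n m = (\<Sum>c\<in>idx n. if c = - b then sg (ipar c) (m a c) else 0)"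
    unfolding cliff_def sum_distrib_left
    by (intro sum.cong refl) (auto simp: matrix_unitsD[OF assms(1)] assms)
  then show "m a b * cliff n m = - sg (ipar b) (m a (- b))"
    using assms by (simp add: ipar_uminus)
qed

lemma cliff_square:
  assumes "matrix_units n m"
  shows "cliff n m * cliff n m = - (\<Sum>k\<in>idx n. m k k)"
proof -
  have "cliff n m * cliff n m = (\<Sum>a\<in>idx n. sg (ipar a) (cliff n m * m (- a) a))"
    by (subst (2) cliff_def) (simp add: sum_distrib_left)
  also have "\<dots> = (\<Sum>a\<in>idx n. - m a a)"
    by (intro sum.cong refl) (simp add: cliff_mult[OF assms] ipar_uminus sg_minus)
  finally show ?thesis by (simp add: sum_negf)
qed

lemma supercommute_cliff:
  assumes "supercommute n x m" "a \<in> idx n" "b \<in> idx n"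
  shows "cliff n m * x a b = sg (ipar a + ipar b) (x a b * cliff n m)"
  unfolding cliff_def sum_distrib_left sum_distrib_right sg_sum
proof (intro sum.cong refl)
  fix c assume c: "c \<in> idx n"
  have "ipar (- c) + ipar c = 1" using c by (cases "ipar c") (simp_all add: ipar_uminus)
  then show "sg (ipar c) (m (- c) c) * x a b = sg (ipar a + ipar b) (x a b * sg (ipar c) (m (- c) c))"
    using supercommuteD[OF supercommute_sym[OF assms(1)], of "- c" c a b] c assms(2,3)
    by (simp add: ac_simps)
qed

lemma cliff_anticommute:
  assumes "supercommute n m m'"
  shows "cliff n m * cliff n m' = - (cliff n m' * cliff n m)"
proof -
  have "cliff n m' * cliff n m = (\<Sum>a\<in>idx n. sg (ipar a) (cliff n m' * m (- a) a))"
    by (subst (2) cliff_def) (simp add: sum_distrib_left)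
  also have "\<dots> = (\<Sum>a\<in>idx n. - (sg (ipar a) (m (- a) a) * cliff n m'))"
  proof (intro sum.cong refl)
    fix a assume a: "a \<in> idx n"
    have "ipar (- a) + ipar a = 1" using a by (cases "ipar a") (simp_all add: ipar_uminus)
    then show "sg (ipar a) (cliff n m' * m (- a) a) = - (sg (ipar a) (m (- a) a) * cliff n m')"
      using supercommute_cliff[OF assms, of "- a" a] a by (simp add: sg_minus)
  qed
  also have "\<dots> = - (cliff n m * cliff n m')"
    by (simp add: sum_negf cliff_def sum_distrib_right)
  finally show ?thesis by simp
qed

lemma cliff_dbl:
  assumes "matrix_units n m" "a \<in> idx n" "b \<in> idx n"
  shows "cliff n m * dbl m a b = sg (ipar a + ipar b) (dbl m a b * cliff n m)"
  unfolding dbl_def distrib_left distrib_right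
  using assms(2,3) by (cases "ipar a"; cases "ipar b") (simp_all add: cliff_mult[OF assms(1)] ipar_uminus)

lemma cliff_flip:
  assumes "matrix_units n m" "supercommute n x m" "\<And>a b. x (- a) (- b) = x a b"
  shows "cliff n m * flip n x m = - (flip n x m * cliff n m)"
proof -
  have "cliff n m * flip n x m = (\<Sum>k\<in>idx n. \<Sum>l\<in>idx n. sg (ipar l + (ipar k + ipar l)) (x k l * (cliff n m * m l k)))"
    unfolding flip_def sum_distrib_left sg_mult_right
    by (intro sum.cong refl) (simp add: supercommute_cliff[OF assms(2)] flip: mult.assoc)
  also have "\<dots> = (\<Sum>k\<in>idx n. \<Sum>l\<in>idx n. sg (ipar k + ipar l) (x k l * m (- l) k))"
    by (intro sum.cong refl) (simp add: cliff_mult[OF assms(1)] ac_simps)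
  finally have 1: "cliff n m * flip n x m = (\<Sum>k\<in>idx n. \<Sum>l\<in>idx n. sg (ipar k + ipar l) (x k l * m (- l) k))" .
  have "flip n x m * cliff n m = (\<Sum>k\<in>idx n. \<Sum>l\<in>idx n. - sg (ipar k + ipar l) (x k l * m l (- k)))"
    unfolding flip_def sum_distrib_right
    by (intro sum.cong refl) (simp add: cliff_mult[OF assms(1)] mult.assoc sg_minus ac_simps)
  also have "\<dots> = (\<Sum>k\<in>idx n. \<Sum>l\<in>idx n. - sg (ipar (- k) + ipar (- l)) (x (- k) (- l) * m (- l) (- (- k))))"
    by (subst (1 2) sum_idx_uminus[symmetric]) (rule refl)
  also have "\<dots> = - (cliff n m * flip n x m)"
    unfolding 1 sum_negf[symmetric]
    by (intro sum.cong refl) (simp add: assms(3) ipar_add_uminus)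
  finally show ?thesis by simp
qed

lemma odd_commute_flip:
  assumes "\<And>k l. k \<in> idx n \<Longrightarrow> l \<in> idx n \<Longrightarrow> c * x k l = sg (ipar k + ipar l) (x k l * c)"
    and "\<And>k l. k \<in> idx n \<Longrightarrow> l \<in> idx n \<Longrightarrow> c * m k l = sg (ipar k + ipar l) (m k l * c)"
  shows "c * flip n x m = flip n x m * c"
  unfolding flip_def sum_distrib_left sum_distrib_right
proof (intro sum.cong refl)
  fix k l assume I: "k \<in> idx n" "l \<in> idx n"
  have "c * (x k l * m l k) = sg (ipar k + ipar l) (x k l * (c * m l k))"
    using assms(1)[OF I] by (simp flip: mult.assoc)
  then show "c * sg (ipar l) (x k l * m l k) = sg (ipar l) (x k l * m l k) * c"
    using assms(2)[OF I(2,1)] by (simp add: mult.assoc ac_simps)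
qed

lemma even_commute_flip:
  assumes "\<And>k l. k \<in> idx n \<Longrightarrow> l \<in> idx n \<Longrightarrow> c * x k l = x k l * c"
    and "\<And>k l. k \<in> idx n \<Longrightarrow> l \<in> idx n \<Longrightarrow> c * m k l = m k l * c"
  shows "c * flip n x m = flip n x m * c"
  unfolding flip_def sum_distrib_left sum_distrib_right
proof (intro sum.cong refl)
  fix k l assume I: "k \<in> idx n" "l \<in> idx n"
  have "c * (x k l * m l k) = x k l * (c * m l k)"
    using assms(1)[OF I] by (simp flip: mult.assoc)
  then show "c * sg (ipar l) (x k l * m l k) = sg (ipar l) (x k l * m l k) * c"
    using assms(2)[OF I(2,1)] by (simp add: mult.assoc)
qed

lemma flip_add: "flip n (\<lambda>a b. x a b + y a b) m = flip n x m + flip n y m"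
  by (simp add: flip_def distrib_right sg_add sum.distrib)

lemma flip_sum: "finite J \<Longrightarrow> flip n (\<lambda>a b. \<Sum>j\<in>J. x j a b) m = (\<Sum>j\<in>J. flip n (x j) m)"
  by (induction J rule: finite_induct) (simp_all add: flip_add, simp add: flip_def)

text \<open>The summand \<open>(1 - C\<^sub>jC\<^sub>i)S\<^bsub>ji\<^esub>\<close> in the action of \<open>x\<^sub>i\<close> is nothing but \<open>\<Omega>\<close> for \<open>q(n)\<close> acting on factor \<open>j\<close>: the
  product with both Clifford operators replaces \<open>m\<^bsub>kl\<^esub>\<close> by \<open>m\<^bsub>-k,-l\<^esub>\<close> up to sign.\<close>

lemma flip_dbl:
  assumes "matrix_units n m" "matrix_units n m'" "supercommute n m m'"
  shows "flip n (dbl m) m' = flip n m m' - cliff n m * (cliff n m' * flip n m m')"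
proof -
  have "cliff n m * (cliff n m' * flip n m m')
      = (\<Sum>k\<in>idx n. \<Sum>l\<in>idx n. sg (ipar l) (m (- k) l * m' (- l) k))"
    unfolding flip_def sum_distrib_left
  proof (intro sum.cong refl)
    fix k l assume I: "k \<in> idx n" "l \<in> idx n"
    have "cliff n m' * sg (ipar l) (m k l * m' l k) = sg (ipar k) (m k l * (cliff n m' * m' l k))"
      using supercommute_cliff[OF assms(3) I] by (simp add: ac_simps flip: mult.assoc)
    also have "\<dots> = sg (ipar k + ipar l) (m k l * m' (- l) k)"
      using I by (simp add: cliff_mult[OF assms(2)])
    finally show "cliff n m * (cliff n m' * sg (ipar l) (m k l * m' l k)) = sg (ipar l) (m (- k) l * m' (- l) k)"
      using I by (simp add: cliff_mult[OF assms(1)] ac_simps flip: mult.assoc)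
  qed
  also have "\<dots> = (\<Sum>k\<in>idx n. \<Sum>l\<in>idx n. - sg (ipar l) (m (- k) (- l) * m' l k))"
    by (intro sum.cong[OF refl] trans[OF sum_idx_uminus[symmetric]]) (simp add: ipar_uminus)
  finally show ?thesis
    by (simp add: flip_def dbl_def distrib_right sg_add sum.distrib sum_negf)
qed

text \<open>\<open>\<Omega>\<close> commutes with \<open>q(n)\<close> acting on both factors.  The bracket of \<open>x a b\<close> with the terms of \<open>\<Omega>\<close> produces
  four sums \<open>A\<close>, \<open>B\<close>, \<open>C\<close>, \<open>D\<close>, one for each delta in the bracket formula.  The same four sums arise when
  \<open>m a b\<close> and \<open>m (- a) (- b)\<close> are multiplied by \<open>\<Omega>\<close> from either side, with the opposite sign.\<close>

lemma casimir_commute: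
  assumes x: "q_rep n x" and m: "matrix_units n m" and xm: "supercommute n x m"
    and ab: "a \<in> idx n" "b \<in> idx n"
  shows "(x a b + dbl m a b) * flip n x m = flip n x m * (x a b + dbl m a b)"
proof -
  let ?A = "\<Sum>l\<in>idx n. sg (ipar l) (x a l * m l b)"
  let ?B = "\<Sum>l\<in>idx n. sg (ipar l) (x (- a) l * m l (- b))"
  let ?C = "\<Sum>k\<in>idx n. sg (ipar b + (ipar a + ipar b) * (ipar k + ipar b)) (x k b * m a k)"
  let ?D = "\<Sum>k\<in>idx n. sg (ipar (- b) + (ipar (- a) + ipar (- b)) * (ipar k + ipar (- b))) (x k (- b) * m (- a) k)"
  let ?s = "\<lambda>k l. (ipar a + ipar b) * (ipar k + ipar l)"
  have "x a b * flip n x m = (\<Sum>k\<in>idx n. \<Sum>l\<in>idx n.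
      sg (ipar l) (x k l * m l k * x a b)
      + (if k = b then sg (ipar l) (x a l * m l k) else 0)
      + (if k = - b then sg (ipar l) (x a (- l) * m l k) else 0)
      - (if l = a then sg (ipar l + ?s k l) (x k b * m l k) else 0)
      - (if l = - a then sg (ipar l + ?s k l) (x k (- b) * m l k) else 0))"
    unfolding flip_def sum_distrib_left
  proof (intro sum.cong refl)
    fix k l assume kl: "k \<in> idx n" "l \<in> idx n"
    have eq: "x k l * m l k * x a b = sg (?s k l) (x k l * x a b * m l k)"
      unfolding mult.assoc supercommuteD[OF supercommute_sym[OF xm] kl(2,1) ab]
      by (simp add: ac_simps)
    have iffs: "b = k \<longleftrightarrow> k = b" "b = - k \<longleftrightarrow> k = - b" "a = l \<longleftrightarrow> l = a" "a = - l \<longleftrightarrow> l = - a"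
      by auto
    have "x a b * (x k l * m l k) = (sg (?s k l) (x k l * x a b)
         + (if k = b then x a l else 0) + (if k = - b then x a (- l) else 0)
         - sg (?s k l) ((if l = a then x k b else 0) + (if l = - a then x k (- b) else 0))) * m l k"
      unfolding mult.assoc[symmetric] q_repD[OF x ab kl] iffs ..
    also have "\<dots> = sg (?s k l) (x k l * x a b * m l k)
         + (if k = b then x a l * m l k else 0) + (if k = - b then x a (- l) * m l k else 0)
         - (if l = a then sg (?s k l) (x k b * m l k) else 0)
         - (if l = - a then sg (?s k l) (x k (- b) * m l k) else 0)"
      by (simp add: distrib_right left_diff_distrib sg_add)
    finally show "x a b * sg (ipar l) (x k l * m l k) = sg (ipar l) (x k l * m l k * x a b)
      + (if k = b then sg (ipar l) (x a l * m l k) else 0)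
      + (if k = - b then sg (ipar l) (x a (- l) * m l k) else 0)
      - (if l = a then sg (ipar l + ?s k l) (x k b * m l k) else 0)
      - (if l = - a then sg (ipar l + ?s k l) (x k (- b) * m l k) else 0)"
      unfolding eq by (simp add: sg_add sg_diff)
  qed
  also have "\<dots> = flip n x m * x a b
      + (\<Sum>l\<in>idx n. \<Sum>k\<in>idx n. if k = b then sg (ipar l) (x a l * m l k) else 0)
      + (\<Sum>l\<in>idx n. \<Sum>k\<in>idx n. if k = - b then sg (ipar l) (x a (- l) * m l k) else 0)
      - (\<Sum>k\<in>idx n. \<Sum>l\<in>idx n. if l = a then sg (ipar l + ?s k l) (x k b * m l k) else 0)
      - (\<Sum>k\<in>idx n. \<Sum>l\<in>idx n. if l = - a then sg (ipar l + ?s k l) (x k (- b) * m l k) else 0)"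
    unfolding sum.distrib sum_subtractf flip_def sum_distrib_right sg_mult_left
    by (subst (4 5) sum.swap) (rule refl)
  also have "\<dots> = flip n x m * x a b + ?A + ?B - ?C - ?D"
  proof -
    have s1: "ipar a + (ipar a + ipar b) * (ipar k + ipar a) = ipar b + (ipar a + ipar b) * (ipar k + ipar b)" for k
      by (rule flip_sign)
    have s2: "ipar (- a) + (ipar a + ipar b) * (ipar k + ipar (- a))
        = ipar (- b) + (ipar (- a) + ipar (- b)) * (ipar k + ipar (- b))" for k
      unfolding ipar_add_uminus[OF ab, symmetric] by (rule flip_sign)
    show ?thesis
      using ab by (simp add: s1 s2 q_rep_uminus'[OF x])
  qed
  finally have "x a b * flip n x m = flip n x m * x a b + ?A + ?B - ?C - ?D" .
  moreover have "flip n x m * m a b = ?A" "flip n x m * m (- a) (- b) = ?B"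
    using ab by (simp_all add: flip_mult_right[OF m])
  moreover have "m a b * flip n x m = ?C" "m (- a) (- b) * flip n x m = ?D"
    using ab by (simp_all add: flip_mult_left[OF m xm])
  ultimately show ?thesis
    by (simp add: distrib_left distrib_right dbl_def)
qed

section \<open>The Hecke-Clifford relations\<close>

lemma flip_flip_intertwine:
  assumes "matrix_units n m" "matrix_units n m'" "supercommute n m m'"
    and "supercommute n x m" "supercommute n x m'"
  shows "flip n m m' * flip n x m = flip n x m' * flip n m m'"
proof -
  have "flip n m m' * flip n x m = (\<Sum>k\<in>idx n. \<Sum>l\<in>idx n. sg (ipar l) (x k l * (flip n m m' * m l k)))"
    unfolding flip_def[of n x m] sum_distrib_left sg_mult_right
    by (intro sum.cong refl) (simp add: supercommute_flip[OF assms(4,5)] flip: mult.assoc)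
  also have "\<dots> = flip n x m' * flip n m m'"
    unfolding flip_def[of n x m'] sum_distrib_right
    by (intro sum.cong refl) (simp add: flip_intertwine[OF assms(1-3)] mult.assoc)
  finally show ?thesis .
qed

text \<open>The operators on \<open>M \<otimes> V\<^sup>d\<close> as elements of a ring: \<open>x\<close> acts in factor \<open>0\<close>, the matrix units \<open>m i\<close> act in
  factor \<open>i\<close>, and \<open>p\<close> is the common identity, which may differ from the unit of the ambient ring.\<close>

locale q_tensor =
  fixes n d :: nat and x :: "int \<Rightarrow> int \<Rightarrow> 'r::ring" and m :: "nat \<Rightarrow> int \<Rightarrow> int \<Rightarrow> 'r" and p :: 'r
  assumes x: "q_rep n x"
    and m: "i \<in> {1..d} \<Longrightarrow> matrix_units n (m i)"
    and xm: "i \<in> {1..d} \<Longrightarrow> supercommute n x (m i)"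
    and mm: "i \<in> {1..d} \<Longrightarrow> j \<in> {1..d} \<Longrightarrow> i \<noteq> j \<Longrightarrow> supercommute n (m i) (m j)"
    and p: "i \<in> {1..d} \<Longrightarrow> (\<Sum>k\<in>idx n. m i k k) = p"
begin

text \<open>The action of \<open>q(n)\<close> on the factors before \<open>i\<close>; for \<open>i = d + 1\<close> these are all factors.\<close>

definition y :: "nat \<Rightarrow> int \<Rightarrow> int \<Rightarrow> 'r" where
  "y i = (\<lambda>a b. x a b + (\<Sum>j\<in>{1..<i}. dbl (m j) a b))"

abbreviation s :: "nat \<Rightarrow> 'r" where "s i \<equiv> flip n (m i) (m (i + 1))"
abbreviation c :: "nat \<Rightarrow> 'r" where "c i \<equiv> cliff n (m i)"
abbreviation X :: "nat \<Rightarrow> 'r" where "X i \<equiv> flip n (y i) (m i)"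

lemma q_rep_y: "i \<le> d + 1 \<Longrightarrow> q_rep n (y i)"
  unfolding y_def by (rule q_rep_add_sum_dbl) (auto intro: x m xm mm)

lemma y_m: "i \<le> j \<Longrightarrow> j \<in> {1..d} \<Longrightarrow> supercommute n (y i) (m j)"
  unfolding y_def
  by (rule supercommute_add[OF xm supercommute_sum[OF _ supercommute_dbl[OF mm]]]) auto

lemma y_Suc: "i \<ge> 1 \<Longrightarrow> y (Suc i) = (\<lambda>a b. y i a b + dbl (m i) a b)"
  by (simp add: y_def add.assoc)

lemma p_m [simp]:
  assumes "i \<in> {1..d}" "a \<in> idx n" "b \<in> idx n"
  shows "p * m i a b = m i a b" "m i a b * p = m i a b"
  unfolding p[OF assms(1), symmetric]
  by (simp_all add: sum_distrib_left sum_distrib_right matrix_unitsD[OF m[OF assms(1)]] assms(2,3) cong: sum.cong_simp)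

lemma c_p: "i \<in> {1..d} \<Longrightarrow> c i * p = c i"
  by (simp add: cliff_def sum_distrib_right)

lemma p_p: "i \<in> {1..d} \<Longrightarrow> p * p = p"
  by (subst (2 3) p[of i, symmetric]) (simp_all add: sum_distrib_left)

lemma X_y_Suc:
  assumes "j \<in> {1..d}" "a \<in> idx n" "b \<in> idx n"
  shows "X j * y (Suc j) a b = y (Suc j) a b * X j"
  using casimir_commute[OF q_rep_y[of j] m[of j] y_m[of j j], of a b] assms y_Suc[of j] by simp

text \<open>\<open>X j\<close> is \<open>\<Omega>\<close> for the factors before \<open>j\<close> and factor \<open>j\<close>.  It commutes with \<open>q(n)\<close> on these factors, and
  being even it commutes with everything in the later factors.\<close>

lemma X_y:
  assumes "j \<in> {1..d}" "j < i" "i \<le> d + 1" "a \<in> idx n" "b \<in> idx n"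
  shows "X j * y i a b = y i a b * X j"
  using assms(2,3)
proof (induction i)
  case (Suc i)
  show ?case
  proof (cases "i = j")
    case True
    then show ?thesis using X_y_Suc assms by simp
  next
    case False
    with Suc have i: "j < i" "i \<in> {1..d}" "i \<noteq> j" "i \<ge> 1" by auto
    have "X j * dbl (m i) a b = dbl (m i) a b * X j"
      using assms i
      by (intro supercommute_flip supercommute_dbl mm supercommute_sym[OF y_m]) auto
    moreover have "X j * y i a b = y i a b * X j" using Suc i by simp
    ultimately show ?thesis by (simp add: y_Suc[OF i(4)] distrib_left distrib_right)
  qed
qed simp

lemma s_y_le:
  assumes "i \<in> {1..<d}" "j \<le> i" "a \<in> idx n" "b \<in> idx n"
  shows "s i * y j a b = y j a b * s i"
  using assms by (intro supercommute_flip y_m) auto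

text \<open>The action on all factors is symmetric in factors \<open>i\<close> and \<open>i + 1\<close>, which \<open>s i\<close> exchanges.\<close>

lemma s_y:
  assumes "i \<in> {1..<d}" "i + 1 < j" "j \<le> d + 1" "a \<in> idx n" "b \<in> idx n"
  shows "s i * y j a b = y j a b * s i"
  using assms(2,3)
proof (induction j)
  case (Suc j)
  show ?case
  proof (cases "j = i + 1")
    case True
    have "s i * dbl (m i) a b = dbl (m (i + 1)) a b * s i" "s i * dbl (m (i + 1)) a b = dbl (m i) a b * s i"
      unfolding dbl_def distrib_left distrib_right
      using assms by (simp_all add: flip_intertwine[OF m m mm] flip_intertwine'[OF m m])
    moreover have "y (Suc j) = (\<lambda>a b. y i a b + dbl (m i) a b + dbl (m (i + 1)) a b)"
      using True assms by (simp add: y_Suc)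
    ultimately show ?thesis
      using s_y_le[of i i a b] assms by (simp add: distrib_left distrib_right add.assoc add.commute)
  next
    case False
    then have j: "i + 1 < j" "j \<in> {1..d}" "j \<ge> 1" using Suc by auto
    have "s i * dbl (m j) a b = dbl (m j) a b * s i"
      using assms j by (intro supercommute_flip supercommute_dbl mm) auto
    moreover have "s i * y j a b = y j a b * s i" using Suc j by simp
    ultimately show ?thesis by (simp add: y_Suc[OF j(3)] distrib_left distrib_right)
  qed
qed simp

lemma c_y_le:
  assumes "j \<in> {1..d}" "i \<le> j" "a \<in> idx n" "b \<in> idx n"
  shows "c j * y i a b = sg (ipar a + ipar b) (y i a b * c j)"
  using assms by (intro supercommute_cliff y_m) auto

lemma c_y:
  assumes "j \<in> {1..d}" "j < i" "i \<le> d + 1" "a \<in> idx n" "b \<in> idx n"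
  shows "c j * y i a b = sg (ipar a + ipar b) (y i a b * c j)"
  using assms(2,3)
proof (induction i)
  case (Suc i)
  then have i: "i \<ge> 1" "i \<in> {1..d}" using assms by auto
  have "c j * y i a b = sg (ipar a + ipar b) (y i a b * c j)"
    using Suc c_y_le[of j i] assms by (cases "i = j") auto
  moreover have "c j * dbl (m i) a b = sg (ipar a + ipar b) (dbl (m i) a b * c j)"
  proof (cases "i = j")
    case True
    then show ?thesis using assms by (simp add: cliff_dbl[OF m])
  next
    case False
    then show ?thesis using i assms by (intro supercommute_cliff supercommute_dbl mm) auto
  qed
  ultimately show ?case by (simp add: y_Suc[OF i(1)] distrib_left distrib_right sg_add)
qed simp

lemma c_y_all:
  assumes "j \<in> {1..d}" "i \<le> d + 1" "a \<in> idx n" "b \<in> idx n"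
  shows "c j * y i a b = sg (ipar a + ipar b) (y i a b * c j)"
  using c_y_le[of j i] c_y[of j i] assms by (cases "i \<le> j") auto

lemma X_X_less:
  assumes "j \<in> {1..d}" "i \<in> {1..d}" "j < i"
  shows "X j * X i = X i * X j"
proof (rule even_commute_flip)
  fix k l assume "k \<in> idx n" "l \<in> idx n"
  then show "X j * y i k l = y i k l * X j" "X j * m i k l = m i k l * X j"
    using assms X_y[of j i k l] by (auto intro!: supercommute_flip mm supercommute_sym[OF y_m])
qed

lemma X_X: "j \<in> {1..d} \<Longrightarrow> i \<in> {1..d} \<Longrightarrow> X j * X i = X i * X j"
  using X_X_less[of i j] X_X_less[of j i] by (cases i j rule: linorder_cases) simp_all

lemma s_s: "i \<in> {1..<d} \<Longrightarrow> s i * s i = p"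
  using flip_square[OF m m mm, of i "i + 1" ] by (simp add: p p_p[of i])

lemma s_c:
  assumes "i \<in> {1..<d}"
  shows "s i * c i = c (i + 1) * s i" "s i * c (i + 1) = c i * s i"
  unfolding cliff_def sum_distrib_left sum_distrib_right sg_mult_left sg_mult_right
  using assms by (simp_all add: flip_intertwine[OF m m mm] flip_intertwine'[OF m m] cong: sum.cong_simp)

lemma s_c_far:
  assumes "i \<in> {1..<d}" "j \<in> {1..d}" "j \<noteq> i" "j \<noteq> i + 1"
  shows "s i * c j = c j * s i"
  unfolding cliff_def sum_distrib_left sum_distrib_right sg_mult_left sg_mult_right
  using assms by (simp add: supercommute_flip[OF mm mm] cong: sum.cong_simp)

lemma c_c: "i \<in> {1..d} \<Longrightarrow> c i * c i = - p"
  by (simp add: cliff_square[OF m] p)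

lemma c_anti: "i \<in> {1..d} \<Longrightarrow> j \<in> {1..d} \<Longrightarrow> i \<noteq> j \<Longrightarrow> c i * c j = - (c j * c i)"
  by (rule cliff_anticommute) (rule mm)

lemma c_X: "i \<in> {1..d} \<Longrightarrow> c i * X i = - (X i * c i)"
  by (rule cliff_flip) (auto intro!: m y_m simp: q_rep_uminus[OF q_rep_y])

lemma c_X_other:
  assumes "i \<in> {1..d}" "j \<in> {1..d}" "j \<noteq> i"
  shows "c j * X i = X i * c j"
  using assms by (intro odd_commute_flip c_y_all supercommute_cliff mm) auto

lemma X_Suc:
  assumes "i \<in> {1..<d}"
  shows "X (i + 1) = flip n (y i) (m (i + 1)) + (s i - c i * (c (i + 1) * s i))"
proof -
  have "X (i + 1) = flip n (y i) (m (i + 1)) + flip n (dbl (m i)) (m (i + 1))"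
    using assms by (simp add: y_Suc flip_add)
  then show ?thesis using assms by (simp add: flip_dbl[OF m m mm])
qed

text \<open>Conjugation by \<open>s i\<close> moves \<open>\<Omega>\<close> from factor \<open>i\<close> to factor \<open>i + 1\<close>, whereas \<open>X (i + 1)\<close> contains in addition the
  term \<open>(1 - c\<^sub>ic\<^bsub>i+1\<^esub>)s\<^sub>i\<close>, whose product with \<open>s i\<close> accounts for the inhomogeneous part of the relation.\<close>

lemma s_X:
  assumes "i \<in> {1..<d}"
  shows "s i * X i = X (i + 1) * s i - p + c i * c (i + 1)"
proof -
  have "s i * X i = flip n (y i) (m (i + 1)) * s i"
    using assms by (intro flip_flip_intertwine m mm y_m) auto
  moreover have "c i * (c (i + 1) * p) = c i * c (i + 1)"
    using assms by (simp add: c_p)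
  ultimately show ?thesis
    using assms unfolding X_Suc[OF assms] by (simp add: distrib_right left_diff_distrib mult.assoc s_s[simplified])
qed

lemma s_X_far:
  assumes "i \<in> {1..<d}" "j \<in> {1..d}" "j \<noteq> i" "j \<noteq> i + 1"
  shows "s i * X j = X j * s i"
proof (rule even_commute_flip)
  fix k l assume kl: "k \<in> idx n" "l \<in> idx n"
  show "s i * y j k l = y j k l * s i"
    using assms s_y[of i j k l] s_y_le[of i j k l] kl by (cases "j \<le> i") auto
  show "s i * m j k l = m j k l * s i"
    using assms kl by (intro supercommute_flip mm) auto
qed

text \<open>Both sides of the braid relation reduce to the flip of the two outer factors, because conjugation by one
  flip relabels the factors of the other.\<close>

lemma s_flip:
  assumes "i \<in> {1..d}" "j \<in> {1..d}" "k \<in> {1..d}" "i \<noteq> j" "i \<noteq> k" "j \<noteq> k"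
  shows "flip n (m i) (m j) * flip n (m j) (m k) = flip n (m i) (m k) * flip n (m i) (m j)"
  unfolding flip_def[of n "m j" "m k"] flip_def[of n "m i" "m k"] sum_distrib_left sum_distrib_right
proof (intro sum.cong refl)
  fix a b assume I: "a \<in> idx n" "b \<in> idx n"
  have "flip n (m i) (m j) * (m j a b * m k b a) = m i a b * (flip n (m i) (m j) * m k b a)"
    using assms I by (simp add: flip_intertwine'[OF m m] flip: mult.assoc)
  also have "flip n (m i) (m j) * m k b a = m k b a * flip n (m i) (m j)"
    using assms I by (intro supercommute_flip mm) auto
  finally show "flip n (m i) (m j) * sg (ipar b) (m j a b * m k b a)
      = sg (ipar b) (m i a b * m k b a) * flip n (m i) (m j)"
    by (simp add: mult.assoc)
qed

lemma s_flip':
  assumes "i \<in> {1..d}" "j \<in> {1..d}" "k \<in> {1..d}" "i \<noteq> j" "i \<noteq> k" "j \<noteq> k"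
  shows "flip n (m j) (m k) * flip n (m i) (m j) = flip n (m i) (m k) * flip n (m j) (m k)"
  unfolding flip_def[of n "m i" "m j"] flip_def[of n "m i" "m k"] sum_distrib_left sum_distrib_right
proof (intro sum.cong refl)
  fix a b assume I: "a \<in> idx n" "b \<in> idx n"
  have "flip n (m j) (m k) * m i a b = m i a b * flip n (m j) (m k)"
    using assms I by (intro supercommute_flip mm) auto
  then have "flip n (m j) (m k) * (m i a b * m j b a) = m i a b * (flip n (m j) (m k) * m j b a)"
    by (simp flip: mult.assoc)
  also have "flip n (m j) (m k) * m j b a = m k b a * flip n (m j) (m k)"
    using assms I by (intro flip_intertwine m mm) auto
  finally show "flip n (m j) (m k) * sg (ipar b) (m i a b * m j b a)
      = sg (ipar b) (m i a b * m k b a) * flip n (m j) (m k)"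
    by (simp add: mult.assoc)
qed

lemma braid:
  assumes "i \<in> {1..<d}" "i + 1 \<in> {1..<d}"
  shows "s i * (s (i + 1) * s i) = s (i + 1) * (s i * s (i + 1))"
proof -
  have "s i * s (i + 1) * s i = flip n (m i) (m (i + 2)) * (s i * s i)"
    using s_flip[of i "i + 1" "i + 2"] assms by (simp add: mult.assoc)
  moreover have "s (i + 1) * s i * s (i + 1) = flip n (m i) (m (i + 2)) * (s (i + 1) * s (i + 1))"
    using s_flip'[of i "i + 1" "i + 2"] assms by (simp add: mult.assoc)
  ultimately show ?thesis using s_s assms by (simp add: mult.assoc)
qed

lemma s_s_far:
  assumes "i \<in> {1..<d}" "j \<in> {1..<d}" "j > i + 1"
  shows "s i * s j = s j * s i"
  using assms by (intro even_commute_flip supercommute_flip mm) auto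

end

section \<open>Sergeev elements\<close>

text \<open>Linear operators as a type, so that compositions and sums of them are computed with in a ring.\<close>

typedef (overloaded) 'v endo = "{f :: 'v::complex_vector \<Rightarrow> 'v. linear_on UNIV f}"
  morphisms app Endo
  by (rule exI[of _ "\<lambda>v. v"]) (simp add: linear_on_def)

setup_lifting type_definition_endo

instantiation endo :: (complex_vector) ring
begin

lift_definition zero_endo :: "'a endo" is "\<lambda>v. 0" by (simp add: linear_on_def)
lift_definition plus_endo :: "'a endo \<Rightarrow> 'a endo \<Rightarrow> 'a endo" is "\<lambda>f g v. f v + g v"
  by (simp add: linear_on_def algebra_simps cvec.scale_right_distrib)
lift_definition uminus_endo :: "'a endo \<Rightarrow> 'a endo" is "\<lambda>f v. - f v"
  by (simp add: linear_on_def)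
lift_definition minus_endo :: "'a endo \<Rightarrow> 'a endo \<Rightarrow> 'a endo" is "\<lambda>f g v. f v - g v"
  by (simp add: linear_on_def algebra_simps cvec.scale_right_diff_distrib)
lift_definition times_endo :: "'a endo \<Rightarrow> 'a endo \<Rightarrow> 'a endo" is "\<lambda>f g v. f (g v)"
  by (simp add: linear_on_def)

instance
  by standard (transfer; simp add: fun_eq_iff linear_on_def algebra_simps)+

end

lemma endo_eqI: "(\<And>v. app a v = app b v) \<Longrightarrow> a = b"
  by transfer (simp add: fun_eq_iff)

lemma app_simps [simp]:
  "app (a + b) v = app a v + app b v" "app (a - b) v = app a v - app b v"
  "app (- a) v = - app a v" "app 0 v = 0" "app (a * b) v = app a (app b v)"
  by (transfer; simp)+

lemma app_add: "app a (u + v) = app a u + app a v"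
  and app_scale: "app a (k *\<^sub>C v) = k *\<^sub>C app a v"
  by (transfer; simp add: linear_on_def)+

lemma app_zero [simp]: "app a 0 = 0"
  using app_add[of a 0 0] by simp

lemma app_minus: "app a (- v) = - app a v"
  using app_add[of a v "- v"] by (simp add: eq_neg_iff_add_eq_0 add.commute)

lemma app_diff: "app a (u - v) = app a u - app a v"
  using app_add[of a u "- v"] by (simp add: app_minus)

lemma app_sg [simp]: "app (sg p a) v = sg p (app a v)"
  by (cases p) simp_all

lemma app_sum [simp]: "app (\<Sum>i\<in>I. f i) v = (\<Sum>i\<in>I. app (f i) v)"
  by (induction I rule: infinite_finite_induct) simp_all

text \<open>The recursion of the Sergeev elements in any ring with elements that satisfy the relations of \<open>q(n)\<close>.\<close>

locale queer =
  fixes n :: nat and x :: "int \<Rightarrow> int \<Rightarrow> 'r::ring"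
  assumes rep: "q_rep n x"
begin

abbreviation e :: "int \<Rightarrow> int \<Rightarrow> 'r" where "e \<equiv> x"
definition f :: "int \<Rightarrow> int \<Rightarrow> 'r" where "f a b = x (- a) b"
abbreviation I :: "int set" where "I \<equiv> {1..int n}"

lemma bracket:
  assumes "a \<in> I" "b \<in> I" "c \<in> I" "g \<in> I"
  shows "e a b * e c g = e c g * e a b + (if b = c then e a g else 0) + (if a = g then - e c b else 0)"
    and "e a b * f c g = f c g * e a b + (if b = c then f a g else 0) + (if a = g then - f c b else 0)"
    and "f a b * e c g = e c g * f a b + (if b = c then f a g else 0) + (if a = g then - f c b else 0)"
    and "f a b * f c g = - (f c g * f a b) + (if b = c then e a g else 0) + (if a = g then e c b else 0)"
proof -
  have idx: "a \<in> idx n" "b \<in> idx n" "c \<in> idx n" "g \<in> idx n"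
    "- a \<in> idx n" "- c \<in> idx n"
    using assms by (auto simp: idx_def)
  have par: "ipar a = 0" "ipar b = 0" "ipar c = 0" "ipar g = 0" "ipar (- a) = 1" "ipar (- c) = 1"
    using assms by (auto simp: ipar_def)
  note U = q_rep_uminus[OF rep] q_rep_uminus'[OF rep]
  show "e a b * e c g = e c g * e a b + (if b = c then e a g else 0) + (if a = g then - e c b else 0)"
    unfolding q_repD[OF rep idx(1,2,3,4)] using assms by (simp add: par)
  show "e a b * f c g = f c g * e a b + (if b = c then f a g else 0) + (if a = g then - f c b else 0)"
    unfolding f_def q_repD[OF rep idx(1,2,6,4)] using assms by (simp add: par U)
  show "f a b * e c g = e c g * f a b + (if b = c then f a g else 0) + (if a = g then - f c b else 0)"
    unfolding f_def q_repD[OF rep idx(5,2,3,4)] using assms by (simp add: par U)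
  show "f a b * f c g = - (f c g * f a b) + (if b = c then e a g else 0) + (if a = g then e c b else 0)"
    unfolding f_def q_repD[OF rep idx(5,2,6,4)] using assms by (simp add: par U)
qed

text \<open>A Leibniz rule: if \<open>u\<close> has brackets with \<open>A\<close> and \<open>B\<close> of the shape typical for matrix entries, then so has it
  with the matrix product, up to two terms in the middle.  In the recursion of the Sergeev elements these
  middle terms cancel, either against each other or between the two matrix products.\<close>

lemma bracket_product:
  fixes u :: "'r"
  assumes A: "\<forall>k\<in>I. \<forall>r\<in>I.
      u * A k r = sg p (A k r * u) + (if b = k then A1 r else 0) + (if a = r then A2 k else 0)"
    and B: "\<forall>k\<in>I. \<forall>r\<in>I.
      u * B k r = sg q (B k r * u) + (if b = k then B1 r else 0) + (if a = r then B2 k else 0)"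
    and I: "a \<in> I" "b \<in> I" "k \<in> I" "l \<in> I"
  shows "u * (\<Sum>r\<in>I. A k r * B r l) = sg (p + q) ((\<Sum>r\<in>I. A k r * B r l) * u)
      + (if b = k then \<Sum>r\<in>I. A1 r * B r l else 0) + A2 k * B a l + sg p (A k b * B1 l)
      + (if a = l then sg p (\<Sum>r\<in>I. A k r * B2 r) else 0)"
proof -
  have "u * (\<Sum>r\<in>I. A k r * B r l) = (\<Sum>r\<in>I. sg (p + q) (A k r * B r l * u)
      + (if b = k then A1 r * B r l else 0) + (if r = a then A2 k * B r l else 0)
      + (if r = b then sg p (A k r * B1 l) else 0) + (if a = l then sg p (A k r * B2 r) else 0))"
    unfolding sum_distrib_left
  proof (intro sum.cong refl)
    fix r assume r: "r \<in> I"
    have "u * (A k r * B r l) = sg p (A k r * (u * B r l))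
        + (if b = k then A1 r * B r l else 0) + (if r = a then A2 k * B r l else 0)"
      unfolding mult.assoc[symmetric] A[rule_format, OF I(3) r] by (auto simp: distrib_right mult.assoc)
    also have "A k r * (u * B r l) = sg q (A k r * B r l * u)
        + (if r = b then A k r * B1 l else 0) + (if a = l then A k r * B2 r else 0)"
      unfolding B[rule_format, OF r I(4)] by (auto simp: distrib_left mult.assoc)
    finally show "u * (A k r * B r l) = sg (p + q) (A k r * B r l * u)
      + (if b = k then A1 r * B r l else 0) + (if r = a then A2 k * B r l else 0)
      + (if r = b then sg p (A k r * B1 l) else 0) + (if a = l then sg p (A k r * B2 r) else 0)"
      by (auto simp: sg_add)
  qed
  also have "\<dots> = sg (p + q) ((\<Sum>r\<in>I. A k r * B r l) * u)
      + (if b = k then \<Sum>r\<in>I. A1 r * B r l else 0) + A2 k * B a l + sg p (A k b * B1 l)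
      + (if a = l then sg p (\<Sum>r\<in>I. A k r * B2 r) else 0)"
    using I by (simp add: sum.distrib sum_distrib_right sg_sum)
  finally show ?thesis .
qed

text \<open>Powers of the matrix formed by the generators.  \<open>S0 r\<close> and \<open>S1 r\<close> are the even and the odd part of the power
  with exponent \<open>r + 1\<close>; the alternating sign is what the sign rule makes of the odd generators.\<close>

fun S0 :: "nat \<Rightarrow> int \<Rightarrow> int \<Rightarrow> 'r" and S1 :: "nat \<Rightarrow> int \<Rightarrow> int \<Rightarrow> 'r" where
  "S0 0 i j = e i j"
| "S1 0 i j = f i j"
| "S0 (Suc r) i j = (\<Sum>k\<in>I. e i k * S0 r k j) - sg (of_nat r) (\<Sum>k\<in>I. f i k * S1 r k j)"
| "S1 (Suc r) i j = (\<Sum>k\<in>I. e i k * S1 r k j) - sg (of_nat r) (\<Sum>k\<in>I. f i k * S0 r k j)"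

text \<open>The Sergeev elements transform like the generators, except for a sign \<open>(-1)\<^sup>r\<close> in the brackets with the odd
  generators.  For even \<open>r\<close> the two deltas contribute opposite terms to the trace, which makes the trace
  central.\<close>

lemma S_bracket:
  assumes "a \<in> I" "b \<in> I" "k \<in> I" "l \<in> I"
  shows "e a b * S0 r k l = S0 r k l * e a b + (if b = k then S0 r a l else 0) + (if a = l then - S0 r k b else 0)"
    and "e a b * S1 r k l = S1 r k l * e a b + (if b = k then S1 r a l else 0) + (if a = l then - S1 r k b else 0)"
    and "f a b * S0 r k l = S0 r k l * f a b
          + (if b = k then sg (of_nat r) (S1 r a l) else 0) + (if a = l then - S1 r k b else 0)"
    and "f a b * S1 r k l = - (S1 r k l * f a b)
          + (if b = k then sg (of_nat r) (S0 r a l) else 0) + (if a = l then S0 r k b else 0)"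
  using assms(3,4)
proof (induction r arbitrary: k l)
  case 0
  {
    case 1 then show ?case using bracket(1)[OF assms(1,2)] by simp
  next
    case 2 then show ?case using bracket(2)[OF assms(1,2)] by simp
  next
    case 3 then show ?case using bracket(3)[OF assms(1,2)] by simp
  next
    case 4 then show ?case using bracket(4)[OF assms(1,2)] by simp
  }
next
  case (Suc r)
  note ab = assms(1,2)
  have ee: "\<forall>k\<in>I. \<forall>l\<in>I. e a b * e k l = sg 0 (e k l * e a b) + (if b = k then e a l else 0) + (if a = l then - e k b else 0)"
    and ef: "\<forall>k\<in>I. \<forall>l\<in>I. e a b * f k l = sg 0 (f k l * e a b) + (if b = k then f a l else 0) + (if a = l then - f k b else 0)"
    and fe: "\<forall>k\<in>I. \<forall>l\<in>I. f a b * e k l = sg 0 (e k l * f a b) + (if b = k then f a l else 0) + (if a = l then - f k b else 0)"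
    and ff: "\<forall>k\<in>I. \<forall>l\<in>I. f a b * f k l = sg 1 (f k l * f a b) + (if b = k then e a l else 0) + (if a = l then e k b else 0)"
    using bracket[OF ab] by simp_all
  have IH: "\<forall>k\<in>I. \<forall>l\<in>I. e a b * S0 r k l = sg 0 (S0 r k l * e a b) + (if b = k then S0 r a l else 0) + (if a = l then - S0 r k b else 0)"
      "\<forall>k\<in>I. \<forall>l\<in>I. e a b * S1 r k l = sg 0 (S1 r k l * e a b) + (if b = k then S1 r a l else 0) + (if a = l then - S1 r k b else 0)"
      "\<forall>k\<in>I. \<forall>l\<in>I. f a b * S0 r k l = sg 0 (S0 r k l * f a b) + (if b = k then sg (of_nat r) (S1 r a l) else 0) + (if a = l then - S1 r k b else 0)"
      "\<forall>k\<in>I. \<forall>l\<in>I. f a b * S1 r k l = sg 1 (S1 r k l * f a b) + (if b = k then sg (of_nat r) (S0 r a l) else 0) + (if a = l then S0 r k b else 0)"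
    using Suc.IH by simp_all
  note simps = S0.simps S1.simps right_diff_distrib left_diff_distrib sg_mult_right sg_mult_left sg_0 sg_1
    sg_add sg_diff sg_minus mult_minus_left mult_minus_right sum_negf
  {
    case 1
    show ?case
      unfolding simps
      unfolding bracket_product[OF ee IH(1) ab 1] bracket_product[OF ef IH(2) ab 1]
      by (auto simp: simps)
  next
    case 2
    show ?case
      unfolding simps
      unfolding bracket_product[OF ee IH(2) ab 2] bracket_product[OF ef IH(1) ab 2]
      by (auto simp: simps)
  next
    case 3
    show ?case
      unfolding simps
      unfolding bracket_product[OF fe IH(3) ab 3] bracket_product[OF ff IH(4) ab 3]
      by (cases "of_nat r :: bit") (auto simp: sum_negf sg_minus)
  next
    case 4
    show ?case
      unfolding simps
      unfolding bracket_product[OF fe IH(4) ab 4] bracket_product[OF ff IH(3) ab 4]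
      by (cases "of_nat r :: bit") (auto simp: sum_negf sg_minus)
  }
qed

definition Z :: "nat \<Rightarrow> 'r" where "Z t = (\<Sum>i\<in>I. S0 (2 * t) i i)"

lemma Z_central:
  assumes "a \<in> I" "b \<in> I"
  shows "e a b * Z t = Z t * e a b" "f a b * Z t = Z t * f a b"
  using assms unfolding Z_def sum_distrib_left sum_distrib_right
  by (simp_all add: S_bracket sum.distrib cong: sum.cong_simp)

end

text \<open>The scalars by which the diagonal Sergeev elements act on a singular vector of weight \<open>\<mu>\<close>: on it,
  \<open>S0 (2 * t) i i\<close> is multiplication by \<open>\<mu> i * alpha n \<mu> t i\<close>.\<close>

fun alpha :: "nat \<Rightarrow> (int \<Rightarrow> int) \<Rightarrow> nat \<Rightarrow> int \<Rightarrow> int" where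
  "alpha n \<mu> 0 i = 1"
| "alpha n \<mu> (Suc t) i = \<mu> i * (\<mu> i - 1) * alpha n \<mu> t i - 2 * (\<Sum>k\<in>{i<..int n}. \<mu> k * alpha n \<mu> t k)"

text \<open>The central character, that is the scalar by which \<open>Z t\<close> acts.\<close>

definition chi :: "nat \<Rightarrow> (int \<Rightarrow> int) \<Rightarrow> nat \<Rightarrow> int" where
  "chi n \<mu> t = (\<Sum>i\<in>{1..int n}. \<mu> i * alpha n \<mu> t i)"

lemma scaleC_of_int_sum: "(\<Sum>i\<in>A. of_int (f i) *\<^sub>C v) = of_int (\<Sum>i\<in>A. f i) *\<^sub>C (v::'a::complex_vector)"
  by (simp add: cvec.scale_sum_left)

lemma two_eq_zero_vec: "v + v = 0 \<Longrightarrow> v = (0::'a::complex_vector)"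
proof -
  assume "v + v = 0"
  moreover have "v + v = 2 *\<^sub>C v"
    using cvec.scale_left_distrib[of 1 1 v] by simp
  ultimately show ?thesis by simp
qed

locale queer_module = queer n x for n and x :: "int \<Rightarrow> int \<Rightarrow> 'v::complex_vector endo"
begin

definition singular :: "'v \<Rightarrow> bool" where
  "singular v \<longleftrightarrow> (\<forall>i\<in>I. \<forall>j\<in>I. i < j \<longrightarrow> app (e i j) v = 0 \<and> app (f i j) v = 0)"

definition weight_vec :: "(int \<Rightarrow> int) \<Rightarrow> 'v \<Rightarrow> bool" where
  "weight_vec \<mu> v \<longleftrightarrow> (\<forall>i\<in>I. app (e i i) v = of_int (\<mu> i) *\<^sub>C v)"

lemma app_swap: "a * b = c \<Longrightarrow> app a (app b v) = app c v"
  by (metis app_simps(5))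

text \<open>In each product of the recursion, either the right factor is again of this kind, or the left factor is a
  raising operator; moved to the right, it leaves a bracket that is again of this kind.\<close>

lemma S_below:
  assumes "singular v" "k \<in> I" "j \<in> I" "k < j"
  shows "app (S0 r k j) v = 0 \<and> app (S1 r k j) v = 0"
  using assms(2-4)
proof (induction r arbitrary: k j)
  case 0
  then show ?case using assms(1) by (simp add: singular_def)
next
  case (Suc r)
  let ?t0 = "\<lambda>i. app (e k i) (app (S0 r i j) v) - sg (of_nat r) (app (f k i) (app (S1 r i j) v))"
  let ?t1 = "\<lambda>i. app (e k i) (app (S1 r i j) v) - sg (of_nat r) (app (f k i) (app (S0 r i j) v))"
  have kj: "app (S0 r k j) v = 0" "app (S1 r k j) v = 0" using Suc by simp_all
  have "?t0 i = 0 \<and> ?t1 i = 0" if i: "i \<in> I" for i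
  proof (cases "i < j")
    case True
    then have "app (S0 r i j) v = 0" "app (S1 r i j) v = 0" using Suc i by simp_all
    then show ?thesis by simp
  next
    case False
    then have s: "app (e k i) v = 0" "app (f k i) v = 0"
      using assms(1) i Suc.prems by (simp_all add: singular_def)
    show ?thesis
      unfolding app_swap[OF S_bracket(1)[OF Suc.prems(1) i i Suc.prems(2)]]
        app_swap[OF S_bracket(2)[OF Suc.prems(1) i i Suc.prems(2)]]
        app_swap[OF S_bracket(3)[OF Suc.prems(1) i i Suc.prems(2)]]
        app_swap[OF S_bracket(4)[OF Suc.prems(1) i i Suc.prems(2)]]
      using Suc.prems(3) by (simp add: s kj)
  qed
  then show ?case
    by (simp add: sg_sum sum_subtractf[symmetric])
qed

text \<open>In the sum that defines the next power, the terms with \<open>k < i\<close> vanish by \<open>S_below\<close>.  For \<open>k > i\<close> the left factor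
  is a raising operator; moving it to the right leaves its bracket with the right factor, and the
  contributions of \<open>S0 r i i\<close> and \<open>S1 r i i\<close> to these brackets cancel between the two products.\<close>

lemma S_diag:
  assumes "singular v" "i \<in> I"
  shows "app (S0 (Suc r) i i) v = app (e i i) (app (S0 r i i) v) - sg (of_nat r) (app (f i i) (app (S1 r i i) v))
      - (\<Sum>k\<in>{i<..int n}. app (S0 r k k) v + sg (of_nat r) (app (S0 r k k) v))" (is ?t0)
    and "app (S1 (Suc r) i i) v = app (e i i) (app (S1 r i i) v) - sg (of_nat r) (app (f i i) (app (S0 r i i) v))
      - (\<Sum>k\<in>{i<..int n}. app (S1 r k k) v - sg (of_nat r) (app (S1 r k k) v))" (is ?t1)
proof -
  have split: "(\<Sum>k\<in>I. g k) = g i + (\<Sum>k\<in>{i<..int n}. g k)" if "\<And>k. k \<in> I \<Longrightarrow> k < i \<Longrightarrow> g k = 0" for g :: "int \<Rightarrow> 'v"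
  proof -
    have "I = {1..<i} \<union> insert i {i<..int n}" using assms(2) by auto
    then have "(\<Sum>k\<in>I. g k) = (\<Sum>k\<in>{1..<i}. g k) + (\<Sum>k\<in>insert i {i<..int n}. g k)"
      by (metis (no_types, lifting) sum.union_disjoint finite_atLeastLessThan_int finite_greaterThanAtMost_int
          finite_insert disjoint_iff insert_iff atLeastLessThan_iff greaterThanAtMost_iff less_irrefl less_asym)
    moreover have "(\<Sum>k\<in>{1..<i}. g k) = 0"
      using that assms(2) by (intro sum.neutral) auto
    ultimately show ?thesis by simp
  qed
  have low: "app (S0 r k i) v = 0" "app (S1 r k i) v = 0" if "k \<in> I" "k < i" for k
    using S_below[OF assms(1) that(1) assms(2) that(2)] by simp_all
  have high: "app (e i k) (app (S0 r k i) v) - sg (of_nat r) (app (f i k) (app (S1 r k i) v))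
        = - (app (S0 r k k) v + sg (of_nat r) (app (S0 r k k) v)) \<and>
      app (e i k) (app (S1 r k i) v) - sg (of_nat r) (app (f i k) (app (S0 r k i) v))
        = - (app (S1 r k k) v - sg (of_nat r) (app (S1 r k k) v))" if "k \<in> {i<..int n}" for k
  proof -
    have k: "k \<in> I" using that assms(2) by auto
    have s: "app (e i k) v = 0" "app (f i k) v = 0"
      using assms k that by (simp_all add: singular_def)
    show ?thesis
      unfolding app_swap[OF S_bracket(1)[OF assms(2) k k assms(2)]]
        app_swap[OF S_bracket(2)[OF assms(2) k k assms(2)]]
        app_swap[OF S_bracket(3)[OF assms(2) k k assms(2)]]
        app_swap[OF S_bracket(4)[OF assms(2) k k assms(2)]]
      by (simp add: s sg_add sg_minus sg_diff)
  qed
  show ?t0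
    unfolding S0.simps app_simps app_sg app_sum sg_sum sum_subtractf[symmetric]
    by (subst split) (simp_all add: low high flip: sum_negf cong: sum.cong_simp)
  show ?t1
    unfolding S1.simps app_simps app_sg app_sum sg_sum sum_subtractf[symmetric]
    by (subst split) (simp_all add: low high flip: sum_negf cong: sum.cong_simp)
qed

lemma f_square:
  assumes "i \<in> I"
  shows "app (f i i) (app (f i i) v) = app (e i i) v"
proof -
  have "f i i * f i i + f i i * f i i = e i i + e i i"
    using bracket(4)[OF assms assms assms assms] by (simp add: eq_neg_iff_add_eq_0[symmetric] algebra_simps)
  from arg_cong[OF this, of "\<lambda>a. app a v"]
  have "(app (f i i) (app (f i i) v) - app (e i i) v) + (app (f i i) (app (f i i) v) - app (e i i) v) = 0"
    by (simp add: algebra_simps)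
  then show ?thesis using two_eq_zero_vec by fastforce
qed

text \<open>Two steps of the recursion are taken at once.  After an odd number of steps the odd part vanishes on the singular
  vector, since \<open>f\<^sub>i\<^sub>i\<close> commutes with \<open>e\<^sub>i\<^sub>i\<close>, so that the vectors \<open>f\<^bsub>kk\<^esub> v\<close> with \<open>k > i\<close> never enter; and
  \<open>f\<^sub>i\<^sub>i\<^sup>2 = e\<^sub>i\<^sub>i\<close> turns the remaining odd contribution into a scalar.\<close>

lemma S_eigen:
  assumes v: "singular v" "weight_vec \<mu> v"
  shows "\<forall>i\<in>I. app (S0 (2 * t) i i) v = of_int (\<mu> i * alpha n \<mu> t i) *\<^sub>C v \<and>
      app (S1 (2 * t) i i) v = of_int (alpha n \<mu> t i) *\<^sub>C app (f i i) v"
proof (induction t)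
  case 0
  then show ?case using v(2) by (simp add: weight_vec_def)
next
  case (Suc t)
  have e: "app (e i i) v = of_int (\<mu> i) *\<^sub>C v" "app (e i i) (app (f i i) v) = of_int (\<mu> i) *\<^sub>C app (f i i) v"
    if "i \<in> I" for i
  proof -
    show ev: "app (e i i) v = of_int (\<mu> i) *\<^sub>C v" using v(2) that by (simp add: weight_vec_def)
    have "app (e i i) (app (f i i) v) = app (f i i) (app (e i i) v)"
      using app_swap[OF bracket(2)[OF that that that that], of v] by simp
    then show "app (e i i) (app (f i i) v) = of_int (\<mu> i) *\<^sub>C app (f i i) v"
      by (simp add: ev app_scale)
  qed
  have odd: "app (S0 (Suc (2 * t)) i i) v = of_int (alpha n \<mu> (Suc t) i) *\<^sub>C v"
    "app (S1 (Suc (2 * t)) i i) v = 0" if i: "i \<in> I" for i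
  proof -
    have I: "k \<in> I" if "k \<in> {i<..int n}" for k using that i by auto
    have "app (S0 (Suc (2 * t)) i i) v
      = of_int (\<mu> i * \<mu> i * alpha n \<mu> t i - \<mu> i * alpha n \<mu> t i) *\<^sub>C v
        - (\<Sum>k\<in>{i<..int n}. of_int (2 * (\<mu> k * alpha n \<mu> t k)) *\<^sub>C v)"
      unfolding S_diag(1)[OF v(1) i]
      using Suc.IH i
      by (simp add: I app_scale e f_square cvec.scale_left_diff_distrib ac_simps
          flip: cvec.scale_left_distrib cong: sum.cong_simp)
    then show "app (S0 (Suc (2 * t)) i i) v = of_int (alpha n \<mu> (Suc t) i) *\<^sub>C v"
      unfolding scaleC_of_int_sum by (simp add: sum_distrib_left algebra_simps flip: cvec.scale_left_diff_distrib)
    show "app (S1 (Suc (2 * t)) i i) v = 0"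
      unfolding S_diag(2)[OF v(1) i]
      using Suc.IH i by (simp add: I app_scale e mult.commute cong: sum.cong_simp)
  qed
  show ?case
  proof
    fix i assume i: "i \<in> I"
    have I: "k \<in> I" if "k \<in> {i<..int n}" for k using that i by auto
    have 2: "2 * Suc t = Suc (Suc (2 * t))" by simp
    have "app (S0 (2 * Suc t) i i) v = app (e i i) (app (S0 (Suc (2 * t)) i i) v)"
      unfolding 2
      by (subst S_diag(1)[OF v(1) i]) (simp add: odd(2)[OF i] del: S0.simps S1.simps)
    then have "app (S0 (2 * Suc t) i i) v = of_int (\<mu> i * alpha n \<mu> (Suc t) i) *\<^sub>C v"
      unfolding odd(1)[OF i] app_scale e(1)[OF i] by (simp only: cvec.scale_scale of_int_mult mult.commute)
    moreover have "app (S1 (2 * Suc t) i i) v = of_int (alpha n \<mu> (Suc t) i) *\<^sub>C app (f i i) v"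
      unfolding 2
      by (subst S_diag(2)[OF v(1) i])
        (simp add: odd(1)[OF i] odd(2)[OF i] odd(2)[OF I] app_scale del: S0.simps S1.simps alpha.simps cong: sum.cong_simp)
    ultimately show "app (S0 (2 * Suc t) i i) v = of_int (\<mu> i * alpha n \<mu> (Suc t) i) *\<^sub>C v \<and>
      app (S1 (2 * Suc t) i i) v = of_int (alpha n \<mu> (Suc t) i) *\<^sub>C app (f i i) v" ..
  qed
qed

lemma Z_eigen:
  assumes "singular v" "weight_vec \<mu> v"
  shows "app (Z t) v = of_int (chi n \<mu> t) *\<^sub>C v"
  using S_eigen[OF assms, of t] unfolding Z_def chi_def scaleC_of_int_sum[symmetric] by simp

end

section \<open>Central characters separate typical dominant weights\<close>

text \<open>A nonzero \<open>a\<close> occurs if and only if \<open>1/a\<close> is a root, and then its factor can be cancelled.\<close>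

lemma linear_factors_unique:
  fixes A B :: "complex multiset"
  assumes "(\<Prod>a\<in>#A. [:1, - a:]) = (\<Prod>b\<in>#B. [:1, - b:])"
  shows "filter_mset (\<lambda>a. a \<noteq> 0) A = filter_mset (\<lambda>a. a \<noteq> 0) B"
  using assms
proof (induction A arbitrary: B)
  case empty
  have "b = 0" if "b \<in># B" for b
  proof (rule ccontr)
    assume "b \<noteq> 0"
    have "poly (\<Prod>b\<in>#B. [:1, - b:]) (1 / b) = 0"
      using that \<open>b \<noteq> 0\<close> by (auto simp: poly_prod_mset prod_mset_zero_iff image_iff intro!: bexI[of _ b])
    with empty show False by simp
  qed
  then show ?case by (auto simp: filter_mset_eq_conv)
next
  case (add a A)
  show ?case
  proof (cases "a = 0")
    case True
    then show ?thesis using add by simp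
  next
    case False
    have "poly (\<Prod>b\<in>#B. [:1, - b:]) (1 / a) = 0"
      using False by (simp flip: add.prems)
    then obtain b where "b \<in># B" "1 - b / a = 0"
      by (auto simp: poly_prod_mset prod_mset_zero_iff)
    with False have "a \<in># B" by simp
    then obtain B' where B: "B = add_mset a B'" by (meson multi_member_split)
    have "(\<Prod>a\<in>#A. [:1, - a:]) = (\<Prod>b\<in>#B'. [:1, - b:])"
      using add.prems mult_left_cancel[of "[:1, - a:]"] by (simp add: B del: mult_pCons_left)
    then show ?thesis using add.IH[of B'] False by (simp add: B)
  qed
qed

lemma fps_prod_linear:
  "(\<Prod>i\<in>A. 1 - fps_const (f i) * fps_X) = fps_of_poly (\<Prod>a\<in>#image_mset f (mset_set A). [:1, - a:])"
  for f :: "int \<Rightarrow> complex"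
proof -
  have "(\<Prod>a\<in>#image_mset f (mset_set A). [:1, - a:]) = (\<Prod>i\<in>A. [:1, - f i:])"
    by (simp add: prod_unfold_prod_mset image_mset.compositionality o_def)
  moreover have "fps_of_poly (\<Prod>i\<in>A. [:1, - f i:]) = (\<Prod>i\<in>A. 1 - fps_const (f i) * fps_X)"
    by (simp add: fps_of_poly_prod fps_of_poly_pCons fps_const_neg[symmetric] del: fps_const_neg)
  ultimately show ?thesis by simp
qed

definition lin :: "int \<Rightarrow> complex fps" where
  "lin k = 1 - fps_const (of_int k) * fps_X"

definition alpha_fps :: "nat \<Rightarrow> (int \<Rightarrow> int) \<Rightarrow> int \<Rightarrow> complex fps" where
  "alpha_fps n \<mu> i = Abs_fps (\<lambda>t. of_int (alpha n \<mu> t i))"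

text \<open>Generating functions of the recursion.  The tail at \<open>0\<close> carries the central character, and neighbouring
  tails differ by a single factor \<open>(1 - \<mu>(\<mu> + 1)z) / (1 - \<mu>(\<mu> - 1)z)\<close>.\<close>

definition tail_fps :: "nat \<Rightarrow> (int \<Rightarrow> int) \<Rightarrow> int \<Rightarrow> complex fps" where
  "tail_fps n \<mu> i = 1 - 2 * fps_X * (\<Sum>k\<in>{i<..int n}. fps_const (of_int (\<mu> k)) * alpha_fps n \<mu> k)"

lemma alpha_fps_eq:
  "lin (\<mu> i * (\<mu> i - 1)) * alpha_fps n \<mu> i = tail_fps n \<mu> i"
proof (rule fps_ext)
  fix t
  have two: "2 * fps_X * h = fps_X * (fps_const 2 * h)" for h :: "complex fps"
    by (simp add: numeral_fps_const mult_ac)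
  have "lin (\<mu> i * (\<mu> i - 1)) * alpha_fps n \<mu> i
      = alpha_fps n \<mu> i - fps_X * (fps_const (of_int (\<mu> i * (\<mu> i - 1))) * alpha_fps n \<mu> i)"
    by (simp only: lin_def left_diff_distrib mult_1_left mult.assoc mult.left_commute)
  then show "fps_nth (lin (\<mu> i * (\<mu> i - 1)) * alpha_fps n \<mu> i) t
      = fps_nth (tail_fps n \<mu> i) t"
    unfolding tail_fps_def two
    by (cases t) (simp_all add: alpha_fps_def fps_sum_nth)
qed

lemma tail_fps_step:
  assumes "i \<in> {1..int n}"
  shows "lin (\<mu> i * (\<mu> i - 1)) * tail_fps n \<mu> (i - 1)
      = lin (\<mu> i * (\<mu> i + 1)) * tail_fps n \<mu> i"
proof -
  have "{i - 1<..int n} = insert i {i<..int n}" using assms by auto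
  then have "tail_fps n \<mu> (i - 1) = tail_fps n \<mu> i - 2 * fps_X * (fps_const (of_int (\<mu> i)) * alpha_fps n \<mu> i)"
    by (simp add: tail_fps_def algebra_simps)
  then have "lin (\<mu> i * (\<mu> i - 1)) * tail_fps n \<mu> (i - 1)
      = lin (\<mu> i * (\<mu> i - 1)) * tail_fps n \<mu> i
        - 2 * fps_X * fps_const (of_int (\<mu> i)) * (lin (\<mu> i * (\<mu> i - 1)) * alpha_fps n \<mu> i)"
    by (simp only: right_diff_distrib mult_ac)
  also have "\<dots> = (1 - (fps_const (of_int (\<mu> i * (\<mu> i - 1))) + 2 * fps_const (of_int (\<mu> i))) * fps_X) * tail_fps n \<mu> i"
    unfolding alpha_fps_eq by (simp add: lin_def algebra_simps)
  also have "fps_const (of_int (\<mu> i * (\<mu> i - 1))) + 2 * fps_const (of_int (\<mu> i)) = (fps_const (of_int (\<mu> i * (\<mu> i + 1))) :: complex fps)"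
    by (simp add: numeral_fps_const algebra_simps)
  finally show ?thesis unfolding lin_def .
qed

lemma tail_fps_prod:
  "(\<Prod>i\<in>{1..int n}. lin (\<mu> i * (\<mu> i - 1))) * tail_fps n \<mu> 0
    = (\<Prod>i\<in>{1..int n}. lin (\<mu> i * (\<mu> i + 1)))"
proof -
  have "m \<le> n \<Longrightarrow> (\<Prod>i\<in>{int n - int m<..int n}. lin (\<mu> i * (\<mu> i - 1))) * tail_fps n \<mu> (int n - int m)
    = (\<Prod>i\<in>{int n - int m<..int n}. lin (\<mu> i * (\<mu> i + 1)))" for m
  proof (induction m)
    case 0
    then show ?case by (simp add: tail_fps_def)
  next
    case (Suc m)
    let ?i = "int n - int m"
    have *: "{int n - int (Suc m)<..int n} = insert ?i {?i<..int n}" using Suc.prems by auto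
    have "?i \<in> {1..int n}" using Suc.prems by auto
    from tail_fps_step[OF this, of \<mu>]
    have step: "lin (\<mu> ?i * (\<mu> ?i - 1)) * tail_fps n \<mu> (int n - int (Suc m))
      = lin (\<mu> ?i * (\<mu> ?i + 1)) * tail_fps n \<mu> ?i"
      by (simp add: algebra_simps)
    have "?i \<notin> {?i<..int n}" by simp
    then have "(\<Prod>i\<in>{int n - int (Suc m)<..int n}. lin (\<mu> i * (\<mu> i - 1))) * tail_fps n \<mu> (int n - int (Suc m))
      = (\<Prod>i\<in>{?i<..int n}. lin (\<mu> i * (\<mu> i - 1))) *
        (lin (\<mu> ?i * (\<mu> ?i - 1)) * tail_fps n \<mu> (int n - int (Suc m)))"
      unfolding * by (subst prod.insert) (simp_all only: finite_greaterThanAtMost_int mult_ac not_False_eq_True)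
    also have "\<dots> = lin (\<mu> ?i * (\<mu> ?i + 1)) *
        ((\<Prod>i\<in>{?i<..int n}. lin (\<mu> i * (\<mu> i - 1))) * tail_fps n \<mu> ?i)"
      unfolding step by (simp only: mult_ac)
    also have "\<dots> = (\<Prod>i\<in>{int n - int (Suc m)<..int n}. lin (\<mu> i * (\<mu> i + 1)))"
      unfolding * using Suc by (subst prod.insert) simp_all
    finally show ?case .
  qed
  from this[of n] show ?thesis by (simp add: greaterThanAtMost_def atLeastAtMost_def greaterThan_def atLeast_def int_one_le_iff_zero_less)
qed

lemma tail_fps_0: "tail_fps n \<mu> 0 = 1 - 2 * fps_X * Abs_fps (\<lambda>t. of_int (chi n \<mu> t))"
proof -
  have "{0<..int n} = {1..int n}" by auto
  moreover have "Abs_fps (\<lambda>t. of_int (chi n \<mu> t)) = (\<Sum>k\<in>{1..int n}. fps_const (of_int (\<mu> k)) * alpha_fps n \<mu> k)"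
    by (rule fps_ext) (simp add: fps_sum_nth chi_def alpha_fps_def)
  ultimately show ?thesis by (simp add: tail_fps_def)
qed

text \<open>Equality of the product formulas, with denominators cleared, is an equality of multisets up to zeros; a
  function that vanishes at \<open>0\<close> can then be summed over both sides.\<close>

lemma chi_eq_imp_sums_eq:
  fixes h :: "int \<Rightarrow> int"
  assumes chi: "\<And>t. chi n \<mu> t = chi n \<nu> t" and h: "h 0 = 0"
  shows "(\<Sum>i\<in>{1..int n}. h (\<mu> i * (\<mu> i + 1)) - h (\<mu> i * (\<mu> i - 1)))
    = (\<Sum>i\<in>{1..int n}. h (\<nu> i * (\<nu> i + 1)) - h (\<nu> i * (\<nu> i - 1)))"
proof -
  let ?p = "\<lambda>\<mu> i. of_int (\<mu> i * (\<mu> i + 1)) :: complex" and ?m = "\<lambda>\<mu> i. of_int (\<mu> i * (\<mu> i - 1)) :: complex"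
  let ?I = "{1..int n}"
  let ?M = "\<lambda>f. image_mset f (mset_set ?I)"
  let ?P = "\<lambda>f. \<Prod>a\<in>#?M f. [:1, - a:]"
  have "tail_fps n \<mu> 0 = tail_fps n \<nu> 0"
    by (simp add: tail_fps_0 chi)
  then have "fps_of_poly (?P (?p \<mu>)) * fps_of_poly (?P (?m \<nu>)) = fps_of_poly (?P (?p \<nu>)) * fps_of_poly (?P (?m \<mu>))"
    unfolding fps_prod_linear[symmetric] lin_def[symmetric] tail_fps_prod[symmetric] by (simp only: mult_ac)
  then have "?P (?p \<mu>) * ?P (?m \<nu>) = ?P (?p \<nu>) * ?P (?m \<mu>)"
    by (simp only: fps_of_poly_mult[symmetric] fps_of_poly_eq_iff)
  then have "(\<Prod>a\<in>#?M (?p \<mu>) + ?M (?m \<nu>). [:1, - a:]) = (\<Prod>a\<in>#?M (?p \<nu>) + ?M (?m \<mu>). [:1, - a:])"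
    by (simp only: image_mset_union prod_mset.union)
  then have eq: "filter_mset (\<lambda>a. a \<noteq> 0) (?M (?p \<mu>) + ?M (?m \<nu>)) = filter_mset (\<lambda>a. a \<noteq> 0) (?M (?p \<nu>) + ?M (?m \<mu>))"
    by (rule linear_factors_unique)
  define H :: "complex \<Rightarrow> int" where "H = (\<lambda>z. h \<lfloor>Re z\<rfloor>)"
  have H: "H (of_int k) = h k" for k by (simp add: H_def)
  have drop0: "(\<Sum>a\<in>#filter_mset (\<lambda>a. a \<noteq> 0) A. H a) = (\<Sum>a\<in>#A. H a)" for A
    using H[of 0] h by (induction A) auto
  have "(\<Sum>a\<in>#?M (?p \<mu>) + ?M (?m \<nu>). H a) = (\<Sum>a\<in>#?M (?p \<nu>) + ?M (?m \<mu>). H a)"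
    using arg_cong[OF eq, of "\<lambda>A. \<Sum>a\<in>#A. H a"] unfolding drop0 .
  then have "(\<Sum>i\<in>?I. H (?p \<mu> i)) + (\<Sum>i\<in>?I. H (?m \<nu> i)) = (\<Sum>i\<in>?I. H (?p \<nu> i)) + (\<Sum>i\<in>?I. H (?m \<mu> i))"
    by (simp only: image_mset_union sum_mset.union sum_unfold_sum_mset image_mset.compositionality o_def)
  then show ?thesis by (simp only: H sum_subtractf)
qed

text \<open>Take for \<open>h\<close> the indicator function of the numbers \<open>\<ge> K(K + 1)\<close>.  Since \<open>k(k + 1) \<ge> K(K + 1)\<close> means \<open>k \<ge> K\<close> or
  \<open>k \<le> -K - 1\<close>, the difference of the values at \<open>k(k + 1)\<close> and \<open>k(k - 1)\<close> is nonzero only for \<open>k = \<plusminus>K\<close>.\<close>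

lemma chi_eq_imp_signed_count_eq:
  assumes chi: "\<And>t. chi n \<mu> t = chi n \<nu> t" and K: "K \<ge> (1::int)"
  shows "(\<Sum>i\<in>{1..int n}. of_bool (\<mu> i = K) - of_bool (\<mu> i = - K) :: int)
    = (\<Sum>i\<in>{1..int n}. of_bool (\<nu> i = K) - of_bool (\<nu> i = - K))"
proof -
  define h :: "int \<Rightarrow> int" where "h = (\<lambda>z. of_bool (z \<ge> K * (K + 1)))"
  have ge: "m * (m + 1) \<ge> K * (K + 1) \<longleftrightarrow> m \<ge> K \<or> m \<le> - K - 1" for m
  proof -
    have "m * (m + 1) - K * (K + 1) = (m - K) * (m + K + 1)" by (simp add: algebra_simps)
    then have "m * (m + 1) \<ge> K * (K + 1) \<longleftrightarrow> 0 \<le> (m - K) * (m + K + 1)" by linarith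
    then show ?thesis using K by (auto simp: zero_le_mult_iff)
  qed
  have h: "h (m * (m + 1)) - h (m * (m - 1)) = of_bool (m = K) - of_bool (m = - K)" for m
  proof -
    have "m * (m - 1) = (m - 1) * ((m - 1) + 1)" by simp
    then have "m * (m - 1) \<ge> K * (K + 1) \<longleftrightarrow> m \<ge> K + 1 \<or> m \<le> - K"
      using ge[of "m - 1"] by (simp only: diff_add_cancel) linarith
    then show ?thesis using K unfolding h_def ge by auto
  qed
  have "h 0 = 0" using K by (simp add: h_def mult_le_0_iff)
  from chi_eq_imp_sums_eq[of n \<mu> \<nu> h, OF chi this] show ?thesis unfolding h .
qed

lemma int_count_image: "finite A \<Longrightarrow> int (count (image_mset f (mset_set A)) v) = (\<Sum>i\<in>A. of_bool (f i = v))"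
  by (induction A rule: finite_induct) auto

text \<open>Entries \<open>K\<close> and \<open>-K\<close> never occur together in a typical weight, nor does \<open>0\<close>.  So the signed counts show that
  every entry of \<open>\<nu>\<close> occurs in \<open>\<mu>\<close> at least as often, and both weights have \<open>n\<close> entries.\<close>

lemma chi_eq_imp_permutation:
  assumes chi: "\<And>t. chi n \<mu> t = chi n \<nu> t"
    and typical: "\<And>i j. i \<in> {1..int n} \<Longrightarrow> j \<in> {1..int n} \<Longrightarrow> \<nu> i + \<nu> j \<noteq> 0"
  shows "image_mset \<mu> (mset_set {1..int n}) = image_mset \<nu> (mset_set {1..int n})"
proof -
  let ?c = "\<lambda>\<mu> v. \<Sum>i\<in>{1..int n}. of_bool (\<mu> i = v) :: int"
  have eq: "?c \<mu> K - ?c \<mu> (- K) = ?c \<nu> K - ?c \<nu> (- K)" if "K \<noteq> 0" for K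
    using chi_eq_imp_signed_count_eq[OF chi, of K] chi_eq_imp_signed_count_eq[OF chi, of "- K"] that
    by (cases "K \<ge> 1") (simp_all add: sum_subtractf)
  have nonneg: "?c \<mu> v \<ge> 0" for \<mu> v by (rule sum_nonneg) simp
  have "?c \<nu> v \<le> ?c \<mu> v" for v
  proof (cases "\<exists>i\<in>{1..int n}. \<nu> i = v")
    case True
    then obtain i where i: "i \<in> {1..int n}" "\<nu> i = v" by blast
    have "v \<noteq> 0" using typical[OF i(1) i(1)] i(2) by auto
    have "?c \<nu> (- v) = 0"
      using typical[OF i(1)] i(2) by (intro sum.neutral) (auto simp: eq_neg_iff_add_eq_0 add.commute)
    then show ?thesis using eq[OF \<open>v \<noteq> 0\<close>] nonneg[of \<mu> "- v"] by linarith
  next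
    case False
    then have "?c \<nu> v = 0" by (intro sum.neutral) auto
    then show ?thesis using nonneg by simp
  qed
  then have "image_mset \<nu> (mset_set {1..int n}) \<subseteq># image_mset \<mu> (mset_set {1..int n})"
    unfolding subseteq_mset_def by (simp only: int_count_image finite_atLeastAtMost_int flip: of_nat_le_iff[where 'a=int]) simp
  then show ?thesis
    by (metis mset_subset_size size_image_mset subset_mset.le_imp_less_or_eq less_irrefl)
qed

text \<open>A permutation \<open>\<mu>\<close> of \<open>\<lambda>\<close> has the same sum of squares, so \<open>|\<mu> - \<lambda>|\<^sup>2 = 2 (|\<lambda>|\<^sup>2 - \<lambda> \<cdot> \<mu>)\<close>, and the second hypothesis makes this
  at most \<open>0\<close>.  The hypothesis holds for weights obtained from a dominant \<open>\<lambda>\<close> by adding positive roots.\<close>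

lemma chi_separates:
  assumes lam: "lam \<in> dominant_typical n"
    and ge: "(\<Sum>i\<in>{1..int n}. lam i * lam i) \<le> (\<Sum>i\<in>{1..int n}. lam i * \<mu> i)"
    and ne: "i \<in> {1..int n}" "\<mu> i \<noteq> lam i"
  shows "\<exists>t. chi n \<mu> t \<noteq> chi n lam t"
proof (rule ccontr)
  assume "\<not> ?thesis"
  then have "image_mset \<mu> (mset_set {1..int n}) = image_mset lam (mset_set {1..int n})"
    using lam by (intro chi_eq_imp_permutation) (auto simp: dominant_typical_def)
  from arg_cong[OF this, of "\<lambda>A. \<Sum>a\<in>#A. a * a"]
  have "(\<Sum>i\<in>{1..int n}. \<mu> i * \<mu> i) = (\<Sum>i\<in>{1..int n}. lam i * lam i)"
    by (simp add: sum_unfold_sum_mset image_mset.compositionality o_def)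
  moreover have "(\<Sum>i\<in>{1..int n}. (\<mu> i - lam i)^2) = (\<Sum>i\<in>{1..int n}. \<mu> i * \<mu> i) + (\<Sum>i\<in>{1..int n}. lam i * lam i)
      - 2 * (\<Sum>i\<in>{1..int n}. lam i * \<mu> i)"
    by (simp add: sum.distrib[symmetric] sum_subtractf[symmetric] sum_distrib_left power2_eq_square algebra_simps)
  ultimately have "(\<Sum>i\<in>{1..int n}. (\<mu> i - lam i)^2) \<le> 0" using ge by linarith
  moreover have "(\<mu> i - lam i)^2 \<le> (\<Sum>i\<in>{1..int n}. (\<mu> i - lam i)^2)"
    using ne by (intro member_le_sum) auto
  ultimately have "(\<mu> i - lam i)^2 \<le> 0" by linarith
  then show False using ne by simp
qed

section \<open>Projection onto singular vectors\<close>

text \<open>Two consequences of \<open>\<mu>\<close> being \<open>\<lambda>\<close> plus a nonempty sum of positive roots that suffice here: the first one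
  feeds \<open>chi_separates\<close>, and the second one ensures \<open>\<mu> \<noteq> \<lambda>\<close>.  Both survive the addition of further positive roots if \<open>\<lambda>\<close>
  is dominant.\<close>

definition above :: "nat \<Rightarrow> (int \<Rightarrow> int) \<Rightarrow> (int \<Rightarrow> int) \<Rightarrow> bool" where
  "above n lam \<mu> \<longleftrightarrow> (\<Sum>i\<in>{1..int n}. lam i * lam i) \<le> (\<Sum>i\<in>{1..int n}. lam i * \<mu> i) \<and>
     (\<Sum>i\<in>{1..int n}. i * \<mu> i) < (\<Sum>i\<in>{1..int n}. i * lam i)"

definition raise :: "int \<Rightarrow> int \<Rightarrow> (int \<Rightarrow> int) \<Rightarrow> int \<Rightarrow> int" where
  "raise i j \<mu> = (\<lambda>k. \<mu> k + of_bool (k = i) - of_bool (k = j))"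

lemma sum_raise:
  assumes "i \<in> {1..int n}" "j \<in> {1..int n}"
  shows "(\<Sum>k\<in>{1..int n}. c k * raise i j \<mu> k) = (\<Sum>k\<in>{1..int n}. c k * \<mu> k) + c i - c j"
proof -
  have "(\<Sum>k\<in>{1..int n}. c k * raise i j \<mu> k)
      = (\<Sum>k\<in>{1..int n}. c k * \<mu> k + (if k = i then c k else 0) - (if k = j then c k else 0))"
    by (intro sum.cong refl) (auto simp: raise_def algebra_simps)
  then show ?thesis using assms by (simp add: sum.distrib sum_subtractf)
qed

lemma above_raise:
  assumes "lam \<in> dominant_typical n" "\<mu> = lam \<or> above n lam \<mu>" "i \<in> {1..int n}" "j \<in> {1..int n}" "i < j"
  shows "above n lam (raise i j \<mu>)"
proof -
  have "lam j \<le> lam i" using assms unfolding dominant_typical_def by auto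
  then show ?thesis
    using assms(2,5) unfolding above_def sum_raise[OF assms(3,4)] by auto
qed

context queer_module
begin

lemma weight_vec_raise:
  assumes "weight_vec \<mu> v" "i \<in> I" "j \<in> I"
  shows "weight_vec (raise i j \<mu>) (app (e i j) v)" "weight_vec (raise i j \<mu>) (app (f i j) v)"
proof -
  have *: "app (e k k) v = of_int (\<mu> k) *\<^sub>C v" if "k \<in> I" for k
    using assms(1) that by (simp add: weight_vec_def)
  show "weight_vec (raise i j \<mu>) (app (e i j) v)" "weight_vec (raise i j \<mu>) (app (f i j) v)"
    unfolding weight_vec_def
  proof safe
    fix k assume k: "k \<in> I"
    show "app (e k k) (app (e i j) v) = of_int (raise i j \<mu> k) *\<^sub>C app (e i j) v"
      unfolding app_swap[OF bracket(1)[OF k k assms(2,3)]]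
      by (auto simp: *[OF k] app_scale raise_def cvec.scale_left_distrib cvec.scale_left_diff_distrib)
    show "app (e k k) (app (f i j) v) = of_int (raise i j \<mu> k) *\<^sub>C app (f i j) v"
      unfolding app_swap[OF bracket(2)[OF k k assms(2,3)]]
      by (auto simp: *[OF k] app_scale raise_def cvec.scale_left_distrib cvec.scale_left_diff_distrib)
  qed
qed

primrec zprod :: "(nat \<times> int) list \<Rightarrow> 'v \<Rightarrow> 'v" where
  "zprod [] u = u"
| "zprod (c # cs) u = zprod cs (app (Z (fst c)) u - of_int (snd c) *\<^sub>C u)"

lemma zprod_append: "zprod (cs @ cs') u = zprod cs' (zprod cs u)"
  by (induction cs arbitrary: u) simp_all

lemma zprod_zero [simp]: "zprod cs 0 = 0"
  by (induction cs) simp_all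

lemma app_zprod:
  assumes "i \<in> I" "j \<in> I"
  shows "app (e i j) (zprod cs u) = zprod cs (app (e i j) u)"
    and "app (f i j) (zprod cs u) = zprod cs (app (f i j) u)"
  using app_swap[OF Z_central(1)[OF assms]] app_swap[OF Z_central(2)[OF assms]]
  by (induction cs arbitrary: u) (simp_all add: app_diff app_scale)

lemma zprod_scale: "zprod cs (k *\<^sub>C u) = k *\<^sub>C zprod cs u"
proof (induction cs arbitrary: u)
  case (Cons c cs)
  have "app (Z (fst c)) (k *\<^sub>C u) - of_int (snd c) *\<^sub>C k *\<^sub>C u
      = k *\<^sub>C (app (Z (fst c)) u - of_int (snd c) *\<^sub>C u)"
    by (simp add: app_scale cvec.scale_right_diff_distrib mult.commute)
  then show ?case by (simp only: zprod.simps Cons.IH)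
qed simp

lemma weight_vec_zprod: "weight_vec \<mu> u \<Longrightarrow> weight_vec \<mu> (zprod cs u)"
  by (simp add: weight_vec_def app_zprod zprod_scale)

text \<open>No factor of the product vanishes on singular vectors of weight \<open>lam\<close>.\<close>

definition separating :: "(int \<Rightarrow> int) \<Rightarrow> (nat \<times> int) list \<Rightarrow> bool" where
  "separating lam cs \<longleftrightarrow> (\<forall>c\<in>set cs. chi n lam (fst c) \<noteq> snd c)"

lemma zprod_eigen:
  assumes "singular v" "weight_vec lam v" "separating lam cs"
  shows "\<exists>k. k \<noteq> 0 \<and> zprod cs v = k *\<^sub>C v"
  using assms(3)
proof (induction cs)
  case Nil
  show ?case by (intro exI[of _ 1]) simp
next
  case (Cons c cs)
  then obtain k where k: "k \<noteq> 0" "zprod cs v = k *\<^sub>C v" by (auto simp: separating_def)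
  let ?l = "of_int (chi n lam (fst c)) - of_int (snd c) :: complex"
  have "?l \<noteq> 0" using Cons.prems by (simp add: separating_def)
  moreover have "zprod (c # cs) v = (?l * k) *\<^sub>C v"
    by (simp add: Z_eigen[OF assms(1,2)] zprod_scale k flip: cvec.scale_left_diff_distrib)
  ultimately show ?case using k(1) by (intro exI[of _ "?l * k"]) simp
qed

primrec killed :: "nat \<Rightarrow> 'v \<Rightarrow> bool" where
  "killed 0 u \<longleftrightarrow> u = 0"
| "killed (Suc k) u \<longleftrightarrow> (\<forall>i\<in>I. \<forall>j\<in>I. i < j \<longrightarrow> killed k (app (e i j) u) \<and> killed k (app (f i j) u))"

lemma killed_zprod: "killed k u \<Longrightarrow> killed k (zprod cs u)"
  by (induction k arbitrary: u) (simp_all add: app_zprod)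

lemma killed_Suc: "killed k u \<Longrightarrow> killed (Suc k) u"
proof (induction k arbitrary: u)
  case (Suc k)
  then have "killed (Suc k) (app (e i j) u) \<and> killed (Suc k) (app (f i j) u)"
    if "i \<in> I" "j \<in> I" "i < j" for i j
    using that by simp
  then show ?case by (subst killed.simps) blast
qed simp

text \<open>The vectors are treated one after another: the product found for the first one is applied to the others,
  which stay in the class \<open>Q\<close>, before the next product is chosen.\<close>

lemma kill_list:
  assumes kill: "\<And>u. Q u \<Longrightarrow> \<exists>cs. separating lam cs \<and> zprod cs u = 0"
    and closed: "\<And>u cs. Q u \<Longrightarrow> Q (zprod cs u)"
  shows "(\<forall>u\<in>set us. Q u) \<Longrightarrow> \<exists>cs. separating lam cs \<and> (\<forall>u\<in>set us. zprod cs u = 0)"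
proof (induction "length us" arbitrary: us)
  case 0
  then show ?case by (intro exI[of _ "[]"]) (simp add: separating_def)
next
  case (Suc k)
  then obtain u vs where us: "us = u # vs" by (cases us) auto
  with Suc.prems kill obtain cs where cs: "separating lam cs" "zprod cs u = 0" by auto
  have "\<forall>v\<in>set (map (zprod cs) vs). Q v" using Suc.prems us closed by auto
  then obtain cs' where "separating lam cs'" "\<forall>v\<in>set (map (zprod cs) vs). zprod cs' v = 0"
    using Suc.hyps(1)[of "map (zprod cs) vs"] Suc.hyps(2) us by auto
  with cs us show ?case
    by (intro exI[of _ "cs @ cs'"]) (auto simp: zprod_append separating_def)
qed

definition raised :: "'v \<Rightarrow> 'v set" where
  "raised u = (\<Union>i\<in>I. \<Union>j\<in>I \<inter> {i<..}. {app (e i j) u, app (f i j) u})"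

text \<open>A product that annihilates the images under the raising operators makes the vector singular, as it commutes
  with the raising operators.\<close>

lemma make_singular:
  assumes kill: "\<And>w. Q w \<Longrightarrow> \<exists>cs. separating lam cs \<and> zprod cs w = 0"
    and closed: "\<And>w cs. Q w \<Longrightarrow> Q (zprod cs w)"
    and u: "\<And>w. w \<in> raised u \<Longrightarrow> Q w"
  shows "\<exists>cs. separating lam cs \<and> singular (zprod cs u)"
proof -
  have "finite (raised u)" by (simp add: raised_def)
  then obtain us where us: "set us = raised u" using finite_list by blast
  then obtain cs where cs: "separating lam cs" "\<forall>w\<in>raised u. zprod cs w = 0"
    using kill_list[of Q lam us] kill closed u by auto
  have "singular (zprod cs u)"
    unfolding singular_def using cs(2)
    by (auto simp: app_zprod raised_def)
  with cs show ?thesis by blast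
qed

lemma make_singular_above:
  assumes lam: "lam \<in> dominant_typical n" and \<mu>: "\<mu> = lam \<or> above n lam \<mu>"
    and u: "weight_vec \<mu> u" "killed (Suc k) u"
    and kill: "\<And>w. \<exists>\<mu>. weight_vec \<mu> w \<and> above n lam \<mu> \<and> killed k w \<Longrightarrow> \<exists>cs. separating lam cs \<and> zprod cs w = 0"
  shows "\<exists>cs. separating lam cs \<and> singular (zprod cs u)"
proof (rule make_singular[OF kill])
  show "\<exists>\<mu>. weight_vec \<mu> (zprod cs w) \<and> above n lam \<mu> \<and> killed k (zprod cs w)"
    if "\<exists>\<mu>. weight_vec \<mu> w \<and> above n lam \<mu> \<and> killed k w" for w cs
    using that weight_vec_zprod killed_zprod by blast
  fix w assume "w \<in> raised u"
  then obtain i j where ij: "i \<in> I" "j \<in> I" "i < j" "w = app (e i j) u \<or> w = app (f i j) u"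
    by (auto simp: raised_def)
  have "weight_vec (raise i j \<mu>) w" using weight_vec_raise[OF u(1) ij(1,2)] ij(4) by auto
  moreover have "above n lam (raise i j \<mu>)" by (rule above_raise[OF lam \<mu> ij(1,2,3)])
  moreover have "killed k w" using u(2) ij by auto
  ultimately show "\<exists>\<mu>. weight_vec \<mu> w \<and> above n lam \<mu> \<and> killed k w" by blast
qed

text \<open>Induction on the length of the words needed: the images of \<open>u\<close> under the raising operators can be annihilated,
  which makes \<open>u\<close> singular of a weight \<open>\<mu>\<close> above \<open>lam\<close>; one more factor \<open>Z t - \<chi>\<^sub>t(\<mu>)\<close> with \<open>\<chi>\<^sub>t(\<mu>) \<noteq> \<chi>\<^sub>t(\<lambda>)\<close> then
  annihilates it.\<close>

lemma kill_above:
  assumes lam: "lam \<in> dominant_typical n"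
  shows "\<exists>\<mu>. weight_vec \<mu> u \<and> above n lam \<mu> \<and> killed k u \<Longrightarrow> \<exists>cs. separating lam cs \<and> zprod cs u = 0"
proof (induction k arbitrary: u)
  case 0
  then show ?case by (intro exI[of _ "[]"]) (auto simp: separating_def)
next
  case (Suc k)
  then obtain \<mu> where \<mu>: "weight_vec \<mu> u" "above n lam \<mu>" "killed (Suc k) u" by blast
  from make_singular_above[OF lam disjI2[OF \<mu>(2)] \<mu>(1,3) Suc.IH]
  obtain cs where cs: "separating lam cs" "singular (zprod cs u)" by blast
  have "\<exists>i\<in>I. \<mu> i \<noteq> lam i"
  proof (rule ccontr)
    assume "\<not> (\<exists>i\<in>I. \<mu> i \<noteq> lam i)"
    then have "(\<Sum>i\<in>I. i * \<mu> i) = (\<Sum>i\<in>I. i * lam i)" by (intro sum.cong) auto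
    with \<mu>(2) show False by (simp add: above_def)
  qed
  then obtain t where t: "chi n \<mu> t \<noteq> chi n lam t"
    using chi_separates[OF lam, of \<mu>] \<mu>(2) unfolding above_def by blast
  have "zprod [(t, chi n \<mu> t)] (zprod cs u) = 0"
    using Z_eigen[OF cs(2) weight_vec_zprod[OF \<mu>(1)]] by simp
  then show ?case
    using cs(1) t by (intro exI[of _ "cs @ [(t, chi n \<mu> t)]"]) (auto simp: zprod_append separating_def)
qed

lemma singular_projection:
  assumes "lam \<in> dominant_typical n" "weight_vec lam u" "killed k u"
  shows "\<exists>cs. separating lam cs \<and> singular (zprod cs u)"
  by (rule make_singular_above[OF assms(1) disjI1[OF refl] assms(2) killed_Suc[OF assms(3)] kill_above[OF assms(1)]])

end

text \<open>A map of parity \<open>q\<close> between two representations that respects the action on a subspace \<open>U\<close> only.\<close>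

locale queer_hom = A: queer_module n x + B: queer_module n x'
  for n and x :: "int \<Rightarrow> int \<Rightarrow> 'v::complex_vector endo" and x' :: "int \<Rightarrow> int \<Rightarrow> 'w::complex_vector endo" +
  fixes \<Phi> :: "'v \<Rightarrow> 'w" and U :: "'v set" and q :: bit
  assumes U: "cvec.subspace U" and \<Phi>: "linear_on U \<Phi>"
    and closed: "a \<in> idx n \<Longrightarrow> b \<in> idx n \<Longrightarrow> u \<in> U \<Longrightarrow> app (x a b) u \<in> U"
    and hom: "a \<in> idx n \<Longrightarrow> b \<in> idx n \<Longrightarrow> u \<in> U \<Longrightarrow>
       \<Phi> (app (x a b) u) = sg (q * (ipar a + ipar b)) (app (x' a b) (\<Phi> u))"
begin

lemma \<Phi>_add: "u \<in> U \<Longrightarrow> v \<in> U \<Longrightarrow> \<Phi> (u + v) = \<Phi> u + \<Phi> v"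
  and \<Phi>_scale: "u \<in> U \<Longrightarrow> \<Phi> (k *\<^sub>C u) = k *\<^sub>C \<Phi> u"
  using \<Phi> by (auto simp: linear_on_def)

lemma U_minus: "u \<in> U \<Longrightarrow> - u \<in> U" and U_add: "u \<in> U \<Longrightarrow> v \<in> U \<Longrightarrow> u + v \<in> U"
  and U_sg: "u \<in> U \<Longrightarrow> sg p u \<in> U" and U_diff: "u \<in> U \<Longrightarrow> v \<in> U \<Longrightarrow> u - v \<in> U"
  and U_sum: "(\<And>i. i \<in> J \<Longrightarrow> g i \<in> U) \<Longrightarrow> (\<Sum>i\<in>J. g i) \<in> U"
  using U by (auto simp: cvec.subspace_neg cvec.subspace_add cvec.subspace_diff sg_def intro: cvec.subspace_sum)

lemma \<Phi>_minus: "u \<in> U \<Longrightarrow> \<Phi> (- u) = - \<Phi> u"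
  using \<Phi>_scale[of u "- 1"] by simp

lemma \<Phi>_diff: "u \<in> U \<Longrightarrow> v \<in> U \<Longrightarrow> \<Phi> (u - v) = \<Phi> u - \<Phi> v"
  using \<Phi>_add[of u "- v"] by (simp add: \<Phi>_minus U_minus)

lemma \<Phi>_sg: "u \<in> U \<Longrightarrow> \<Phi> (sg p u) = sg p (\<Phi> u)"
  by (cases p) (simp_all add: \<Phi>_minus)

lemma \<Phi>_sum: "finite J \<Longrightarrow> (\<And>i. i \<in> J \<Longrightarrow> g i \<in> U) \<Longrightarrow> \<Phi> (\<Sum>i\<in>J. g i) = (\<Sum>i\<in>J. \<Phi> (g i))"
proof (induction J rule: finite_induct)
  case empty
  show ?case using \<Phi>_scale[OF cvec.subspace_0[OF U], of 0] by simp
next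
  case (insert i J)
  then show ?case by (simp add: \<Phi>_add U_sum)
qed

lemma ef:
  assumes "i \<in> A.I" "j \<in> A.I" "u \<in> U"
  shows "app (A.e i j) u \<in> U" "app (A.f i j) u \<in> U"
    "\<Phi> (app (A.e i j) u) = app (B.e i j) (\<Phi> u)" "\<Phi> (app (A.f i j) u) = sg q (app (B.f i j) (\<Phi> u))"
  using closed[of i j u] closed[of "- i" j u] hom[of i j u] hom[of "- i" j u] assms
  by (auto simp: A.f_def B.f_def idx_def ipar_def)

text \<open>The signs of an odd map cancel in \<open>S0\<close>, all of whose monomials have an even number of odd generators.\<close>

lemma S_hom:
  assumes "i \<in> A.I" "j \<in> A.I" "u \<in> U"
  shows "app (A.S0 r i j) u \<in> U \<and> app (A.S1 r i j) u \<in> U \<and>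
    \<Phi> (app (A.S0 r i j) u) = app (B.S0 r i j) (\<Phi> u) \<and> \<Phi> (app (A.S1 r i j) u) = sg q (app (B.S1 r i j) (\<Phi> u))"
  using assms
proof (induction r arbitrary: i j)
  case 0
  then show ?case by (simp add: ef)
next
  case (Suc r)
  have IH: "app (A.S0 r k j) u \<in> U" "app (A.S1 r k j) u \<in> U"
    "\<Phi> (app (A.S0 r k j) u) = app (B.S0 r k j) (\<Phi> u)" "\<Phi> (app (A.S1 r k j) u) = sg q (app (B.S1 r k j) (\<Phi> u))"
    if "k \<in> A.I" for k
    using Suc.IH[OF that Suc.prems(2,3)] by blast+
  have app_sg_vec: "app a (sg p v) = sg p (app a v)" for a p and v :: 'w
    by (cases p) (simp_all add: app_minus)
  have terms: "app (A.e i k) (app (A.S0 r k j) u) \<in> U" "app (A.e i k) (app (A.S1 r k j) u) \<in> U"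
    "app (A.f i k) (app (A.S0 r k j) u) \<in> U" "app (A.f i k) (app (A.S1 r k j) u) \<in> U"
    "\<Phi> (app (A.e i k) (app (A.S0 r k j) u)) = app (B.e i k) (app (B.S0 r k j) (\<Phi> u))"
    "\<Phi> (app (A.f i k) (app (A.S1 r k j) u)) = app (B.f i k) (app (B.S1 r k j) (\<Phi> u))"
    "\<Phi> (app (A.e i k) (app (A.S1 r k j) u)) = sg q (app (B.e i k) (app (B.S1 r k j) (\<Phi> u)))"
    "\<Phi> (app (A.f i k) (app (A.S0 r k j) u)) = sg q (app (B.f i k) (app (B.S0 r k j) (\<Phi> u)))"
    if "k \<in> A.I" for k
    using ef[OF Suc.prems(1) that] IH[OF that] by (simp_all add: app_sg_vec)
  have sums: "(\<Sum>k\<in>A.I. g k) - sg (of_nat r) (\<Sum>k\<in>A.I. h k) \<in> U \<and>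
      \<Phi> ((\<Sum>k\<in>A.I. g k) - sg (of_nat r) (\<Sum>k\<in>A.I. h k))
        = (\<Sum>k\<in>A.I. \<Phi> (g k)) - sg (of_nat r) (\<Sum>k\<in>A.I. \<Phi> (h k))"
    if "\<And>k. k \<in> A.I \<Longrightarrow> g k \<in> U" "\<And>k. k \<in> A.I \<Longrightarrow> h k \<in> U" for g h
    using U_sum[of A.I g, OF that(1)] U_sum[of A.I h, OF that(2)] that
    by (simp only: \<Phi>_diff \<Phi>_sum \<Phi>_sg U_diff U_sg finite_atLeastAtMost_int simp_thms)
  from sums[of "\<lambda>k. app (A.e i k) (app (A.S0 r k j) u)" "\<lambda>k. app (A.f i k) (app (A.S1 r k j) u)"]
    sums[of "\<lambda>k. app (A.e i k) (app (A.S1 r k j) u)" "\<lambda>k. app (A.f i k) (app (A.S0 r k j) u)"]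
  show ?case
    unfolding A.S0.simps A.S1.simps B.S0.simps B.S1.simps app_simps app_sg app_sum
    using terms by (simp only: sg_sum sg_diff sg_sg add.commute[of q] cong: sum.cong)
qed

lemma Z_hom:
  assumes "u \<in> U"
  shows "app (A.Z t) u \<in> U" "\<Phi> (app (A.Z t) u) = app (B.Z t) (\<Phi> u)"
proof -
  have "app (A.S0 (2 * t) i i) u \<in> U" "\<Phi> (app (A.S0 (2 * t) i i) u) = app (B.S0 (2 * t) i i) (\<Phi> u)"
    if "i \<in> A.I" for i
    using S_hom[OF that that assms] by blast+
  then show "app (A.Z t) u \<in> U" "\<Phi> (app (A.Z t) u) = app (B.Z t) (\<Phi> u)"
    unfolding A.Z_def B.Z_def app_sum
    by (blast intro: U_sum, simp only: \<Phi>_sum finite_atLeastAtMost_int cong: sum.cong)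
qed

lemma zprod_hom:
  assumes "u \<in> U"
  shows "A.zprod cs u \<in> U \<and> \<Phi> (A.zprod cs u) = B.zprod cs (\<Phi> u)"
  using assms
  by (induction cs arbitrary: u)
    (simp_all add: Z_hom \<Phi>_diff \<Phi>_scale U_diff cvec.subspace_scale[OF U])

end

section \<open>Superspaces and operators on their carriers\<close>

lemma koszul_eq_sg: "koszul p q *\<^sub>C v = sg (p * q) (v::'a::complex_vector)"
  by (cases p; cases q) (simp_all add: koszul_def)

lemma scaleC_sg: "k *\<^sub>C sg p v = sg p (k *\<^sub>C (v::'a::complex_vector))"
  by (simp add: sg_def)

lemma linear_onD:
  "linear_on A f \<Longrightarrow> x \<in> A \<Longrightarrow> y \<in> A \<Longrightarrow> f (x + y) = f x + f y"
  "linear_on A f \<Longrightarrow> x \<in> A \<Longrightarrow> f (c *\<^sub>C x) = c *\<^sub>C f x"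
  by (auto simp: linear_on_def)

lemma linear_on_zero: "linear_on A f \<Longrightarrow> cvec.subspace A \<Longrightarrow> f 0 = 0"
  using linear_onD(2)[of A f 0 0] by (simp add: cvec.subspace_0)

lemma linear_on_minus: "linear_on A f \<Longrightarrow> x \<in> A \<Longrightarrow> f (- x) = - f x"
  using linear_onD(2)[of A f x "-1"] by simp

lemma linear_on_sg: "linear_on A f \<Longrightarrow> x \<in> A \<Longrightarrow> f (sg p x) = sg p (f x)"
  by (cases p) (simp_all add: linear_on_minus)

lemma linear_on_sum:
  assumes "linear_on A f" "cvec.subspace A" "finite J" "\<And>j. j \<in> J \<Longrightarrow> g j \<in> A"
  shows "f (\<Sum>j\<in>J. g j) = (\<Sum>j\<in>J. f (g j))"
  using assms(3,4)
proof (induction J rule: finite_induct)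
  case (insert j J)
  then show ?case by (simp add: linear_onD[OF assms(1)] cvec.subspace_sum[OF assms(2)])
qed (simp add: linear_on_zero[OF assms(1,2)])

lemma linear_on_span:
  assumes lin: "linear_on A h" and A: "cvec.subspace A" and B: "B \<subseteq> A" and D: "cvec.subspace D"
    and h: "\<And>x. x \<in> B \<Longrightarrow> h x \<in> D" and v: "v \<in> cvec.span B"
  shows "h v \<in> D"
proof -
  have "cvec.subspace {v \<in> A. h v \<in> D}"
    unfolding cvec.subspace_def using linear_onD[OF lin] linear_on_zero[OF lin A]
    by (auto simp: cvec.subspace_0 cvec.subspace_add cvec.subspace_scale A D)
  moreover have "B \<subseteq> {v \<in> A. h v \<in> D}" using B h by blast
  ultimately have "cvec.span B \<subseteq> {v \<in> A. h v \<in> D}" by (intro cvec.span_minimal)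
  with v show ?thesis by blast
qed

lemma subspace_sg: "cvec.subspace A \<Longrightarrow> v \<in> A \<Longrightarrow> sg p v \<in> A"
  by (simp add: sg_def cvec.subspace_neg)

context
  fixes M :: "('x, 'a::complex_vector) supermod"
  assumes M: "superspace M"
begin

lemma subspace_grade: "cvec.subspace (grade M p)"
  using M by (simp add: superspace_def)

lemma grade_carrier: "m \<in> grade M p \<Longrightarrow> m \<in> mcarrier M"
proof -
  assume m: "m \<in> grade M p"
  have c: "mcarrier M = {a + b | a b. a \<in> grade M 0 \<and> b \<in> grade M 1}" using M by (simp add: superspace_def)
  show ?thesis
  proof (cases "p = 0")
    case True
    then have "m = m + 0 \<and> m \<in> grade M 0 \<and> 0 \<in> grade M 1" using m by (simp add: cvec.subspace_0 subspace_grade)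
    then show ?thesis unfolding c by blast
  next
    case False
    then have "m = 0 + m \<and> 0 \<in> grade M 0 \<and> m \<in> grade M 1" using m by (simp add: cvec.subspace_0 subspace_grade)
    then show ?thesis unfolding c by blast
  qed
qed

lemma subspace_carrier: "cvec.subspace (mcarrier M)"
  using M cvec.subspace_sums[OF subspace_grade subspace_grade] by (simp add: superspace_def)

lemma grade_disjoint: "m \<in> grade M p \<Longrightarrow> m \<in> grade M (p + 1) \<Longrightarrow> m = 0"
  using M by (cases p) (auto simp: superspace_def)

lemma hcomp_unique:
  assumes "a \<in> grade M r" "m - a \<in> grade M (r + 1)"
  shows "hcomp M r m = a"
  unfolding hcomp_def
proof (rule the_equality)
  fix b assume b: "b \<in> grade M r \<and> m - b \<in> grade M (r + 1)"
  have "b - a \<in> grade M r" using b assms(1) by (simp add: cvec.subspace_diff subspace_grade)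
  moreover have "(m - a) - (m - b) \<in> grade M (r + 1)"
    by (rule cvec.subspace_diff[OF subspace_grade assms(2) conjunct2[OF b]])
  then have "b - a \<in> grade M (r + 1)" by (simp add: algebra_simps)
  ultimately have "b - a = 0" by (rule grade_disjoint)
  then show "b = a" by simp
qed (use assms in simp)

lemma carrier_decomp:
  assumes "m \<in> mcarrier M"
  obtains a b where "m = a + b" "a \<in> grade M 0" "b \<in> grade M 1"
  using assms M by (auto simp: superspace_def)

lemma twist_add_grades:
  assumes "a \<in> grade M 0" "b \<in> grade M 1"
  shows "twist M p (a + b) = a + sg p b"
proof -
  have "hcomp M 0 (a + b) = a" using assms by (intro hcomp_unique) simp_all
  moreover have "hcomp M 1 (a + b) = b" using assms by (intro hcomp_unique) simp_all
  ultimately show ?thesis by (simp add: twist_def koszul_eq_sg)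
qed

lemma twist_grade: "m \<in> grade M r \<Longrightarrow> twist M p m = sg (p * r) m"
  using twist_add_grades[of m 0 p] twist_add_grades[of 0 m p]
  by (cases r) (simp_all add: cvec.subspace_0 subspace_grade)

lemma twist_in_grade: "m \<in> grade M r \<Longrightarrow> twist M p m \<in> grade M r"
  by (simp add: twist_grade subspace_sg subspace_grade)

text \<open>The homogeneous components are unique, so they may be computed from any decomposition.\<close>

lemma linear_twist: "linear_on (mcarrier M) (twist M p)"
  unfolding linear_on_def
proof (intro conjI ballI allI)
  fix x y :: 'a and c assume "x \<in> mcarrier M" "y \<in> mcarrier M"
  then obtain a b a' b' where x: "x = a + b" "a \<in> grade M 0" "b \<in> grade M 1"
    and y: "y = a' + b'" "a' \<in> grade M 0" "b' \<in> grade M 1" by (metis carrier_decomp)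
  have "a + a' \<in> grade M 0" "b + b' \<in> grade M 1"
    using x y by (simp_all add: cvec.subspace_add subspace_grade)
  from twist_add_grades[OF this, of p] show "twist M p (x + y) = twist M p x + twist M p y"
    using x y by (simp add: twist_add_grades sg_add algebra_simps)
next
  fix c x assume "x \<in> mcarrier M"
  then obtain a b where x: "x = a + b" "a \<in> grade M 0" "b \<in> grade M 1" by (metis carrier_decomp)
  have "c *\<^sub>C a \<in> grade M 0" "c *\<^sub>C b \<in> grade M 1"
    using x by (simp_all add: cvec.subspace_scale subspace_grade)
  from twist_add_grades[OF this, of p] show "twist M p (c *\<^sub>C x) = c *\<^sub>C twist M p x"
    using x by (simp add: twist_add_grades scaleC_sg cvec.scale_right_distrib)
qed

lemma twist_carrier: "m \<in> mcarrier M \<Longrightarrow> twist M p m \<in> mcarrier M"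
proof -
  assume "m \<in> mcarrier M"
  then obtain a b where m: "m = a + b" "a \<in> grade M 0" "b \<in> grade M 1" by (metis carrier_decomp)
  then show ?thesis
    by (auto simp: twist_add_grades intro!: cvec.subspace_add subspace_sg intro: subspace_carrier grade_carrier)
qed

lemma twist_0 [simp]: "m \<in> mcarrier M \<Longrightarrow> twist M 0 m = m"
  by (elim carrier_decomp) (simp add: twist_add_grades)

lemma twist_twist: "m \<in> mcarrier M \<Longrightarrow> twist M p (twist M q m) = twist M (p + q) m"
  by (elim carrier_decomp) (simp add: twist_add_grades subspace_sg subspace_grade)

end

lemma twist_graded_map:
  assumes M: "superspace M" and g: "graded_map q M N g" and N: "superspace N" and m: "m \<in> mcarrier M"
  shows "g (twist M p m) = sg (p * q) (twist N p (g m))"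
proof -
  from m obtain a b where m: "m = a + b" "a \<in> grade M 0" "b \<in> grade M 1" by (metis carrier_decomp[OF M])
  have lin: "linear_on (mcarrier M) g" using g by (simp add: graded_map_def)
  have "g ` grade M 0 \<subseteq> grade N (0 + q)" "g ` grade M 1 \<subseteq> grade N (1 + q)"
    using g by (simp_all only: graded_map_def)
  then have gr: "g a \<in> grade N q" "g b \<in> grade N (1 + q)" using m by auto
  have "twist N p (g m) = twist N p (g a) + twist N p (g b)"
    using linear_onD(1)[OF linear_twist[OF N], of "g a" "g b"] linear_onD(1)[OF lin, of a b] gr m
    by (simp add: grade_carrier[OF M] grade_carrier[OF N])
  also have "\<dots> = sg (p * q) (g a) + sg (p * (1 + q)) (g b)"
    by (simp only: twist_grade[OF N gr(1)] twist_grade[OF N gr(2)])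
  finally have "sg (p * q) (twist N p (g m)) = g a + sg p (g b)"
    by (cases p; cases q) (simp_all add: sg_add)
  also have "\<dots> = g (twist M p m)"
    using m linear_onD(1)[OF lin, of a "sg p b"] linear_on_sg[OF lin, of b p]
    by (simp add: twist_add_grades[OF M] grade_carrier[OF M] subspace_sg subspace_carrier[OF M])
  finally show ?thesis ..
qed

lemma exists_projection:
  fixes U :: "'v::complex_vector set"
  assumes "cvec.subspace U"
  shows "\<exists>g. linear_on UNIV g \<and> range g \<subseteq> U \<and> (\<forall>u\<in>U. g u = u)"
proof -
  interpret vector_space_pair "scaleC :: complex \<Rightarrow> 'v \<Rightarrow> 'v" "scaleC :: complex \<Rightarrow> 'v \<Rightarrow> 'v" ..
  have "Vector_Spaces.linear scaleC scaleC (\<lambda>v::'v. v)"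
    by (rule cvec.linear_ident)
  from linear_exists_left_inverse_on[OF this assms]
  obtain g where g: "range g \<subseteq> U" "Vector_Spaces.linear scaleC scaleC g" "\<forall>v\<in>U. g v = v" by auto
  interpret g: Vector_Spaces.linear scaleC scaleC g by (rule g(2))
  show ?thesis using g(1,3) by (intro exI[of _ g]) (simp add: linear_on_def g.add g.scale)
qed

text \<open>The operators of a supermodule are meaningful on its carrier only.  Composing them with a fixed linear projection
  onto the carrier makes them linear operators on the ambient space, without changing them on the carrier.\<close>

definition proj :: "'v::complex_vector set \<Rightarrow> 'v \<Rightarrow> 'v" where
  "proj U = (SOME g. linear_on UNIV g \<and> range g \<subseteq> U \<and> (\<forall>u\<in>U. g u = u))"

definition extension :: "'v::complex_vector set \<Rightarrow> ('v \<Rightarrow> 'v) \<Rightarrow> 'v endo" where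
  "extension U f = Endo (\<lambda>v. f (proj U v))"

lemma proj:
  assumes "cvec.subspace U"
  shows "linear_on UNIV (proj U)" "proj U v \<in> U" "u \<in> U \<Longrightarrow> proj U u = u"
  using someI_ex[OF exists_projection[OF assms]] unfolding proj_def[symmetric] by auto

lemma app_extension:
  assumes "cvec.subspace U" "linear_on U f"
  shows "app (extension U f) v = f (proj U v)"
proof -
  have "linear_on UNIV (\<lambda>v. f (proj U v))"
    using proj[OF assms(1)] assms(2) by (simp add: linear_on_def)
  then show ?thesis by (simp add: extension_def Endo_inverse)
qed

lemma app_extension_in:
  assumes "cvec.subspace U" "linear_on U f" "u \<in> U"
  shows "app (extension U f) u = f u"
  using app_extension[OF assms(1,2)] proj(3)[OF assms(1,3)] by simp

text \<open>Operators of this kind are determined by their values on \<open>U\<close>.\<close>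

definition supported :: "'v::complex_vector set \<Rightarrow> 'v endo \<Rightarrow> bool" where
  "supported U a \<longleftrightarrow> (\<forall>v. app a v = app a (proj U v))"

lemma supported_eqI:
  assumes "cvec.subspace U" "supported U a" "supported U b" "\<And>u. u \<in> U \<Longrightarrow> app a u = app b u"
  shows "a = b"
  using assms proj(2)[OF assms(1)] by (intro endo_eqI) (metis supported_def)

lemma supported_extension: "cvec.subspace U \<Longrightarrow> linear_on U f \<Longrightarrow> supported U (extension U f)"
  by (simp add: supported_def app_extension proj)

lemma supported_zero: "supported U 0"
  by (simp add: supported_def)

lemma supported_add: "supported U a \<Longrightarrow> supported U b \<Longrightarrow> supported U (a + b)"
  unfolding supported_def app_simps by simp

lemma supported_diff: "supported U a \<Longrightarrow> supported U b \<Longrightarrow> supported U (a - b)"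
  unfolding supported_def app_simps by simp

lemma supported_sg: "supported U a \<Longrightarrow> supported U (sg p a)"
  unfolding supported_def app_sg by simp

lemma supported_mult: "supported U b \<Longrightarrow> supported U (a * b)"
  unfolding supported_def app_simps by simp

lemma supported_if: "supported U a \<Longrightarrow> supported U b \<Longrightarrow> supported U (if P then a else b)"
  by simp

lemmas supported_intros = supported_zero supported_add supported_diff supported_sg supported_mult supported_if

lemma supported_sum: "(\<And>i. i \<in> J \<Longrightarrow> supported U (g i)) \<Longrightarrow> supported U (\<Sum>i\<in>J. g i)"
  by (induction J rule: infinite_finite_induct) (simp_all add: supported_zero supported_add)

section \<open>Operators on the tensor product\<close>

lemma sg_fun: "sg p u = (\<lambda>w. sg p (u w))" for u :: "'b \<Rightarrow> 'a::ab_group_add"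
  by (cases p) (auto simp: fun_Compl_def)

lemma sum_fun: "(\<Sum>i\<in>J. g i) = (\<lambda>w. \<Sum>i\<in>J. g i w)" for g :: "'i \<Rightarrow> 'b \<Rightarrow> 'a::ab_group_add"
  by (induction J rule: infinite_finite_induct) (auto simp: fun_eq_iff)

lemma words_update: "w \<in> tensor_words n d \<Longrightarrow> b \<in> idx n \<Longrightarrow> w[i := b] \<in> tensor_words n d"
  using set_update_subset_insert[of w i b] by (auto simp: tensor_words_def)

lemma words_nth: "w \<in> tensor_words n d \<Longrightarrow> i \<in> {1..d} \<Longrightarrow> w ! (i - 1) \<in> idx n"
  by (auto simp: tensor_words_def)

lemma words_length: "w \<in> tensor_words n d \<Longrightarrow> length w = d"
  by (simp add: tensor_words_def)

lemma word_par_update: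
  "i < length w \<Longrightarrow> word_par (w[i := b]) = word_par w + (ipar (w ! i) + ipar b)"
proof (induction w arbitrary: i)
  case (Cons a w)
  then show ?case by (cases i) (simp_all add: word_par_def ac_simps)
qed simp

text \<open>The elements of \<open>q(n)\<close> with signed indices that are the source of families with the property \<open>q_rep\<close>.\<close>

definition q_mat :: "int \<Rightarrow> int \<Rightarrow> smatrix" where
  "q_mat a b = E_mat a b + E_mat (- a) (- b)"

lemma q_mat_uminus: "q_mat (- a) (- b) = q_mat a b"
  by (simp add: q_mat_def add.commute)

lemma e_mat_eq: "e_mat i j = q_mat i j" and f_mat_eq: "f_mat i j = q_mat (- i) j"
  by (simp_all add: e_mat_def f_mat_def q_mat_def)

lemma idx_cases:
  assumes "a \<in> idx n"
  obtains "a \<in> {1..int n}" "ipar a = 0" | "- a \<in> {1..int n}" "ipar a = 1"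
  using assms by (cases "a > 0") (auto simp: idx_def ipar_def)

lemma q_mat_part:
  assumes "a \<in> idx n" "b \<in> idx n"
  shows "q_mat a b \<in> q_part n (ipar a + ipar b)"
proof -
  have e: "q_mat i j \<in> q_part n 0" and f: "q_mat (- i) j \<in> q_part n 1"
    if "i \<in> {1..int n}" "j \<in> {1..int n}" for i j
    using that unfolding q_part_def e_mat_eq f_mat_eq by (auto intro!: cvec.span_base)
  show ?thesis
    using assms(1)
  proof (cases rule: idx_cases)
    case 1
    note a = this
    show ?thesis using assms(2)
    proof (cases rule: idx_cases)
      case 1
      then show ?thesis using e[OF a(1)] a by simp
    next
      case 2
      then show ?thesis using f[OF a(1) 2(1)] a q_mat_uminus[of a b] by (simp add: q_mat_def add.commute)
    qed
  next
    case 2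
    note a = this
    show ?thesis using assms(2)
    proof (cases rule: idx_cases)
      case 1
      then show ?thesis using f[OF a(1) 1(1)] a by simp
    next
      case 2
      then show ?thesis using e[OF a(1) 2(1)] a q_mat_uminus[of a b] by simp
    qed
  qed
qed

lemma q_part_subset: "q_part n p \<subseteq> q_alg n"
  unfolding q_part_def q_alg_def by (rule cvec.span_mono) auto

lemma mmul_E_mat: "b \<in> idx n \<Longrightarrow> mmul n (E_mat a b) (E_mat c e) = (if b = c then E_mat a e else 0)"
proof (intro ext)
  fix k l assume b: "b \<in> idx n"
  have "mmul n (E_mat a b) (E_mat c e) k l = (\<Sum>j\<in>idx n. if j = b then of_bool (k = a \<and> b = c \<and> l = e) else 0)"
    unfolding mmul_def E_mat_def by (intro sum.cong refl) auto
  then show "mmul n (E_mat a b) (E_mat c e) k l = (if b = c then E_mat a e else 0) k l"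
    using b by (simp add: E_mat_def)
qed

lemma mmul_add: "mmul n (x + x') y = mmul n x y + mmul n x' y" "mmul n x (y + y') = mmul n x y + mmul n x y'"
  by (auto simp: mmul_def fun_eq_iff sum.distrib algebra_simps)

lemma mmul_q_mat:
  assumes "b \<in> idx n"
  shows "mmul n (q_mat a b) (q_mat c e) = (if b = c then q_mat a e else 0) + (if b = - c then q_mat a (- e) else 0)"
  using assms idx_nonzero[OF assms]
  by (auto simp: q_mat_def mmul_add mmul_E_mat)

locale tensor =
  fixes n d :: nat and M :: "(smatrix, 'a::complex_vector) supermod"
  assumes qM: "q_supermodule n M"
begin

abbreviation W :: "int list set" where "W \<equiv> tensor_words n d"
abbreviation T :: "(smatrix, int list \<Rightarrow> 'a) supermod" where "T \<equiv> tensor_module n d M"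
abbreviation U :: "(int list \<Rightarrow> 'a) set" where "U \<equiv> mcarrier T"
abbreviation mu :: "nat \<Rightarrow> int \<Rightarrow> int \<Rightarrow> (int list \<Rightarrow> 'a) \<Rightarrow> int list \<Rightarrow> 'a" where
  "mu i a b \<equiv> at_factor n d M i (E_mat a b)"

lemma sM: "superspace M"
  using qM by (simp add: q_supermodule_def)

lemmas subspace_M = subspace_carrier[OF sM]

lemma graded_act: "z \<in> q_part n p \<Longrightarrow> graded_map p M M (act M z)"
  using qM by (simp add: q_supermodule_def)

lemma linear_act: "z \<in> q_part n p \<Longrightarrow> linear_on (mcarrier M) (act M z)"
  using graded_act by (auto simp: graded_map_def)

lemma act_grade: "z \<in> q_part n p \<Longrightarrow> m \<in> grade M r \<Longrightarrow> act M z m \<in> grade M (r + p)"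
  using graded_act[of z p] unfolding graded_map_def by blast

lemma act_carrier: "z \<in> q_part n p \<Longrightarrow> m \<in> mcarrier M \<Longrightarrow> act M z m \<in> mcarrier M"
proof -
  assume z: "z \<in> q_part n p" and "m \<in> mcarrier M"
  then obtain a b where m: "m = a + b" "a \<in> grade M 0" "b \<in> grade M 1" by (metis carrier_decomp[OF sM])
  have "act M z m = act M z a + act M z b"
    using m linear_onD(1)[OF linear_act[OF z], of a b] by (simp add: grade_carrier[OF sM])
  then show ?thesis using act_grade[OF z] m grade_carrier[OF sM]
    by (metis cvec.subspace_add[OF subspace_M])
qed

lemma linear_act_left: "m \<in> mcarrier M \<Longrightarrow> linear_on (q_alg n) (\<lambda>z. act M z m)"
  using qM by (simp add: q_supermodule_def)

lemma subspace_q_alg: "cvec.subspace (q_alg n)"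
  unfolding q_alg_def by (rule cvec.subspace_span)

lemma act_sbracket:
  assumes "z \<in> q_part n r" "z' \<in> q_part n s" "m \<in> mcarrier M"
  shows "act M (sbracket n r s z z') m = act M z (act M z' m) - sg (r * s) (act M z' (act M z m))"
  using qM assms unfolding q_supermodule_def koszul_eq_sg by simp

lemma act_bracket:
  assumes "a \<in> idx n" "b \<in> idx n" "c \<in> idx n" "e \<in> idx n" "m \<in> mcarrier M"
  shows "act M (q_mat a b) (act M (q_mat c e) m)
    = sg ((ipar a + ipar b) * (ipar c + ipar e)) (act M (q_mat c e) (act M (q_mat a b) m))
      + (if b = c then act M (q_mat a e) m else 0) + (if b = - c then act M (q_mat a (- e)) m else 0)
      - sg ((ipar a + ipar b) * (ipar c + ipar e))
          ((if a = e then act M (q_mat c b) m else 0) + (if a = - e then act M (q_mat c (- b)) m else 0))"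
proof -
  let ?s = "(ipar a + ipar b) * (ipar c + ipar e)"
  let ?D = "\<lambda>P a b. if P then q_mat a b else 0"
  note lin = linear_act_left[OF assms(5)]
  have mem: "q_mat a b \<in> q_alg n" if "a \<in> idx n" "b \<in> idx n" for a b
    using q_mat_part[OF that] q_part_subset by blast
  then have D: "?D P a b \<in> q_alg n" if "a \<in> idx n" "b \<in> idx n" for P a b
    using that subspace_q_alg by (auto simp: cvec.subspace_0)
  have actD: "act M (?D P a b) m = (if P then act M (q_mat a b) m else 0)" for P a b
    using linear_on_zero[OF lin subspace_q_alg] by simp
  have 1: "sbracket n (ipar a + ipar b) (ipar c + ipar e) (q_mat a b) (q_mat c e)
      = (?D (b = c) a e + ?D (b = - c) a (- e)) - sg ?s (?D (a = e) c b + ?D (a = - e) c (- b))"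
    unfolding sbracket_def mmul_q_mat[OF assms(2)] mmul_q_mat[OF assms(4)] koszul_eq_sg
    by auto
  have 2: "act M ((?D (b = c) a e + ?D (b = - c) a (- e)) - sg ?s (?D (a = e) c b + ?D (a = - e) c (- b))) m
     = (act M (?D (b = c) a e) m + act M (?D (b = - c) a (- e)) m)
       - sg ?s (act M (?D (a = e) c b) m + act M (?D (a = - e) c (- b)) m)"
  proof -
    have diff: "act M (z - z') m = act M z m - act M z' m" if "z \<in> q_alg n" "z' \<in> q_alg n" for z z'
      using linear_onD(1)[OF lin, of z "- z'"] linear_on_minus[OF lin, of z'] that
      by (simp add: cvec.subspace_neg[OF subspace_q_alg])
    show ?thesis
      using assms D by (simp only: diff linear_on_sg[OF lin] linear_onD(1)[OF lin] uminus_idx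
        cvec.subspace_add[OF subspace_q_alg] subspace_sg[OF subspace_q_alg])
  qed
  have 3: "act M (sbracket n (ipar a + ipar b) (ipar c + ipar e) (q_mat a b) (q_mat c e)) m
      = act M (q_mat a b) (act M (q_mat c e) m) - sg ?s (act M (q_mat c e) (act M (q_mat a b) m))"
    by (rule act_sbracket[OF q_mat_part[OF assms(1,2)] q_mat_part[OF assms(3,4)] assms(5)])
  have rearrange: "l = t + u + v - k" if "l - t = u + v - k" for l t u v k :: 'a
    using that by (simp add: algebra_simps)
  show ?thesis
    by (rule rearrange)
      (rule trans[OF 3[symmetric] trans[OF arg_cong[OF 1, of "\<lambda>z. act M z m"] 2[unfolded actD]]])
qed

lemma U_iff: "u \<in> U \<longleftrightarrow> (\<forall>w\<in>W. u w \<in> mcarrier M) \<and> (\<forall>w. w \<notin> W \<longrightarrow> u w = 0)"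
  by (auto simp: tensor_module_def)

lemma U_at: "u \<in> U \<Longrightarrow> u w \<in> mcarrier M"
  by (cases "w \<in> W") (auto simp: U_iff cvec.subspace_0[OF subspace_M])

lemma subspace_U: "cvec.subspace U"
  unfolding cvec.subspace_def
  by (auto simp: U_iff scaleC_fun_def cvec.subspace_0[OF subspace_M] cvec.subspace_add[OF subspace_M] cvec.subspace_scale[OF subspace_M])

lemma grade_T_iff: "u \<in> grade T p \<longleftrightarrow> (\<forall>w\<in>W. u w \<in> grade M (p + word_par w)) \<and> (\<forall>w. w \<notin> W \<longrightarrow> u w = 0)"
  by (auto simp: tensor_module_def)

lemma linear_at0: "z \<in> q_part n p \<Longrightarrow> linear_on U (at0 M z)"
  using linear_onD[OF linear_act] U_at by (auto simp: linear_on_def at0_def fun_eq_iff scaleC_fun_def)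

lemma at0_U: "z \<in> q_part n p \<Longrightarrow> u \<in> U \<Longrightarrow> at0 M z u \<in> U"
  using act_carrier U_at linear_on_zero[OF linear_act subspace_M] by (auto simp: U_iff at0_def)

text \<open>A matrix unit in factor \<open>i\<close> reads the coefficient at the word with letter \<open>b\<close> and writes it at the word with letter
  \<open>a\<close>; the sign counts the parity of the letters before, and \<open>twist\<close> that of the coefficient.\<close>

lemma mu_apply:
  assumes "a \<in> idx n" "b \<in> idx n" "i \<in> {1..d}"
  shows "mu i a b u w = (if w \<in> W \<and> w ! (i - 1) = a
     then sg ((ipar a + ipar b) * word_par (take (i - 1) w)) (twist M (ipar a + ipar b) (u (w[i - 1 := b]))) else 0)"
proof (cases "w \<in> W \<and> w ! (i - 1) = a")
  case True
  have "(\<Sum>j\<in>idx n. (E_mat a b a j * koszul (ipar a + ipar j) (word_par (take (i - 1) w)))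
                    *\<^sub>C twist M (ipar a + ipar j) (u (w[i - 1 := j])))
     = (\<Sum>j\<in>idx n. if j = b then koszul (ipar a + ipar j) (word_par (take (i - 1) w))
                    *\<^sub>C twist M (ipar a + ipar j) (u (w[i - 1 := j])) else 0)"
    by (intro sum.cong refl) (auto simp: E_mat_def)
  with True show ?thesis using assms by (simp add: at_factor_def koszul_eq_sg)
next
  case False
  then show ?thesis by (auto simp: at_factor_def E_mat_def)
qed

lemma at_factor_expand:
  assumes "i \<in> {1..d}"
  shows "at_factor n d M i A u = (\<Sum>a\<in>idx n. \<Sum>b\<in>idx n. A a b *\<^sub>C mu i a b u)"
proof
  fix w
  show "at_factor n d M i A u w = (\<Sum>a\<in>idx n. \<Sum>b\<in>idx n. A a b *\<^sub>C mu i a b u) w"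
  proof (cases "w \<in> W")
    case True
    let ?k = "w ! (i - 1)"
    have "(\<Sum>a\<in>idx n. \<Sum>b\<in>idx n. A a b *\<^sub>C mu i a b u) w
        = (\<Sum>a\<in>idx n. if a = ?k then \<Sum>b\<in>idx n. A a b *\<^sub>C mu i a b u w else 0)"
      unfolding sum_fun scaleC_fun_def
      by (intro sum.cong refl) (auto simp: mu_apply[OF _ _ assms] intro!: sum.neutral)
    also have "\<dots> = (\<Sum>b\<in>idx n. A ?k b *\<^sub>C mu i ?k b u w)"
      using words_nth[OF True assms] by simp
    also have "\<dots> = (\<Sum>j\<in>idx n. A ?k j *\<^sub>C koszul (ipar ?k + ipar j) (word_par (take (i - 1) w))
                    *\<^sub>C twist M (ipar ?k + ipar j) (u (w[i - 1 := j])))"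
      using True by (intro sum.cong refl) (simp only: mu_apply[OF words_nth[OF True assms] _ assms] koszul_eq_sg simp_thms if_True)
    also have "\<dots> = at_factor n d M i A u w"
      using True by (simp add: at_factor_def Let_def)
    finally show ?thesis ..
  next
    case False
    then show ?thesis by (simp add: at_factor_def sum_fun scaleC_fun_def)
  qed
qed

lemma linear_mu:
  assumes "a \<in> idx n" "b \<in> idx n" "i \<in> {1..d}"
  shows "linear_on U (mu i a b)"
  using linear_onD[OF linear_twist[OF sM]] U_at
  by (auto simp: linear_on_def fun_eq_iff mu_apply[OF assms] scaleC_fun_def sg_add scaleC_sg)

lemma mu_U:
  assumes "a \<in> idx n" "b \<in> idx n" "i \<in> {1..d}" "u \<in> U"
  shows "mu i a b u \<in> U"
  using U_at[OF assms(4)]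
  by (auto simp: U_iff mu_apply[OF assms(1-3)] cvec.subspace_0[OF subspace_M] intro!: subspace_sg subspace_M twist_carrier sM)

definition x :: "int \<Rightarrow> int \<Rightarrow> (int list \<Rightarrow> 'a) endo" where
  "x a b = extension U (at0 M (q_mat a b))"

definition m :: "nat \<Rightarrow> int \<Rightarrow> int \<Rightarrow> (int list \<Rightarrow> 'a) endo" where
  "m i a b = extension U (mu i a b)"

definition p :: "(int list \<Rightarrow> 'a) endo" where
  "p = extension U (\<lambda>u. u)"

lemma app_x: "a \<in> idx n \<Longrightarrow> b \<in> idx n \<Longrightarrow> u \<in> U \<Longrightarrow> app (x a b) u = at0 M (q_mat a b) u"
  unfolding x_def by (rule app_extension_in[OF subspace_U linear_at0[OF q_mat_part]])

lemma app_m: "i \<in> {1..d} \<Longrightarrow> a \<in> idx n \<Longrightarrow> b \<in> idx n \<Longrightarrow> u \<in> U \<Longrightarrow> app (m i a b) u = mu i a b u"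
  unfolding m_def by (rule app_extension_in[OF subspace_U linear_mu])

lemma app_p: "u \<in> U \<Longrightarrow> app p u = u"
  unfolding p_def by (rule app_extension_in[OF subspace_U]) (simp add: linear_on_def)

lemma x_supported: "a \<in> idx n \<Longrightarrow> b \<in> idx n \<Longrightarrow> supported U (x a b)"
  unfolding x_def by (rule supported_extension[OF subspace_U linear_at0[OF q_mat_part]])

lemma m_supported: "i \<in> {1..d} \<Longrightarrow> a \<in> idx n \<Longrightarrow> b \<in> idx n \<Longrightarrow> supported U (m i a b)"
  unfolding m_def by (rule supported_extension[OF subspace_U linear_mu])

lemma p_supported: "supported U p"
  unfolding p_def by (rule supported_extension[OF subspace_U]) (simp add: linear_on_def)

lemma x_U: "a \<in> idx n \<Longrightarrow> b \<in> idx n \<Longrightarrow> u \<in> U \<Longrightarrow> app (x a b) u \<in> U"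
  using at0_U[OF q_mat_part] by (simp add: app_x)

lemma m_U: "i \<in> {1..d} \<Longrightarrow> a \<in> idx n \<Longrightarrow> b \<in> idx n \<Longrightarrow> u \<in> U \<Longrightarrow> app (m i a b) u \<in> U"
  by (simp add: app_m mu_U)

lemma x_at: "a \<in> idx n \<Longrightarrow> b \<in> idx n \<Longrightarrow> u \<in> U \<Longrightarrow> app (x a b) u w = act M (q_mat a b) (u w)"
  by (simp add: app_x at0_def)

lemma q_rep_x: "q_rep n x"
  unfolding q_rep_def
proof (intro conjI allI ballI)
  fix a b show "x (- a) (- b) = x a b" by (simp add: x_def q_mat_uminus)
next
  fix a b c e assume I: "a \<in> idx n" "b \<in> idx n" "c \<in> idx n" "e \<in> idx n"
  show "x a b * x c e = sg ((ipar a + ipar b) * (ipar c + ipar e)) (x c e * x a b)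
         + (if b = c then x a e else 0) + (if b = - c then x a (- e) else 0)
         - sg ((ipar a + ipar b) * (ipar c + ipar e))
             ((if a = e then x c b else 0) + (if a = - e then x c (- b) else 0))" (is "?l = ?r")
  proof (rule supported_eqI[OF subspace_U])
    show "supported U ?l" "supported U ?r"
      using I by (intro supported_intros x_supported; simp)+
    fix u assume u: "u \<in> U"
    show "app ?l u = app ?r u"
    proof
      fix w
      have if_app: "app (if P then a else 0) u w = (if P then app a u w else 0)" for P a
        by simp
      show "app ?l u w = app ?r u w"
        using I u
        by (simp only: app_simps app_sg plus_fun_apply minus_apply sg_fun if_app x_at x_U uminus_idx
            act_bracket[OF I U_at[OF u, of w]] simp_thms)
    qed
  qed
qed

lemma x_m:
  assumes i: "i \<in> {1..d}"
  shows "supercommute n x (m i)"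
  unfolding supercommute_def
proof (intro ballI)
  fix a b c e assume I: "a \<in> idx n" "b \<in> idx n" "c \<in> idx n" "e \<in> idx n"
  show "x a b * m i c e = sg ((ipar a + ipar b) * (ipar c + ipar e)) (m i c e * x a b)" (is "?l = ?r")
  proof (rule supported_eqI[OF subspace_U])
    show "supported U ?l" "supported U ?r"
      using I i by (intro supported_intros x_supported m_supported; simp)+
    fix u assume u: "u \<in> U"
    show "app ?l u = app ?r u"
    proof
      fix w
      note q = q_mat_part[OF I(1,2)]
      have "act M (q_mat a b) (twist M r v) = sg (r * (ipar a + ipar b)) (twist M r (act M (q_mat a b) v))"
        if "v \<in> mcarrier M" for r v
        by (rule twist_graded_map[OF sM graded_act[OF q] sM that])
      moreover have "app ?l u w = act M (q_mat a b) (mu i c e u w)"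
        using I i u by (simp only: app_simps x_at mu_U app_m)
      moreover have "app ?r u w = sg ((ipar a + ipar b) * (ipar c + ipar e)) (mu i c e (app (x a b) u) w)"
        using I i u by (simp only: app_simps app_sg sg_fun x_U app_m)
      ultimately show "app ?l u w = app ?r u w"
        using I u linear_on_zero[OF linear_act[OF q] subspace_M]
          linear_on_sg[OF linear_act[OF q]] U_at[OF u]
        by (simp add: mu_apply[OF I(3,4) i] x_at twist_carrier sM mult.commute[of "ipar c + ipar e"] add.commute)
    qed
  qed
qed

lemma m_units:
  assumes i: "i \<in> {1..d}"
  shows "matrix_units n (m i)"
  unfolding matrix_units_def
proof (intro ballI)
  fix a b c e assume I: "a \<in> idx n" "b \<in> idx n" "c \<in> idx n" "e \<in> idx n"
  show "m i a b * m i c e = (if b = c then m i a e else 0)" (is "?l = ?r")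
  proof (rule supported_eqI[OF subspace_U])
    show "supported U ?l" "supported U ?r"
      using I i by (intro supported_intros m_supported; simp)+
    fix u assume u: "u \<in> U"
    show "app ?l u = app ?r u"
    proof
      fix w
      have "app ?l u w = mu i a b (mu i c e u) w" using I i u by (simp only: app_simps app_m mu_U)
      also have "\<dots> = (if b = c then mu i a e u w else 0)"
      proof (cases "w \<in> W \<and> w ! (i - 1) = a")
        case True
        let ?t = "word_par (take (i - 1) w)"
        have l: "i - 1 < length w" using True i words_length by auto
        have b: "w[i - 1 := b] \<in> W" using True I words_update by auto
        have tz: "twist M r 0 = 0" for r by (rule linear_on_zero[OF linear_twist[OF sM] subspace_M])
        have exps: "(ipar a + ipar c) * ?t + (ipar c + ipar e) * ?t = (ipar a + ipar e) * ?t"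
          "ipar a + ipar c + (ipar c + ipar e) = ipar a + ipar e"
          by (cases "ipar a"; cases "ipar c"; cases "ipar e"; simp)+
        show ?thesis
          using True I i l b U_at[OF u]
          by (simp add: mu_apply tz linear_on_sg[OF linear_twist[OF sM]] twist_carrier sM twist_twist[OF sM] exps del: One_nat_def)
      next
        case False
        then show ?thesis using I i by (auto simp: mu_apply)
      qed
      also have "\<dots> = app ?r u w" using I i u by (simp add: app_m)
      finally show "app ?l u w = app ?r u w" .
    qed
  qed
qed

text \<open>Changing letter \<open>i\<close> from \<open>a\<close> to \<open>b\<close> changes the parity seen by a factor to its right by \<open>|a| + |b|\<close>, and is not seen
  by a factor to its left.  Exactly one of the two orders therefore produces the sign.\<close>

lemma m_m:
  assumes ij: "i \<in> {1..d}" "j \<in> {1..d}" "i \<noteq> j"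
  shows "supercommute n (m i) (m j)"
  unfolding supercommute_def
proof (intro ballI)
  fix a b c e assume I: "a \<in> idx n" "b \<in> idx n" "c \<in> idx n" "e \<in> idx n"
  show "m i a b * m j c e = sg ((ipar a + ipar b) * (ipar c + ipar e)) (m j c e * m i a b)" (is "?l = ?r")
  proof (rule supported_eqI[OF subspace_U])
    show "supported U ?l" "supported U ?r"
      using I ij by (intro supported_intros m_supported; simp)+
    fix u assume u: "u \<in> U"
    have *: "mu i a b (mu j c e u) w = (if w \<in> W \<and> w ! (i - 1) = a \<and> w ! (j - 1) = c then
        sg ((ipar a + ipar b) * word_par (take (i - 1) w) + (ipar c + ipar e) * word_par (take (j - 1) w)
            + (if i < j then (ipar a + ipar b) * (ipar c + ipar e) else 0))
          (twist M (ipar a + ipar b + (ipar c + ipar e)) (u (w[i - 1 := b, j - 1 := e]))) else 0)"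
      if I: "a \<in> idx n" "b \<in> idx n" "c \<in> idx n" "e \<in> idx n" and ij: "i \<in> {1..d}" "j \<in> {1..d}" "i \<noteq> j" for a b c e i j w
    proof (cases "w \<in> W \<and> w ! (i - 1) = a")
      case True
      have l: "i - 1 < length w" "j - 1 < length w" using True ij words_length by auto
      have b: "w[i - 1 := b] \<in> W" using True I words_update by auto
      have ne: "i - 1 \<noteq> j - 1" using ij by auto
      have tz: "twist M r 0 = 0" for r by (rule linear_on_zero[OF linear_twist[OF sM] subspace_M])
      have par: "word_par (take (j - 1) (w[i - 1 := b]))
          = word_par (take (j - 1) w) + (if i < j then ipar a + ipar b else 0)"
      proof (cases "i < j")
        case True': True
        then have "i - 1 < j - 1" using ij by auto
        then show ?thesis using True True' l by (simp add: take_update_swap word_par_update)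
      next
        case False
        then have "j - 1 \<le> i - 1" by simp
        then show ?thesis using False by (simp add: take_update_cancel)
      qed
      have sgn: "(ipar a + ipar b) * s + (ipar c + ipar e) * (t + (if i < j then ipar a + ipar b else 0))
        = (ipar a + ipar b) * s + (ipar c + ipar e) * t + (if i < j then (ipar a + ipar b) * (ipar c + ipar e) else 0)" for s t
        by (simp add: algebra_simps)
      show ?thesis
        using True I ij l b ne U_at[OF u]
        by (simp add: mu_apply tz par linear_on_sg[OF linear_twist[OF sM]] twist_carrier sM twist_twist[OF sM] sgn del: One_nat_def)
    next
      case False
      then show ?thesis using I ij by (auto simp: mu_apply)
    qed
    show "app ?l u = app ?r u"
    proof
      fix w
      have "i - 1 \<noteq> j - 1" using ij by auto
      then have sw: "w[j - 1 := e, i - 1 := b] = w[i - 1 := b, j - 1 := e]" by (rule list_update_swap[symmetric])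
      have "app ?l u w = mu i a b (mu j c e u) w" using I ij u by (simp only: app_simps app_m mu_U)
      also have "\<dots> = sg ((ipar a + ipar b) * (ipar c + ipar e)) (mu j c e (mu i a b u) w)"
        unfolding *[OF I ij] *[OF I(3,4,1,2) ij(2,1) ij(3)[symmetric]] sw
        using ij(3) by (auto simp: ac_simps)
      also have "\<dots> = app ?r u w" using I ij u by (simp only: app_simps app_sg app_m mu_U sg_fun)
      finally show "app ?l u w = app ?r u w" .
    qed
  qed
qed

lemma m_sum:
  assumes i: "i \<in> {1..d}"
  shows "(\<Sum>k\<in>idx n. m i k k) = p"
proof (rule supported_eqI[OF subspace_U])
  show "supported U (\<Sum>k\<in>idx n. m i k k)" using i by (intro supported_sum m_supported)
  fix u assume u: "u \<in> U"
  show "app (\<Sum>k\<in>idx n. m i k k) u = app p u"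
  proof
    fix w
    have "app (\<Sum>k\<in>idx n. m i k k) u w = (\<Sum>k\<in>idx n. mu i k k u w)"
      using i u by (simp add: app_m sum_fun cong: sum.cong_simp)
    also have "\<dots> = u w"
    proof (cases "w \<in> W")
      case True
      have "(\<Sum>k\<in>idx n. mu i k k u w) = (\<Sum>k\<in>idx n. if k = w ! (i - 1) then u w else 0)"
        using True i U_at[OF u] by (intro sum.cong refl) (auto simp: mu_apply sM)
      then show ?thesis using words_nth[OF True i] by simp
    next
      case False
      then show ?thesis using u i by (simp add: mu_apply U_iff cong: sum.cong_simp)
    qed
    finally show "app (\<Sum>k\<in>idx n. m i k k) u w = app p u w" using u by (simp add: app_p)
  qed
qed (rule p_supported)

sublocale q_tensor n d x m p
  by unfold_locales (auto intro: q_rep_x m_units x_m m_m m_sum)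

end

lemma sum_idx_split: "(\<Sum>a\<in>idx n. g a) = (\<Sum>k\<in>{1..int n}. g k + g (- k))"
proof -
  have "idx n = {1..int n} \<union> uminus ` {1..int n}"
  proof (intro set_eqI iffI)
    fix a assume "a \<in> idx n"
    then show "a \<in> {1..int n} \<union> uminus ` {1..int n}"
      by (cases "a > 0") (auto simp: idx_def image_iff intro: bexI[of _ "- a"])
  qed (auto simp: idx_def)
  then have "(\<Sum>a\<in>idx n. g a) = (\<Sum>k\<in>{1..int n}. g k) + (\<Sum>k\<in>uminus ` {1..int n}. g k)"
    by (simp only:) (rule sum.union_disjoint; force)
  then show ?thesis by (simp add: sum.reindex inj_on_def sum.distrib del: image_uminus_atLeastAtMost)
qed

text \<open>Over signed indices, \<open>C\<close> is \<open>\<Sum>\<^sub>b sgn(b) E\<^bsub>-b,b\<^esub>\<close>.\<close>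

lemma C_mat_apply:
  assumes "a \<in> idx n" "b \<in> idx n"
  shows "C_mat n a b = (if a = - b then (if b > 0 then 1 else - 1) else 0)"
proof -
  have "C_mat n a b = (\<Sum>k\<in>{1..int n}. f_bar k k a b)"
    by (simp add: C_mat_def sum_fun)
  also have "\<dots> = (\<Sum>k\<in>{1..int n}. if k = \<bar>b\<bar> then (if a = - b then (if b > 0 then 1 else - 1) else 0) else 0)"
    by (intro sum.cong refl) (auto simp: f_bar_def E_mat_def)
  also have "\<dots> = (if a = - b then (if b > 0 then 1 else - 1) else 0)"
    using assms by (auto simp: idx_def)
  finally show ?thesis .
qed

context tensor
begin

lemma C_op_eq:
  assumes "i \<in> {1..d}" "u \<in> U"
  shows "C_op n d M i u = app (c i) u"
proof -
  have "C_op n d M i u = (\<Sum>b\<in>idx n. \<Sum>a\<in>idx n. C_mat n a b *\<^sub>C mu i a b u)"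
    unfolding C_op_def by (subst at_factor_expand[OF assms(1)]) (rule sum.swap)
  also have "\<dots> = (\<Sum>b\<in>idx n. \<Sum>a\<in>idx n. if a = - b then sg (ipar b) (mu i (- b) b u) else 0)"
  proof (intro sum.cong refl)
    fix a b assume "a \<in> idx n" "b \<in> idx n"
    from C_mat_apply[OF this] show "C_mat n a b *\<^sub>C mu i a b u = (if a = - b then sg (ipar b) (mu i (- b) b u) else 0)"
      by (cases "a = - b"; cases "b > 0") (simp_all add: ipar_def)
  qed
  also have "\<dots> = app (c i) u"
    unfolding cliff_def app_sum app_sg by (intro sum.cong refl) (simp add: app_m[OF assms(1) _ _ assms(2)])
  finally show ?thesis .
qed

lemma S_op_eq:
  assumes "i \<in> {1..d}" "j \<in> {1..d}" "u \<in> U"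
  shows "S_op n d M i j u = app (flip n (m i) (m j)) u"
  unfolding S_op_def flip_def app_sum app_sg app_simps
  by (intro sum.cong refl) (simp only: of_int_sgn_eq_sg app_m[OF assms(1)] app_m[OF assms(2)] mu_U[OF _ _ assms(2,3)] assms(3))

lemma at_factor_add: "at_factor n d M i (A + B) u = at_factor n d M i A u + at_factor n d M i B u"
  and at_factor_diff: "at_factor n d M i (A - B) u = at_factor n d M i A u - at_factor n d M i B u"
  and at_factor_scale: "at_factor n d M i (k *\<^sub>C A) u = k *\<^sub>C at_factor n d M i A u"
  by (auto simp: at_factor_def fun_eq_iff Let_def scaleC_fun_def scaleC_complex_def distrib_right left_diff_distrib
      cvec.scale_left_distrib cvec.scale_left_diff_distrib sum.distrib sum_subtractf cvec.scale_sum_right mult.assoc)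

text \<open>The sums over positive indices in \<open>\<Omega>\<close> arise from the sum over signed ones by collecting the four choices
  of signs.\<close>

lemma Omega_op_eq:
  assumes i: "i \<in> {1..d}" and u: "u \<in> U"
  shows "Omega_op n d M i u = app (flip n x (m i)) u"
proof -
  have "app (flip n x (m i)) u = (\<Sum>k\<in>{1..int n}. \<Sum>l\<in>{1..int n}.
      app (x k l) (app (m i l k) u - app (m i (- l) (- k)) u) - app (x (- k) l) (app (m i (- l) k) u - app (m i l (- k)) u))"
    unfolding flip_def sum_idx_split sum.distrib[symmetric] app_sum
  proof (intro sum.cong refl)
    fix k l assume "k \<in> {1..int n}" "l \<in> {1..int n}"
    then have p: "ipar l = 0" "ipar (- l) = 1" by (auto simp: ipar_def)
    show "app (sg (ipar l) (x k l * m i l k) + sg (ipar (- l)) (x k (- l) * m i (- l) k) +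
        (sg (ipar l) (x (- k) l * m i l (- k)) + sg (ipar (- l)) (x (- k) (- l) * m i (- l) (- k)))) u =
      app (x k l) (app (m i l k) u - app (m i (- l) (- k)) u) - app (x (- k) l) (app (m i (- l) k) u - app (m i l (- k)) u)"
      unfolding p app_sg app_simps app_diff q_rep_uminus[OF q_rep_x, of k l] q_rep_uminus'[OF q_rep_x, of k l]
      by simp
  qed
  also have "\<dots> = Omega_op n d M i u"
    unfolding Omega_op_def
  proof (intro sum.cong refl)
    fix k l assume kl: "k \<in> {1..int n}" "l \<in> {1..int n}"
    then have I: "k \<in> idx n" "l \<in> idx n" "- k \<in> idx n" "- l \<in> idx n" by (auto simp: idx_def)
    show "app (x k l) (app (m i l k) u - app (m i (- l) (- k)) u) - app (x (- k) l) (app (m i (- l) k) u - app (m i l (- k)) u)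
      = at0 M (e_mat k l) (at_factor n d M i (e_bar l k) u) - at0 M (f_mat k l) (at_factor n d M i (f_bar l k) u)"
      unfolding e_mat_eq f_mat_eq e_bar_def f_bar_def at_factor_diff
      using I i u by (simp add: app_m app_x mu_U cvec.subspace_diff[OF subspace_U] del: atLeastAtMost_iff)
  qed
  finally show ?thesis ..
qed

text \<open>Homogeneity of an operator; it also provides the invariance of the carrier.\<close>

definition shifts :: "bit \<Rightarrow> (int list \<Rightarrow> 'a) endo \<Rightarrow> bool" where
  "shifts q a \<longleftrightarrow> (\<forall>r. \<forall>u\<in>grade T r. app a u \<in> grade T (r + q))"

lemma subspace_grade_T: "cvec.subspace (grade T r)"
  unfolding cvec.subspace_def
  by (auto simp: grade_T_iff scaleC_fun_def cvec.subspace_0[OF subspace_grade[OF sM]]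
      cvec.subspace_add[OF subspace_grade[OF sM]] cvec.subspace_scale[OF subspace_grade[OF sM]])

lemma decomp_par:
  assumes "v \<in> mcarrier M"
  shows "\<exists>a. a \<in> grade M r \<and> v - a \<in> grade M (r + 1)"
proof -
  from assms obtain a b where v: "v = a + b" "a \<in> grade M 0" "b \<in> grade M 1" by (metis carrier_decomp[OF sM])
  then show ?thesis
    by (cases "r = 0") (auto intro: exI[of _ a] exI[of _ b])
qed

lemma superspace_T: "superspace T"
  unfolding superspace_def
proof (intro conjI allI)
  show "cvec.subspace (grade T r)" for r by (rule subspace_grade_T)
  show "grade T 0 \<inter> grade T 1 = {0}"
  proof (intro set_eqI iffI)
    fix u assume u: "u \<in> grade T 0 \<inter> grade T 1"
    have "u w = 0" for w
    proof (cases "w \<in> W")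
      case True
      then have "u w \<in> grade M (word_par w)" "u w \<in> grade M (word_par w + 1)"
        using u by (auto simp: grade_T_iff add.commute)
      then show ?thesis by (rule grade_disjoint[OF sM])
    next
      case False
      then show ?thesis using u by (simp add: grade_T_iff)
    qed
    then show "u \<in> {0}" by auto
  qed (auto simp: cvec.subspace_0[OF subspace_grade_T])
  show "U = {a + b |a b. a \<in> grade T 0 \<and> b \<in> grade T 1}"
  proof (intro set_eqI iffI)
    fix u assume u: "u \<in> U"
    then have "\<forall>w. \<exists>a. a \<in> grade M (word_par w) \<and> u w - a \<in> grade M (word_par w + 1)"
      using decomp_par[OF U_at] by blast
    then obtain a where a: "\<And>w. a w \<in> grade M (word_par w)" "\<And>w. u w - a w \<in> grade M (word_par w + 1)" by metis
    let ?a = "\<lambda>w. if w \<in> W then a w else 0"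
    have "?a \<in> grade T 0" using a by (auto simp: grade_T_iff)
    moreover have "u - ?a \<in> grade T 1" using a u by (auto simp: grade_T_iff U_iff add.commute)
    moreover have "u = ?a + (u - ?a)" by simp
    ultimately show "u \<in> {a + b |a b. a \<in> grade T 0 \<and> b \<in> grade T 1}" by blast
  next
    fix u assume "u \<in> {a + b |a b. a \<in> grade T 0 \<and> b \<in> grade T 1}"
    then obtain a b where "u = a + b" "a \<in> grade T 0" "b \<in> grade T 1" by blast
    moreover have "v \<in> U" if "v \<in> grade T r" for v r
      using that grade_carrier[OF sM] by (auto simp: U_iff grade_T_iff)
    ultimately show "u \<in> U"
      using cvec.subspace_add[OF subspace_U] by blast
  qed
qed

lemma shifts_x: "a \<in> idx n \<Longrightarrow> b \<in> idx n \<Longrightarrow> shifts (ipar a + ipar b) (x a b)"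
  unfolding shifts_def
proof (intro allI ballI)
  fix r u assume I: "a \<in> idx n" "b \<in> idx n" and u: "u \<in> grade T r"
  have uU: "u \<in> U" by (rule grade_carrier[OF superspace_T u])
  show "app (x a b) u \<in> grade T (r + (ipar a + ipar b))"
    unfolding grade_T_iff
  proof safe
    fix w assume "w \<in> W"
    then have "u w \<in> grade M (r + word_par w)" using u by (simp add: grade_T_iff)
    from act_grade[OF q_mat_part[OF I] this]
    show "app (x a b) u w \<in> grade M (r + (ipar a + ipar b) + word_par w)"
      by (simp add: x_at I uU ac_simps)
  next
    fix w assume "w \<notin> W"
    then show "app (x a b) u w = 0" using x_U[OF I uU] by (simp add: U_iff)
  qed
qed

lemma shifts_m: "i \<in> {1..d} \<Longrightarrow> a \<in> idx n \<Longrightarrow> b \<in> idx n \<Longrightarrow> shifts (ipar a + ipar b) (m i a b)"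
  unfolding shifts_def
proof (intro allI ballI)
  fix r u assume I: "i \<in> {1..d}" "a \<in> idx n" "b \<in> idx n" and u: "u \<in> grade T r"
  have uU: "u \<in> U" by (rule grade_carrier[OF superspace_T u])
  show "app (m i a b) u \<in> grade T (r + (ipar a + ipar b))"
    unfolding grade_T_iff
  proof safe
    fix w assume w: "w \<in> W"
    show "app (m i a b) u w \<in> grade M (r + (ipar a + ipar b) + word_par w)"
    proof (cases "w ! (i - 1) = a")
      case True
      have "u (w[i - 1 := b]) \<in> grade M (r + word_par (w[i - 1 := b]))"
        using u words_update[OF w I(3)] by (simp add: grade_T_iff)
      also have "word_par (w[i - 1 := b]) = word_par w + (ipar a + ipar b)"
        using True words_length[OF w] I by (subst word_par_update) auto
      finally have "u (w[i - 1 := b]) \<in> grade M (r + (ipar a + ipar b) + word_par w)"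
        by (simp add: ac_simps)
      then show ?thesis
        using w True by (simp add: app_m[OF I uU] mu_apply[OF I(2,3,1)] subspace_sg subspace_grade sM twist_in_grade)
    next
      case False
      then show ?thesis
        by (simp add: app_m[OF I uU] mu_apply[OF I(2,3,1)] cvec.subspace_0[OF subspace_grade[OF sM]])
    qed
  next
    fix w assume "w \<notin> W"
    then show "app (m i a b) u w = 0" using m_U[OF I uU] by (simp add: U_iff)
  qed
qed

lemma shifts_sg: "shifts q a \<Longrightarrow> shifts q (sg r a)"
  by (simp add: shifts_def subspace_sg subspace_grade_T)

lemma shifts_add: "shifts q a \<Longrightarrow> shifts q b \<Longrightarrow> shifts q (a + b)"
  by (simp add: shifts_def cvec.subspace_add[OF subspace_grade_T])

lemma shifts_sum: "(\<And>i. i \<in> J \<Longrightarrow> shifts q (g i)) \<Longrightarrow> shifts q (\<Sum>i\<in>J. g i)"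
  by (simp add: shifts_def cvec.subspace_sum[OF subspace_grade_T])

lemma shifts_mult: "shifts q a \<Longrightarrow> shifts r b \<Longrightarrow> shifts (q + r) (a * b)"
  unfolding shifts_def app_simps
proof (intro allI ballI)
  fix k u assume a: "\<forall>k. \<forall>u\<in>grade T k. app a u \<in> grade T (k + q)"
    and b: "\<forall>k. \<forall>u\<in>grade T k. app b u \<in> grade T (k + r)" and u: "u \<in> grade T k"
  from a[rule_format, OF b[rule_format, OF u]]
  show "app a (app b u) \<in> grade T (k + (q + r))" by (simp add: ac_simps)
qed

lemma shifts_dbl:
  assumes "i \<in> {1..d}" "a \<in> idx n" "b \<in> idx n"
  shows "shifts (ipar a + ipar b) (dbl (m i) a b)"
  unfolding dbl_def
  using shifts_m[OF assms] shifts_m[of i "- a" "- b"] assms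
  by (intro shifts_add) (simp_all add: ipar_add_uminus)

lemma shifts_y:
  assumes "i \<le> d + 1" "a \<in> idx n" "b \<in> idx n"
  shows "shifts (ipar a + ipar b) (y i a b)"
  unfolding y_def using assms by (intro shifts_add shifts_x shifts_sum shifts_dbl) auto

lemma shifts_flip:
  assumes "\<And>a b. a \<in> idx n \<Longrightarrow> b \<in> idx n \<Longrightarrow> shifts (ipar a + ipar b) (z a b)"
    and "\<And>a b. a \<in> idx n \<Longrightarrow> b \<in> idx n \<Longrightarrow> shifts (ipar a + ipar b) (z' a b)"
  shows "shifts 0 (flip n z z')"
  unfolding flip_def
proof (intro shifts_sum shifts_sg)
  fix k l assume I: "k \<in> idx n" "l \<in> idx n"
  from shifts_mult[OF assms(1)[OF I] assms(2)[OF I(2,1)]]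
  show "shifts 0 (z k l * z' l k)" by (simp add: ac_simps)
qed

lemma shifts_cliff:
  assumes "i \<in> {1..d}"
  shows "shifts 1 (c i)"
  unfolding cliff_def
proof (intro shifts_sum shifts_sg)
  fix a assume a: "a \<in> idx n"
  have "ipar (- a) + ipar a = 1" using a by (cases "ipar a") (simp_all add: ipar_uminus)
  then show "shifts 1 (m i (- a) a)" using shifts_m[OF assms, of "- a" a] a by simp
qed

lemma shifts_U:
  assumes "shifts q a" "u \<in> U"
  shows "app a u \<in> U"
proof -
  from assms(2) obtain v w where u: "u = v + w" "v \<in> grade T 0" "w \<in> grade T 1"
    by (metis carrier_decomp[OF superspace_T])
  then have "app a v \<in> U" "app a w \<in> U"
    using assms(1) grade_carrier[OF superspace_T] unfolding shifts_def by blast+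
  then show ?thesis by (simp add: u app_add cvec.subspace_add[OF subspace_U])
qed

lemma shifts_s: "i \<in> {1..<d} \<Longrightarrow> shifts 0 (s i)"
  by (rule shifts_flip) (auto intro: shifts_m)

lemma shifts_X: "i \<in> {1..d} \<Longrightarrow> shifts 0 (X i)"
  by (rule shifts_flip) (auto intro: shifts_m shifts_y)

lemma X_op_eq:
  assumes i: "i \<in> {1..d}" and u: "u \<in> U"
  shows "X_op n d M i u = app (X i) u"
proof -
  have "flip n (dbl (m j)) (m i) = flip n (m j) (m i) - c j * (c i * flip n (m j) (m i))" if "j \<in> {1..<i}" for j
    using that i by (intro flip_dbl m_units m_m) auto
  then have "X i = flip n x (m i) + (\<Sum>j\<in>{1..<i}. flip n (m j) (m i) - c j * (c i * flip n (m j) (m i)))"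
    unfolding y_def by (simp add: flip_add flip_sum cong: sum.cong_simp)
  then have "app (X i) u = Omega_op n d M i u
      + (\<Sum>j\<in>{1..<i}. app (flip n (m j) (m i)) u - app (c j) (app (c i) (app (flip n (m j) (m i)) u)))"
    using i u by (simp add: Omega_op_eq)
  also have "\<dots> = X_op n d M i u"
    unfolding X_op_def
  proof (intro arg_cong2[where f = "(+)"] sum.cong refl)
    fix j assume "j \<in> {1..<i}"
    then have j: "j \<in> {1..d}" using i by auto
    have 1: "app (flip n (m j) (m i)) u \<in> U"
      using i j u by (intro shifts_U[of 0] shifts_flip shifts_m)
    then have 2: "app (c i) (app (flip n (m j) (m i)) u) \<in> U"
      by (rule shifts_U[OF shifts_cliff[OF i]])
    show "app (flip n (m j) (m i)) u - app (c j) (app (c i) (app (flip n (m j) (m i)) u))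
      = S_op n d M j i u - C_op n d M j (C_op n d M i (S_op n d M j i u))"
      using 1 2 i j u by (simp only: S_op_eq C_op_eq)
  qed
  finally show ?thesis ..
qed

fun gen_op :: "hecke_gen \<Rightarrow> (int list \<Rightarrow> 'a) endo" where
  "gen_op (s_gen i) = s i"
| "gen_op (x_gen i) = X i"
| "gen_op (c_gen i) = c i"

lemma hecke_act_eq:
  assumes "g \<in> hecke_gens d" "u \<in> U"
  shows "hecke_act n d M g u = app (gen_op g) u"
  using assms by (cases g) (auto simp: hecke_gens_def S_op_eq X_op_eq C_op_eq)

lemma shifts_gen: "g \<in> hecke_gens d \<Longrightarrow> shifts (gen_par g) (gen_op g)"
  using shifts_s shifts_X shifts_cliff by (cases g) (auto simp: hecke_gens_def)

text \<open>The generators supercommute with \<open>q(n)\<close>, so they preserve its singular vectors and weight spaces.\<close>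

lemma gen_y:
  assumes "g \<in> hecke_gens d" "a \<in> idx n" "b \<in> idx n"
  shows "gen_op g * y (d + 1) a b = sg (gen_par g * (ipar a + ipar b)) (y (d + 1) a b * gen_op g)"
proof (cases g)
  case (s_gen i)
  then have "i \<in> {1..<d}" using assms(1) by (auto simp: hecke_gens_def)
  then show ?thesis using s_y[of i "d + 1" a b] assms(2,3) by (simp add: s_gen)
next
  case (x_gen i)
  then have "i \<in> {1..d}" using assms(1) by (auto simp: hecke_gens_def)
  then show ?thesis using X_y[of i "d + 1" a b] assms(2,3) by (simp add: x_gen)
next
  case (c_gen i)
  then have "i \<in> {1..d}" using assms(1) by (auto simp: hecke_gens_def)
  then show ?thesis using c_y_all[of i "d + 1" a b] assms(2,3) by (simp add: c_gen)
qed

end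

section \<open>Singular vectors as a Hecke-Clifford supermodule\<close>

lemma weight_linear:
  "weight n lam (h + h') = weight n lam h + weight n lam h'"
  "weight n lam (k *\<^sub>C h) = k * weight n lam h"
  "weight n lam 0 = 0"
  by (simp_all add: weight_def scaleC_fun_def scaleC_complex_def algebra_simps sum.distrib sum_distrib_left)

lemma weight_q_mat: "i \<in> {1..int n} \<Longrightarrow> weight n lam (q_mat i i) = of_int (lam i)"
proof -
  assume i: "i \<in> {1..int n}"
  have "weight n lam (q_mat i i) = (\<Sum>k\<in>{1..int n}. if k = i then of_int (lam i) else 0)"
    unfolding weight_def
  proof (intro sum.cong refl)
    fix k assume "k \<in> {1..int n}"
    then have "q_mat i i k k = (if k = i then 1 else 0)"
      using i by (cases "k = i") (simp_all add: q_mat_def E_mat_def)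
    then show "of_int (lam k) * q_mat i i k k = (if k = i then of_int (lam i) else 0)"
      by simp
  qed
  with i show ?thesis by simp
qed

lemma cartan0_subset: "cartan0 n \<subseteq> q_alg n" and nplus_subset: "nplus n \<subseteq> q_alg n"
proof -
  show "cartan0 n \<subseteq> q_alg n" unfolding cartan0_def q_alg_def by (rule cvec.span_mono) blast
  have R: "i \<in> {1..int n}" "j \<in> {1..int n}" if "1 \<le> i" "i < j" "j \<le> int n" for i j using that by auto
  show "nplus n \<subseteq> q_alg n" unfolding nplus_def q_alg_def
    by (rule cvec.span_mono, rule Un_mono) (use R in blast)+
qed

text \<open>The conditions on all elements of the Cartan subalgebra, or of the nilpotent one in the next
  lemma, reduce to the spanning elements by linearity.\<close>

lemma weight_condition_iff:
  assumes lin: "linear_on (q_alg n) (\<lambda>z. act Z z v)"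
  shows "(\<forall>h\<in>cartan0 n. act Z h v = weight n lam h *\<^sub>C v)
    \<longleftrightarrow> (\<forall>i\<in>{1..int n}. act Z (q_mat i i) v = of_int (lam i) *\<^sub>C v)" (is "?l \<longleftrightarrow> ?r")
proof
  assume ?l
  show ?r
  proof
    fix i assume i: "i \<in> {1..int n}"
    then have "q_mat i i \<in> cartan0 n"
      unfolding cartan0_def e_mat_eq by (intro cvec.span_base) auto
    with \<open>?l\<close> i show "act Z (q_mat i i) v = of_int (lam i) *\<^sub>C v" by (simp add: weight_q_mat)
  qed
next
  assume r: ?r
  let ?G = "{e_mat i i | i. i \<in> {1..int n}}"
  let ?h = "\<lambda>z. act Z z v - weight n lam z *\<^sub>C v"
  have sub: "cvec.subspace (q_alg n)" unfolding q_alg_def by (rule cvec.subspace_span)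
  have h: "linear_on (q_alg n) ?h"
    using linear_onD[OF lin] by (simp add: linear_on_def weight_linear cvec.scale_left_distrib cvec.scale_right_diff_distrib)
  have G: "?G \<subseteq> q_alg n"
    using cartan0_subset[of n] cvec.span_superset[of ?G] unfolding cartan0_def by blast
  have "?h z \<in> {0}" if "z \<in> ?G" for z
    using that r weight_q_mat[of _ n lam] by (auto simp: e_mat_eq simp del: atLeastAtMost_iff)
  from linear_on_span[OF h sub G cvec.subspace_single_0 this]
  show ?l unfolding cartan0_def by simp
qed

lemma nplus_condition_iff:
  assumes lin: "linear_on (q_alg n) (\<lambda>z. act Z z v)"
  shows "(\<forall>z\<in>nplus n. act Z z v = 0)
    \<longleftrightarrow> (\<forall>i\<in>{1..int n}. \<forall>j\<in>{1..int n}. i < j \<longrightarrow> act Z (q_mat i j) v = 0 \<and> act Z (q_mat (- i) j) v = 0)" (is "?l \<longleftrightarrow> ?r")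
proof
  assume l: ?l
  show ?r
  proof (intro ballI impI)
    fix i j assume "i \<in> {1..int n}" "j \<in> {1..int n}" "i < j"
    then have "q_mat i j \<in> nplus n" "q_mat (- i) j \<in> nplus n"
      unfolding nplus_def e_mat_eq f_mat_eq by (auto intro!: cvec.span_base)
    with l show "act Z (q_mat i j) v = 0 \<and> act Z (q_mat (- i) j) v = 0" by blast
  qed
next
  assume r: ?r
  let ?G = "{e_mat i j | i j. 1 \<le> i \<and> i < j \<and> j \<le> int n} \<union> {f_mat i j | i j. 1 \<le> i \<and> i < j \<and> j \<le> int n}"
  have sub: "cvec.subspace (q_alg n)" unfolding q_alg_def by (rule cvec.subspace_span)
  have G: "?G \<subseteq> q_alg n"
    using nplus_subset[of n] cvec.span_superset[of ?G] unfolding nplus_def by blast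
  have "act Z z v \<in> {0}" if "z \<in> ?G" for z
    using that r by (auto simp: e_mat_eq f_mat_eq)
  from linear_on_span[OF lin sub G cvec.subspace_single_0 this]
  show ?l unfolding nplus_def by simp
qed

lemma scaleC_apply: "(k *\<^sub>C f) w = k *\<^sub>C f w" for f :: "'b \<Rightarrow> 'a::complex_vector"
  by (simp add: scaleC_fun_def)

context tensor
begin

definition Y :: "int \<Rightarrow> int \<Rightarrow> (int list \<Rightarrow> 'a) endo" where
  "Y = y (d + 1)"

sublocale Q: queer_module n Y
  by unfold_locales (simp add: Y_def q_rep_y)

lemma shifts_Y: "a \<in> idx n \<Longrightarrow> b \<in> idx n \<Longrightarrow> shifts (ipar a + ipar b) (Y a b)"
  unfolding Y_def by (rule shifts_y) simp

lemma act_T: "act T z u = at0 M z u + (\<Sum>i\<in>{1..d}. at_factor n d M i z u)"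
  by (simp add: tensor_module_def)

lemma act_T_q_mat:
  assumes "a \<in> idx n" "b \<in> idx n" "u \<in> U"
  shows "act T (q_mat a b) u = app (Y a b) u"
proof -
  have "(\<Sum>i\<in>{1..d}. at_factor n d M i (q_mat a b) u) = (\<Sum>i\<in>{1..<d + 1}. app (dbl (m i) a b) u)"
    unfolding q_mat_def dbl_def at_factor_add app_simps using assms
    by (intro sum.cong) (auto simp: app_m)
  then show ?thesis
    using assms by (simp add: act_T Y_def y_def app_x)
qed

lemma linear_act_T:
  assumes u: "u \<in> U"
  shows "linear_on (q_alg n) (\<lambda>z. act T z u)"
proof -
  have "at0 M (z + z') u = at0 M z u + at0 M z' u" if "z \<in> q_alg n" "z' \<in> q_alg n" for z z'
    using linear_onD(1)[OF linear_act_left[OF U_at[OF u]] that] by (auto simp: at0_def)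
  moreover have "at0 M (k *\<^sub>C z) u = k *\<^sub>C at0 M z u" if "z \<in> q_alg n" for z k
    using linear_onD(2)[OF linear_act_left[OF U_at[OF u]] that, where c = k] by (auto simp: at0_def scaleC_apply)
  ultimately show ?thesis
    by (simp add: linear_on_def act_T at_factor_add at_factor_scale sum.distrib cvec.scale_right_distrib cvec.scale_sum_right)
qed

lemma F_space_iff: "u \<in> F_space n d lam M \<longleftrightarrow> u \<in> U \<and> Q.weight_vec lam u \<and> Q.singular u"
proof (cases "u \<in> U")
  case True
  have I: "i \<in> idx n" "- i \<in> idx n" if "i \<in> {1..int n}" for i using that by (auto simp: idx_def)
  show ?thesis
    unfolding F_space_def weight_space_def mem_Collect_eq weight_condition_iff[OF linear_act_T[OF True]]
      nplus_condition_iff[OF linear_act_T[OF True]] Q.weight_vec_def Q.singular_def Q.f_def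
    using I True by (simp add: act_T_q_mat del: atLeastAtMost_iff)
next
  case False
  then show ?thesis by (simp add: F_space_def weight_space_def)
qed

lemma subspace_F: "cvec.subspace (F_space n d lam M)"
  unfolding cvec.subspace_def
  by (auto simp: F_space_iff Q.weight_vec_def Q.singular_def app_add app_scale cvec.scale_right_distrib
      cvec.subspace_0[OF subspace_U] cvec.subspace_add[OF subspace_U] cvec.subspace_scale[OF subspace_U] cvec.scale_left_commute)

text \<open>The images of the two components lie in different degrees, so they cannot cancel.\<close>

lemma shifts_zero_components:
  assumes "shifts q a" "u \<in> grade T 0" "v \<in> grade T 1" "app a (u + v) = 0"
  shows "app a u = 0" "app a v = 0"
proof -
  have u: "app a u \<in> grade T q" and v: "app a v \<in> grade T (q + 1)"
    using assms(1-3) unfolding shifts_def by (force simp: add.commute)+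
  have "app a u + app a v = 0" using assms(4) by (simp add: app_add)
  then have "app a u = - app a v" by (simp add: eq_neg_iff_add_eq_0)
  then have "app a u \<in> grade T (q + 1)" using v by (simp add: cvec.subspace_neg[OF subspace_grade_T])
  from grade_disjoint[OF superspace_T u this] show "app a u = 0" .
  with assms(4) show "app a v = 0" by (simp add: app_add)
qed

lemma F_space_components:
  assumes F: "u + v \<in> F_space n d lam M" and u: "u \<in> grade T 0" and v: "v \<in> grade T 1"
  shows "u \<in> F_space n d lam M" "v \<in> F_space n d lam M"
proof -
  have U: "u \<in> U" "v \<in> U" using u v by (auto intro: grade_carrier[OF superspace_T])
  have I: "i \<in> idx n" "- i \<in> idx n" if "i \<in> Q.I" for i using that by (auto simp: idx_def)
  have w: "app (Q.e i i) u = of_int (lam i) *\<^sub>C u" "app (Q.e i i) v = of_int (lam i) *\<^sub>C v" if i: "i \<in> Q.I" for i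
  proof -
    let ?k = "of_int (lam i) :: complex"
    \<comment> \<open>The weight condition says that the even operator \<open>Y i i - lam i\<close> annihilates the vector.\<close>
    define a where "a = Endo (\<lambda>w :: int list \<Rightarrow> 'a. - (?k *\<^sub>C w))"
    have a: "app a w = - (?k *\<^sub>C w)" for w
      unfolding a_def by (subst Endo_inverse) (auto simp: linear_on_def cvec.scale_right_distrib mult.commute)
    have "shifts 0 a"
      by (simp add: shifts_def a cvec.subspace_neg[OF subspace_grade_T] cvec.subspace_scale[OF subspace_grade_T])
    then have sh: "shifts 0 (Y i i + a)"
      using shifts_Y[of i i] I[OF i] by (intro shifts_add) simp_all
    have "app (Y i i + a) (u + v) = 0"
      using F i by (simp add: F_space_iff Q.weight_vec_def a)
    from shifts_zero_components[OF sh u v this]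
    show "app (Q.e i i) u = ?k *\<^sub>C u" "app (Q.e i i) v = ?k *\<^sub>C v" by (simp_all add: a)
  qed
  have s: "app (Y a b) u = 0" "app (Y a b) v = 0"
    if "a \<in> idx n" "b \<in> idx n" "app (Y a b) (u + v) = 0" for a b
    using shifts_zero_components[OF shifts_Y[of a b] u v that(3)] that(1,2) by simp_all
  have sing: "app (Y i j) (u + v) = 0" "app (Y (- i) j) (u + v) = 0"
    if "i \<in> Q.I" "j \<in> Q.I" "i < j" for i j
    using F that by (simp_all add: F_space_iff Q.singular_def Q.f_def)
  have "app (Y i j) u = 0 \<and> app (Y (- i) j) u = 0" "app (Y i j) v = 0 \<and> app (Y (- i) j) v = 0"
    if ij: "i \<in> Q.I" "j \<in> Q.I" "i < j" for i j
    using s[OF I(1)[OF ij(1)] I(1)[OF ij(2)] sing(1)[OF ij]] s[OF I(2)[OF ij(1)] I(1)[OF ij(2)] sing(2)[OF ij]]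
    by blast+
  then show "u \<in> F_space n d lam M" "v \<in> F_space n d lam M"
    using U w by (simp_all add: F_space_iff Q.weight_vec_def Q.singular_def Q.f_def)
qed

lemma superspace_F: "superspace (F_obj n d lam M)"
  unfolding superspace_def
proof (intro conjI allI)
  let ?F = "F_space n d lam M"
  let ?O = "F_obj n d lam M"
  show "cvec.subspace (grade ?O r)" for r
    by (simp add: F_obj_def cvec.subspace_inter subspace_F subspace_grade_T)
  show "grade ?O 0 \<inter> grade ?O 1 = {0}"
    using grade_disjoint[OF superspace_T, of _ 0] cvec.subspace_0[OF subspace_F] cvec.subspace_0[OF subspace_grade_T]
    by (auto simp: F_obj_def)
  show "mcarrier ?O = {a + b |a b. a \<in> grade ?O 0 \<and> b \<in> grade ?O 1}"
  proof (intro set_eqI iffI)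
    fix u assume "u \<in> mcarrier ?O"
    then have u: "u \<in> ?F" by (simp add: F_obj_def)
    then have "u \<in> U" by (simp add: F_space_iff)
    then obtain a b where ab: "u = a + b" "a \<in> grade T 0" "b \<in> grade T 1"
      by (metis carrier_decomp[OF superspace_T])
    with F_space_components[of a b] u show "u \<in> {a + b |a b. a \<in> grade ?O 0 \<and> b \<in> grade ?O 1}"
      by (auto simp: F_obj_def)
  next
    fix u assume "u \<in> {a + b |a b. a \<in> grade ?O 0 \<and> b \<in> grade ?O 1}"
    then show "u \<in> mcarrier ?O"
      using cvec.subspace_add[OF subspace_F] by (auto simp: F_obj_def)
  qed
qed

lemma gen_op_F_space:
  assumes g: "g \<in> hecke_gens d" and u: "u \<in> F_space n d lam M"
  shows "app (gen_op g) u \<in> F_space n d lam M"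
proof -
  have U: "u \<in> U" using u by (simp add: F_space_iff)
  have I: "i \<in> idx n" "- i \<in> idx n" if "i \<in> Q.I" for i using that by (auto simp: idx_def)
  have comm: "app (Y a b) (app (gen_op g) u) = sg (gen_par g * (ipar a + ipar b)) (app (gen_op g) (app (Y a b) u))"
    if "a \<in> idx n" "b \<in> idx n" for a b
    using arg_cong[OF gen_y[OF g that, folded Y_def], of "\<lambda>a. app a u"] by simp
  have "app (gen_op g) u \<in> U" by (rule shifts_U[OF shifts_gen[OF g] U])
  moreover have "Q.weight_vec lam (app (gen_op g) u)"
    using u I by (simp add: F_space_iff Q.weight_vec_def comm app_scale del: atLeastAtMost_iff)
  moreover have "Q.singular (app (gen_op g) u)"
    using u I by (simp add: F_space_iff Q.singular_def Q.f_def comm del: atLeastAtMost_iff)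
  ultimately show ?thesis by (simp add: F_space_iff)
qed

lemma app_eqI: "a = b \<Longrightarrow> app a u = app b u"
  by simp

lemma hecke_relations_U:
  assumes u: "u \<in> U"
  shows "hecke_relations d (\<lambda>i. hecke_act n d M (s_gen i)) (\<lambda>i. hecke_act n d M (x_gen i))
     (\<lambda>i. hecke_act n d M (c_gen i)) u"
proof -
  have s: "hecke_act n d M (s_gen i) v = app (s i) v" "app (s i) v \<in> U" if "i \<in> {1..<d}" "v \<in> U" for i v
    using hecke_act_eq[of "s_gen i" v] shifts_U[OF shifts_s[of i]] that by (simp_all add: hecke_gens_def del: hecke_act.simps)
  have X: "hecke_act n d M (x_gen i) v = app (X i) v" "app (X i) v \<in> U" if "i \<in> {1..d}" "v \<in> U" for i v
    using hecke_act_eq[of "x_gen i" v] shifts_U[OF shifts_X[of i]] that by (simp_all add: hecke_gens_def del: hecke_act.simps)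
  have c: "hecke_act n d M (c_gen i) v = app (c i) v" "app (c i) v \<in> U" if "i \<in> {1..d}" "v \<in> U" for i v
    using hecke_act_eq[of "c_gen i" v] shifts_U[OF shifts_cliff[of i]] that by (simp_all add: hecke_gens_def del: hecke_act.simps)
  have d: "i \<in> {1..d}" "i + 1 \<in> {1..d}" if "i \<in> {1..<d}" for i using that by auto
  note E = app_eqI[where u = u]
  show ?thesis
    unfolding hecke_relations_def
  proof (intro conjI ballI impI, goal_cases)
    case (1 i j) then show ?case using E[OF X_X[of i j]] u by (simp only: app_simps simp_thms d X)
  next
    case (2 i) then show ?case using E[OF s_s[of i]] u by (simp only: app_simps simp_thms d s app_p)
  next
    case (3 i j) then show ?case using E[OF braid[of i]] u by (simp only: app_simps simp_thms d s)
  next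
    case (4 i j) then show ?case using E[OF s_s_far[of i j]] u by (simp only: app_simps simp_thms d s)
  next
    case (5 i) then show ?case using E[OF c_c[of i]] u by (simp only: app_simps simp_thms d c app_p)
  next
    case (6 i j) then show ?case using E[OF c_anti[of i j]] u by (simp only: app_simps simp_thms d c)
  next
    case (7 i) then show ?case using E[OF s_c(1)[of i]] u by (simp only: app_simps simp_thms d c s d)
  next
    case (8 i) then show ?case using E[OF s_c(2)[of i]] u by (simp only: app_simps simp_thms d c s d)
  next
    case (9 i j) then show ?case using E[OF s_c_far[of i j]] u by (simp only: app_simps simp_thms d c s d)
  next
    case (10 i) then show ?case using E[OF c_X[of i]] u by (simp only: app_simps simp_thms d c X)
  next
    case (11 i j) then show ?case using E[OF c_X_other[of i j]] u by (simp only: app_simps simp_thms d c X)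
  next
    case (12 i) then show ?case using E[OF s_X[of i]] u by (simp only: app_simps simp_thms d c X s d app_p)
  next
    case (13 i j) then show ?case using E[OF s_X_far[of i j]] u by (simp only: app_simps simp_thms d X s)
  qed
qed

lemma hecke_supermodule_F: "hecke_supermodule d (F_obj n d lam M)"
  unfolding hecke_supermodule_def
proof (intro conjI ballI)
  let ?O = "F_obj n d lam M"
  show "superspace ?O" by (rule superspace_F)
  fix g assume g: "g \<in> hecke_gens d"
  have act: "act ?O g u = app (gen_op g) u" if "u \<in> F_space n d lam M" for u
    using that hecke_act_eq[OF g] by (simp add: F_obj_def F_space_iff)
  show "graded_map (gen_par g) ?O ?O (act ?O g)"
    unfolding graded_map_def
  proof (intro conjI allI)
    show "linear_on (mcarrier ?O) (act ?O g)"
      using act cvec.subspace_add[OF subspace_F] cvec.subspace_scale[OF subspace_F]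
      by (auto simp: linear_on_def app_add app_scale F_obj_def)
    show "act ?O g ` grade ?O r \<subseteq> grade ?O (r + gen_par g)" for r
    proof
      fix v assume "v \<in> act ?O g ` grade ?O r"
      then obtain u where u: "u \<in> F_space n d lam M" "u \<in> grade T r" "v = app (gen_op g) u"
        using act by (auto simp: F_obj_def)
      then show "v \<in> grade ?O (r + gen_par g)"
        using gen_op_F_space[OF g] shifts_gen[OF g] by (auto simp: F_obj_def shifts_def)
    qed
  qed
next
  let ?O = "F_obj n d lam M"
  fix u assume "u \<in> mcarrier ?O"
  then have "u \<in> U" by (simp add: F_obj_def F_space_iff)
  from hecke_relations_U[OF this]
  show "hecke_relations d (\<lambda>i. act ?O (s_gen i)) (\<lambda>i. act ?O (x_gen i))
     (\<lambda>i. act ?O (c_gen i)) u"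
    by (simp add: F_obj_def)
qed

end

section \<open>Homomorphisms\<close>

lemma F_map_apply: "F_map \<phi> u w = \<phi> (u w)"
  by (simp add: F_map_def)

text \<open>The map \<open>\<phi> \<otimes> id\<close> for a homomorphism \<open>\<phi>\<close> of parity \<open>q\<close>.\<close>

locale tensor_hom = A: tensor n d M + B: tensor n d N
  for n d :: nat and M :: "(smatrix, 'a::complex_vector) supermod" and N :: "(smatrix, 'b::complex_vector) supermod" +
  fixes \<phi> :: "'a \<Rightarrow> 'b" and q :: bit
  assumes hom: "q_hom n q M N \<phi>"
begin

abbreviation \<Phi> :: "(int list \<Rightarrow> 'a) \<Rightarrow> int list \<Rightarrow> 'b" where "\<Phi> \<equiv> F_map \<phi>"

lemma graded_phi: "graded_map q M N \<phi>"
  using hom by (simp add: q_hom_def)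

lemma linear_phi: "linear_on (mcarrier M) \<phi>"
  using graded_phi by (simp add: graded_map_def)

lemma phi_grade: "v \<in> grade M r \<Longrightarrow> \<phi> v \<in> grade N (r + q)"
  using graded_phi unfolding graded_map_def by blast

lemma phi_zero: "\<phi> 0 = 0"
  by (rule linear_on_zero[OF linear_phi A.subspace_M])

lemma phi_carrier: "v \<in> mcarrier M \<Longrightarrow> \<phi> v \<in> mcarrier N"
proof -
  assume "v \<in> mcarrier M"
  then obtain a b where v: "v = a + b" "a \<in> grade M 0" "b \<in> grade M 1" by (metis carrier_decomp[OF A.sM])
  then have "\<phi> v = \<phi> a + \<phi> b"
    using linear_onD(1)[OF linear_phi, of a b] by (simp add: grade_carrier[OF A.sM])
  then show ?thesis using phi_grade v grade_carrier[OF B.sM] cvec.subspace_add[OF B.subspace_M] by metis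
qed

lemma phi_act: "a \<in> idx n \<Longrightarrow> b \<in> idx n \<Longrightarrow> v \<in> mcarrier M \<Longrightarrow>
    \<phi> (act M (q_mat a b) v) = sg (q * (ipar a + ipar b)) (act N (q_mat a b) (\<phi> v))"
  using hom q_mat_part[of a n b] unfolding q_hom_def koszul_eq_sg by blast

lemma Phi_U: "u \<in> A.U \<Longrightarrow> \<Phi> u \<in> B.U"
  by (auto simp: A.U_iff B.U_iff F_map_def phi_carrier phi_zero)

lemma linear_Phi: "linear_on A.U \<Phi>"
  using linear_onD[OF linear_phi] A.U_at by (auto simp: linear_on_def F_map_def fun_eq_iff scaleC_apply)

lemma Phi_grade: "u \<in> grade A.T r \<Longrightarrow> \<Phi> u \<in> grade B.T (r + q)"
  using phi_grade by (fastforce simp: A.grade_T_iff B.grade_T_iff F_map_def phi_zero ac_simps)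

text \<open>\<open>a\<close> and \<open>a'\<close> are the same operator of parity \<open>r\<close> on the two tensor products.  The property passes through
  sums and products, and so from the building blocks to all generators.\<close>

definition equiv :: "bit \<Rightarrow> (int list \<Rightarrow> 'a) endo \<Rightarrow> (int list \<Rightarrow> 'b) endo \<Rightarrow> bool" where
  "equiv r a a' \<longleftrightarrow> (\<forall>u\<in>A.U. app a u \<in> A.U \<and> \<Phi> (app a u) = sg (q * r) (app a' (\<Phi> u)))"

lemma equiv_x:
  assumes "a \<in> idx n" "b \<in> idx n"
  shows "equiv (ipar a + ipar b) (A.x a b) (B.x a b)"
  unfolding equiv_def
proof (intro ballI conjI)
  fix u assume u: "u \<in> A.U"
  show "app (A.x a b) u \<in> A.U" by (rule A.x_U[OF assms u])
  show "\<Phi> (app (A.x a b) u) = sg (q * (ipar a + ipar b)) (app (B.x a b) (\<Phi> u))"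
  proof
    fix w
    show "\<Phi> (app (A.x a b) u) w = sg (q * (ipar a + ipar b)) (app (B.x a b) (\<Phi> u)) w"
      using phi_act[OF assms A.U_at[OF u]]
      by (simp add: sg_fun A.x_at[OF assms u] B.x_at[OF assms Phi_U[OF u]] F_map_apply)
  qed
qed

lemma equiv_m:
  assumes "i \<in> {1..d}" "a \<in> idx n" "b \<in> idx n"
  shows "equiv (ipar a + ipar b) (A.m i a b) (B.m i a b)"
  unfolding equiv_def
proof (intro ballI conjI)
  fix u assume u: "u \<in> A.U"
  show "app (A.m i a b) u \<in> A.U" by (rule A.m_U[OF assms u])
  show "\<Phi> (app (A.m i a b) u) = sg (q * (ipar a + ipar b)) (app (B.m i a b) (\<Phi> u))"
  proof
    fix w
    have "\<phi> (twist M r (u w')) = sg (r * q) (twist N r (\<phi> (u w')))" for r w'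
      by (rule twist_graded_map[OF A.sM graded_phi B.sM A.U_at[OF u]])
    then show "\<Phi> (app (A.m i a b) u) w = sg (q * (ipar a + ipar b)) (app (B.m i a b) (\<Phi> u)) w"
      using linear_on_sg[OF linear_phi twist_carrier[OF A.sM A.U_at[OF u]]]
      by (simp add: sg_fun A.app_m[OF assms u] B.app_m[OF assms Phi_U[OF u]] F_map_apply
          A.mu_apply[OF assms(2,3,1)] B.mu_apply[OF assms(2,3,1)] phi_zero add.commute mult.commute[of q])
  qed
qed

lemma equiv_sg:
  assumes "equiv r a a'"
  shows "equiv r (sg s a) (sg s a')"
  using assms unfolding equiv_def app_sg
  by (simp add: subspace_sg[OF A.subspace_U] linear_on_sg[OF linear_Phi] add.commute)

lemma equiv_add:
  assumes "equiv r a a'" "equiv r b b'"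
  shows "equiv r (a + b) (a' + b')"
  using assms unfolding equiv_def app_simps
  by (simp add: cvec.subspace_add[OF A.subspace_U] linear_onD(1)[OF linear_Phi] sg_add)

lemma equiv_zero: "equiv r 0 0"
  by (simp add: equiv_def cvec.subspace_0[OF A.subspace_U] linear_on_zero[OF linear_Phi A.subspace_U])

lemma equiv_sum:
  "(\<And>i. i \<in> J \<Longrightarrow> equiv r (g i) (g' i)) \<Longrightarrow> equiv r (\<Sum>i\<in>J. g i) (\<Sum>i\<in>J. g' i)"
  by (induction J rule: infinite_finite_induct) (simp_all add: equiv_zero equiv_add)

lemma equiv_mult:
  assumes "equiv r a a'" "equiv s b b'"
  shows "equiv (r + s) (a * b) (a' * b')"
  unfolding equiv_def app_simps
proof (intro ballI conjI)
  fix u assume u: "u \<in> A.U"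
  have b: "app b u \<in> A.U" "\<Phi> (app b u) = sg (q * s) (app b' (\<Phi> u))" using assms(2) u by (simp_all add: equiv_def)
  have a: "app a (app b u) \<in> A.U" "\<Phi> (app a (app b u)) = sg (q * r) (app a' (\<Phi> (app b u)))"
    using assms(1) b(1) by (simp_all add: equiv_def)
  show "app a (app b u) \<in> A.U" by fact
  have "app a' (sg t v) = sg t (app a' v)" for t v by (cases t) (simp_all add: app_minus)
  then show "\<Phi> (app a (app b u)) = sg (q * (r + s)) (app a' (app b' (\<Phi> u)))"
    by (simp add: a b distrib_left)
qed

lemma equiv_flip:
  assumes "\<And>a b. a \<in> idx n \<Longrightarrow> b \<in> idx n \<Longrightarrow> equiv (ipar a + ipar b) (z a b) (z' a b)"
    and "\<And>a b. a \<in> idx n \<Longrightarrow> b \<in> idx n \<Longrightarrow> equiv (ipar a + ipar b) (t a b) (t' a b)"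
  shows "equiv 0 (flip n z t) (flip n z' t')"
  unfolding flip_def
proof (intro equiv_sum equiv_sg)
  fix k l assume I: "k \<in> idx n" "l \<in> idx n"
  from equiv_mult[OF assms(1)[OF I] assms(2)[OF I(2,1)]]
  show "equiv 0 (z k l * t l k) (z' k l * t' l k)" by (simp add: ac_simps)
qed

lemma equiv_cliff:
  assumes "i \<in> {1..d}"
  shows "equiv 1 (A.c i) (B.c i)"
  unfolding cliff_def
proof (intro equiv_sum equiv_sg)
  fix a assume a: "a \<in> idx n"
  have "ipar (- a) + ipar a = 1" using a by (cases "ipar a") (simp_all add: ipar_uminus)
  then show "equiv 1 (A.m i (- a) a) (B.m i (- a) a)" using equiv_m[OF assms, of "- a" a] a by simp
qed

lemma equiv_y:
  assumes "i \<le> d + 1" "a \<in> idx n" "b \<in> idx n"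
  shows "equiv (ipar a + ipar b) (A.y i a b) (B.y i a b)"
  unfolding A.y_def B.y_def
proof (intro equiv_add equiv_x equiv_sum)
  fix j assume "j \<in> {1..<i}"
  then have j: "j \<in> {1..d}" using assms by auto
  show "equiv (ipar a + ipar b) (dbl (A.m j) a b) (dbl (B.m j) a b)"
    unfolding dbl_def using equiv_m[OF j, of a b] equiv_m[OF j, of "- a" "- b"] assms(2,3)
    by (intro equiv_add) (simp_all add: ipar_add_uminus)
qed (use assms in auto)

lemma equiv_Y: "a \<in> idx n \<Longrightarrow> b \<in> idx n \<Longrightarrow> equiv (ipar a + ipar b) (A.Y a b) (B.Y a b)"
  unfolding A.Y_def B.Y_def by (rule equiv_y) simp

lemma equiv_gen: "g \<in> hecke_gens d \<Longrightarrow> equiv (gen_par g) (A.gen_op g) (B.gen_op g)"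
  by (cases g) (auto simp: hecke_gens_def intro!: equiv_flip equiv_m equiv_y equiv_cliff)

sublocale H: queer_hom n A.Y B.Y \<Phi> A.U q
  using equiv_Y by unfold_locales (simp_all add: A.subspace_U linear_Phi equiv_def)

lemma Phi_weight_vec: "u \<in> A.U \<Longrightarrow> A.Q.weight_vec \<mu> u \<Longrightarrow> B.Q.weight_vec \<mu> (\<Phi> u)"
  using H.ef(3) by (simp add: A.Q.weight_vec_def B.Q.weight_vec_def H.\<Phi>_scale flip: H.ef(3))

lemma Phi_singular:
  assumes "u \<in> A.U" "A.Q.singular u"
  shows "B.Q.singular (\<Phi> u)"
  unfolding B.Q.singular_def
proof (intro ballI impI)
  fix i j assume ij: "i \<in> B.Q.I" "j \<in> B.Q.I" "i < j"
  have z: "\<Phi> 0 = 0" by (rule linear_on_zero[OF linear_Phi A.subspace_U])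
  have "app (A.Q.e i j) u = 0" "app (A.Q.f i j) u = 0" using assms(2) ij by (simp_all add: A.Q.singular_def)
  then have "app (B.Q.e i j) (\<Phi> u) = 0" "sg q (app (B.Q.f i j) (\<Phi> u)) = 0"
    using H.ef(3,4)[OF ij(1,2) assms(1)] z by simp_all
  then show "app (B.Q.e i j) (\<Phi> u) = 0 \<and> app (B.Q.f i j) (\<Phi> u) = 0"
    by (cases q) simp_all
qed

lemma Phi_F: "u \<in> F_space n d lam M \<Longrightarrow> \<Phi> u \<in> F_space n d lam N"
  by (simp add: A.F_space_iff B.F_space_iff Phi_U Phi_weight_vec Phi_singular)

lemma hecke_hom_F: "hecke_hom d q (F_obj n d lam M) (F_obj n d lam N) \<Phi>"
  unfolding hecke_hom_def graded_map_def
proof (intro conjI allI ballI)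
  show "linear_on (mcarrier (F_obj n d lam M)) \<Phi>"
    using linear_Phi by (auto simp: linear_on_def F_obj_def A.F_space_iff)
  show "\<Phi> ` grade (F_obj n d lam M) r \<subseteq> grade (F_obj n d lam N) (r + q)" for r
    using Phi_F Phi_grade by (auto simp: F_obj_def)
  fix g u assume g: "g \<in> hecke_gens d" and "u \<in> mcarrier (F_obj n d lam M)"
  then have u: "u \<in> A.U" by (simp add: F_obj_def A.F_space_iff)
  then show "\<Phi> (act (F_obj n d lam M) g u) = koszul q (gen_par g) *\<^sub>C act (F_obj n d lam N) g (\<Phi> u)"
    using equiv_gen[OF g] Phi_U[OF u]
    by (simp add: F_obj_def A.hecke_act_eq[OF g] B.hecke_act_eq[OF g] equiv_def koszul_eq_sg)
qed

text \<open>An injective homomorphism reflects the linear conditions that define singular vectors of a given weight.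
  This gives exactness in the middle.\<close>

lemma F_reflect:
  assumes inj: "inj_on \<phi> (mcarrier M)" and u: "u \<in> A.U" and F: "\<Phi> u \<in> F_space n d lam N"
  shows "u \<in> F_space n d lam M"
proof -
  have inj': "v = v'" if "v \<in> A.U" "v' \<in> A.U" "\<Phi> v = \<Phi> v'" for v v'
    using that inj A.U_at by (metis F_map_def ext inj_onD)
  have z: "\<Phi> 0 = 0" by (rule linear_on_zero[OF linear_Phi A.subspace_U])
  have "A.Q.weight_vec lam u"
    unfolding A.Q.weight_vec_def
  proof
    fix i assume i: "i \<in> A.Q.I"
    have "app (B.Q.e i i) (\<Phi> u) = of_int (lam i) *\<^sub>C \<Phi> u"
      using F i by (simp add: B.F_space_iff B.Q.weight_vec_def)
    then have "\<Phi> (app (A.Q.e i i) u) = \<Phi> (of_int (lam i) *\<^sub>C u)"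
      using H.ef(3)[OF i i u] by (simp add: H.\<Phi>_scale u)
    then show "app (A.Q.e i i) u = of_int (lam i) *\<^sub>C u"
      using H.ef(1)[OF i i u] cvec.subspace_scale[OF A.subspace_U u] by (intro inj')
  qed
  moreover have "A.Q.singular u"
    unfolding A.Q.singular_def
  proof (intro ballI impI)
    fix i j assume ij: "i \<in> A.Q.I" "j \<in> A.Q.I" "i < j"
    have "app (B.Q.e i j) (\<Phi> u) = 0" "app (B.Q.f i j) (\<Phi> u) = 0"
      using F ij by (simp_all add: B.F_space_iff B.Q.singular_def)
    then have "\<Phi> (app (A.Q.e i j) u) = \<Phi> 0" "\<Phi> (app (A.Q.f i j) u) = \<Phi> 0"
      using H.ef(3,4)[OF ij(1,2) u] z by simp_all
    then show "app (A.Q.e i j) u = 0 \<and> app (A.Q.f i j) u = 0"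
      using H.ef(1,2)[OF ij(1,2) u] cvec.subspace_0[OF A.subspace_U] inj' by blast
  qed
  ultimately show ?thesis using u by (simp add: A.F_space_iff)
qed

end

section \<open>Weights and local finiteness of the tensor product\<close>

definition count_letter :: "int list \<Rightarrow> int \<Rightarrow> int" where
  "count_letter w i = (\<Sum>j<length w. of_bool (\<bar>w ! j\<bar> = i))"

text \<open>The weight which the coefficient of the word \<open>w\<close> has if the whole tensor has weight \<open>\<mu>\<close>: both letters \<open>i\<close> and
  \<open>-i\<close> have weight \<open>\<epsilon>\<^sub>i\<close>.\<close>

definition word_shift :: "nat \<Rightarrow> (int \<Rightarrow> int) \<Rightarrow> int list \<Rightarrow> int \<Rightarrow> int" where
  "word_shift n \<mu> w = (\<lambda>i. if i \<in> {1..int n} then \<mu> i - count_letter w i else 0)"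

lemma word_shift_lattice: "word_shift n \<mu> w \<in> wt_lattice n"
  by (simp add: word_shift_def wt_lattice_def)

lemma count_letter_nonneg: "count_letter w i \<ge> 0"
  unfolding count_letter_def by (rule sum_nonneg) simp

context tensor
begin

lemma weight_space_iff:
  "v \<in> weight_space n M \<mu> \<longleftrightarrow> v \<in> mcarrier M \<and> (\<forall>i\<in>{1..int n}. act M (q_mat i i) v = of_int (\<mu> i) *\<^sub>C v)"
proof (cases "v \<in> mcarrier M")
  case True
  from weight_condition_iff[OF linear_act_left[OF True]] True show ?thesis
    by (simp add: weight_space_def)
qed (simp add: weight_space_def)

lemma Y_diag:
  assumes i: "i \<in> {1..int n}" and u: "u \<in> U" and w: "w \<in> W"
  shows "app (Y i i) u w = act M (q_mat i i) (u w) + of_int (count_letter w i) *\<^sub>C u w"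
proof -
  have I: "i \<in> idx n" "- i \<in> idx n" using i by (auto simp: idx_def)
  have "app (dbl (m j) i i) u w = of_int (of_bool (\<bar>w ! (j - 1)\<bar> = i)) *\<^sub>C u w" if j: "j \<in> {1..d}" for j
  proof -
    have "app (m j a a) u w = (if w ! (j - 1) = a then u w else 0)" if a: "a \<in> idx n" for a
      using w U_at[OF u] by (auto simp: app_m[OF j a a u] mu_apply[OF a a j] twist_0[OF sM])
    then show ?thesis
      using I i by (auto simp: dbl_def abs_if)
  qed
  then have "(\<Sum>j\<in>{1..<d + 1}. app (dbl (m j) i i) u w) = (\<Sum>j\<in>{1..<d + 1}. of_int (of_bool (\<bar>w ! (j - 1)\<bar> = i)) *\<^sub>C u w)"
    by (intro sum.cong refl) auto
  also have "\<dots> = of_int (\<Sum>j\<in>{1..<d + 1}. of_bool (\<bar>w ! (j - 1)\<bar> = i)) *\<^sub>C u w"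
    by (rule scaleC_of_int_sum)
  also have "(\<Sum>j\<in>{1..<d + 1}. of_bool (\<bar>w ! (j - 1)\<bar> = i)) = count_letter w i"
    unfolding count_letter_def words_length[OF w]
    by (rule sum.reindex_bij_witness[of _ Suc "\<lambda>j. j - 1"]) auto
  finally show ?thesis
    unfolding Y_def y_def app_simps app_sum plus_fun_apply sum_fun x_at[OF I(1) I(1) u] by (rule arg_cong)
qed

lemma weight_vec_iff:
  assumes u: "u \<in> U"
  shows "Q.weight_vec \<mu> u \<longleftrightarrow> (\<forall>w\<in>W. u w \<in> weight_space n M (word_shift n \<mu> w))"
proof
  assume l: "Q.weight_vec \<mu> u"
  show "\<forall>w\<in>W. u w \<in> weight_space n M (word_shift n \<mu> w)"
    unfolding weight_space_iff
  proof (intro ballI conjI)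
    fix w i assume w: "w \<in> W" and i: "i \<in> {1..int n}"
    have "app (Y i i) u w = (of_int (\<mu> i) *\<^sub>C u) w" using l i by (simp add: Q.weight_vec_def)
    then show "act M (q_mat i i) (u w) = of_int (word_shift n \<mu> w i) *\<^sub>C u w"
      using i by (simp add: Y_diag[OF i u w] word_shift_def scaleC_apply cvec.scale_left_diff_distrib eq_diff_eq)
  qed (rule U_at[OF u])
next
  assume r: "\<forall>w\<in>W. u w \<in> weight_space n M (word_shift n \<mu> w)"
  show "Q.weight_vec \<mu> u"
    unfolding Q.weight_vec_def
  proof (intro ballI ext)
    fix i w assume i: "i \<in> Q.I"
    show "app (Q.e i i) u w = (of_int (\<mu> i) *\<^sub>C u) w"
    proof (cases "w \<in> W")
      case True
      then have "act M (q_mat i i) (u w) = of_int (word_shift n \<mu> w i) *\<^sub>C u w"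
        using r i by (simp add: weight_space_iff)
      then show ?thesis
        using i by (simp add: Y_diag[OF i u True] word_shift_def scaleC_apply cvec.scale_left_diff_distrib)
    next
      case False
      have I: "i \<in> idx n" using i by (auto simp: idx_def)
      have "app (Y i i) u \<in> U" by (rule shifts_U[OF shifts_Y[OF I I] u])
      with False u show ?thesis by (simp add: U_iff scaleC_apply)
    qed
  qed
qed

end

locale tensor_O = tensor n d M for n d :: nat and M :: "(smatrix, 'a::complex_vector) supermod" +
  assumes catO: "category_O n M"
begin

definition decomposition :: "'a \<Rightarrow> ((int \<Rightarrow> int) \<Rightarrow> 'a) \<Rightarrow> bool" where
  "decomposition v u \<longleftrightarrow> (\<forall>\<mu>\<in>wt_lattice n. u \<mu> \<in> weight_space n M \<mu>) \<and> (\<forall>\<mu>. \<mu> \<notin> wt_lattice n \<longrightarrow> u \<mu> = 0) \<and>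
        finite {\<mu>. u \<mu> \<noteq> 0} \<and> v = (\<Sum>\<mu> | u \<mu> \<noteq> 0. u \<mu>)"

lemma decomposition_ex1: "v \<in> mcarrier M \<Longrightarrow> \<exists>!u. decomposition v u"
  using catO unfolding category_O_def decomposition_def by blast

lemma decomposition_unique: "v \<in> mcarrier M \<Longrightarrow> decomposition v u \<Longrightarrow> decomposition v u' \<Longrightarrow> u = u'"
  using decomposition_ex1 by blast

lemma decompositionI:
  assumes "finite S" "S \<subseteq> wt_lattice n" "\<And>\<mu>. \<mu> \<in> S \<Longrightarrow> u \<mu> \<in> weight_space n M \<mu>" "\<And>\<mu>. \<mu> \<notin> S \<Longrightarrow> u \<mu> = 0"
  shows "decomposition (\<Sum>\<mu>\<in>S. u \<mu>) u"
proof -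
  have sub: "{\<mu>. u \<mu> \<noteq> 0} \<subseteq> S" using assms(4) by blast
  have "0 \<in> weight_space n M \<mu>" for \<mu>
    using linear_on_zero[OF linear_act[OF q_mat_part] subspace_M] cvec.subspace_0[OF subspace_M]
    by (simp add: weight_space_iff idx_def)
  moreover have "(\<Sum>\<mu>\<in>S. u \<mu>) = (\<Sum>\<mu> | u \<mu> \<noteq> 0. u \<mu>)"
    by (rule sum.mono_neutral_right[OF assms(1) sub]) auto
  ultimately show ?thesis
    unfolding decomposition_def using assms finite_subset[OF sub assms(1)]
    by (metis (mono_tags, lifting) subsetD)
qed

text \<open>Nonzero vectors of distinct weights are linearly independent, because weight decompositions are unique;
  so a finite-dimensional subspace meets only finitely many weight spaces.\<close>

lemma finite_weights:
  assumes B: "finite B" "cvec.span B \<subseteq> mcarrier M"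
  shows "finite {\<mu> \<in> wt_lattice n. \<exists>v\<in>cvec.span B. v \<noteq> 0 \<and> v \<in> weight_space n M \<mu>}" (is "finite ?S")
proof -
  obtain g where g: "\<And>\<mu>. \<mu> \<in> ?S \<Longrightarrow> g \<mu> \<in> cvec.span B \<and> g \<mu> \<noteq> 0 \<and> g \<mu> \<in> weight_space n M \<mu>"
    using bchoice[of ?S "\<lambda>\<mu> v. v \<in> cvec.span B \<and> v \<noteq> 0 \<and> v \<in> weight_space n M \<mu>"] by auto
  have indep: "\<forall>\<mu>\<in>S. c \<mu> = 0" if S: "finite S" "S \<subseteq> ?S" and z: "(\<Sum>\<mu>\<in>S. c \<mu> *\<^sub>C g \<mu>) = 0" for S c
  proof -
    let ?u = "\<lambda>\<mu>. if \<mu> \<in> S then c \<mu> *\<^sub>C g \<mu> else 0"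
    have "c \<mu> *\<^sub>C v \<in> weight_space n M \<mu>" if "v \<in> weight_space n M \<mu>" for \<mu> v
      using that linear_onD(2)[OF linear_act[OF q_mat_part]]
      by (simp add: weight_space_iff cvec.subspace_scale[OF subspace_M] mult.commute idx_def)
    moreover have "g \<mu> \<in> weight_space n M \<mu>" "\<mu> \<in> wt_lattice n" if "\<mu> \<in> S" for \<mu>
      using that S(2) g by blast+
    ultimately have "decomposition (\<Sum>\<mu>\<in>S. ?u \<mu>) ?u"
      using S(1) by (intro decompositionI) auto
    then have "decomposition 0 ?u" using z by (simp cong: sum.cong_simp)
    moreover have "decomposition 0 (\<lambda>\<mu>. 0)"
      using decompositionI[of "{}" "\<lambda>\<mu>. 0"] by simp
    ultimately have "?u = (\<lambda>\<mu>. 0)"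
      using decomposition_unique cvec.subspace_0[OF subspace_M] by blast
    then have "c \<mu> *\<^sub>C g \<mu> = 0" if "\<mu> \<in> S" for \<mu> using that by (metis (mono_tags, lifting))
    then show ?thesis using g S by (meson cvec.scale_eq_0_iff subsetD)
  qed
  have inj: "inj_on g ?S"
  proof (rule inj_onI, rule ccontr)
    fix \<mu> \<nu> assume *: "\<mu> \<in> ?S" "\<nu> \<in> ?S" "g \<mu> = g \<nu>" "\<mu> \<noteq> \<nu>"
    let ?c = "\<lambda>x. if x = \<mu> then 1 else - 1 :: complex"
    have "(\<Sum>x\<in>{\<mu>, \<nu>}. ?c x *\<^sub>C g x) = 0" using * by simp
    from indep[OF _ _ this] * show False by auto
  qed
  have "cvec.independent (g ` ?S)"
    unfolding cvec.independent_explicit_finite_subsets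
  proof (intro allI impI ballI)
    fix A c v assume A: "A \<subseteq> g ` ?S" "finite A" "(\<Sum>v\<in>A. c v *\<^sub>C v) = 0" "v \<in> A"
    then obtain S where S: "S \<subseteq> ?S" "A = g ` S" by (meson subset_imageE)
    have i: "inj_on g S" using inj S(1) by (rule inj_on_subset)
    have "finite S" using A(2) S(2) i finite_imageD by blast
    moreover have "(\<Sum>\<mu>\<in>S. (c (g \<mu>)) *\<^sub>C g \<mu>) = 0"
      using A(3) unfolding S(2) by (simp add: sum.reindex[OF i])
    ultimately have "\<forall>\<mu>\<in>S. c (g \<mu>) = 0" using indep[of S "\<lambda>\<mu>. c (g \<mu>)"] S(1) by blast
    then show "c v = 0" using A(4) S(2) by blast
  qed
  moreover have "g ` ?S \<subseteq> cvec.span B" using g by blast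
  ultimately have "finite (g ` ?S)" using cvec.independent_span_bound[OF B(1)] by blast
  then show ?thesis using inj finite_imageD by blast
qed

text \<open>The pairs with \<open>q_mat a b\<close> in the nilpotent radical: \<open>e\<^sub>i\<^sub>b\<close> and \<open>f\<^sub>i\<^sub>b\<close> with \<open>i = |a| < b\<close>.\<close>

definition upper :: "int \<Rightarrow> int \<Rightarrow> bool" where
  "upper a b \<longleftrightarrow> a \<in> idx n \<and> b \<in> {1..int n} \<and> \<bar>a\<bar> < b"

lemma upper_borel: "upper a b \<Longrightarrow> q_mat a b \<in> borel_sub n"
proof -
  assume ab: "upper a b"
  have "q_mat a b \<in> nplus n"
  proof (cases "a > 0")
    case True
    then show ?thesis using ab unfolding nplus_def e_mat_eq upper_def
      by (intro cvec.span_base) auto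
  next
    case False
    then have "q_mat a b = f_mat (- a) b" by (simp add: f_mat_eq)
    moreover have "1 \<le> - a" "- a < b" "b \<le> int n" using ab False by (auto simp: upper_def idx_def)
    ultimately show ?thesis unfolding nplus_def by (intro cvec.span_base) blast
  qed
  moreover have "0 \<in> cartan n" unfolding cartan_def by (rule cvec.span_zero)
  ultimately have "0 + q_mat a b \<in> borel_sub n" unfolding borel_sub_def by blast
  then show ?thesis by simp
qed

text \<open>A finite-dimensional subspace stable under the Borel subalgebra need not be graded, but the operators on the
  tensor product involve the parity twist.  Adding the twisted copy of the subspace repairs this, since the
  homogeneous raising operators commute with the twist up to sign.\<close>

lemma locally_finite:
  assumes "finite A" "A \<subseteq> mcarrier M"
  shows "\<exists>B. finite B \<and> A \<subseteq> cvec.span B \<and> cvec.span B \<subseteq> mcarrier M \<and>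
    (\<forall>v\<in>cvec.span B. (\<forall>a b. upper a b \<longrightarrow> act M (q_mat a b) v \<in> cvec.span B) \<and> (\<forall>p. twist M p v \<in> cvec.span B))"
proof -
  have "\<exists>B. finite B \<and> stable (borel_sub n) M (cvec.span B) \<and> v \<in> cvec.span B" if "v \<in> A" for v
    using catO assms(2) that unfolding category_O_def by blast
  then obtain B where B: "\<And>v. v \<in> A \<Longrightarrow> finite (B v) \<and> stable (borel_sub n) M (cvec.span (B v)) \<and> v \<in> cvec.span (B v)"
    by metis
  let ?B = "\<Union>v\<in>A. B v"
  let ?D = "?B \<union> twist M 1 ` ?B"
  have subB: "?B \<subseteq> mcarrier M"
  proof
    fix x assume "x \<in> ?B"
    then obtain v where v: "v \<in> A" "x \<in> B v" by blast
    then have "cvec.span (B v) \<subseteq> mcarrier M" using B unfolding stable_def by simp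
    then show "x \<in> mcarrier M" using cvec.span_base[OF v(2)] by blast
  qed
  then have subD: "?D \<subseteq> mcarrier M" using twist_carrier[OF sM] by blast
  have spanD: "cvec.span ?D \<subseteq> mcarrier M" by (rule cvec.span_minimal[OF subD subspace_M])
  have tw: "twist M 1 x \<in> cvec.span ?D" if x: "x \<in> cvec.span ?B" for x
    by (rule linear_on_span[OF linear_twist[OF sM] subspace_M subB cvec.subspace_span _ x])
      (intro cvec.span_base, blast)
  have up: "act M (q_mat a b) x \<in> cvec.span ?B" if ab: "upper a b" and x: "x \<in> ?B" for a b x
  proof -
    obtain v where v: "v \<in> A" "x \<in> B v" using x by blast
    then have "act M (q_mat a b) x \<in> cvec.span (B v)"
      using B[OF v(1)] upper_borel[OF ab] cvec.span_base[OF v(2)] unfolding stable_def by simp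
    moreover have "cvec.span (B v) \<subseteq> cvec.span ?B" using v(1) by (intro cvec.span_mono) blast
    ultimately show ?thesis by blast
  qed
  have upD: "act M (q_mat a b) v \<in> cvec.span ?D" if ab: "upper a b" and v: "v \<in> cvec.span ?D" for a b v
  proof -
    have idx: "a \<in> idx n" "b \<in> idx n" using ab by (auto simp: upper_def idx_def)
    show ?thesis
    proof (rule linear_on_span[OF linear_act[OF q_mat_part[OF idx]] subspace_M subD cvec.subspace_span _ v])
      fix x assume x: "x \<in> ?D"
      show "act M (q_mat a b) x \<in> cvec.span ?D"
      proof (cases "x \<in> ?B")
        case True
        then show ?thesis using up[OF ab] cvec.span_mono[of ?B ?D] by blast
      next
        case False
        then obtain z where z: "z \<in> ?B" "x = twist M 1 z" using x by blast
        have "act M (q_mat a b) x = sg (1 * (ipar a + ipar b)) (twist M 1 (act M (q_mat a b) z))"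
          unfolding z(2)
          by (rule twist_graded_map[OF sM graded_act[OF q_mat_part[OF idx]] sM subsetD[OF subB z(1)]])
        then show ?thesis
          using tw[OF up[OF ab z(1)]] by (simp only: subspace_sg cvec.subspace_span)
      qed
    qed
  qed
  have twD: "twist M 1 v \<in> cvec.span ?D" if v: "v \<in> cvec.span ?D" for v
  proof (rule linear_on_span[OF linear_twist[OF sM] subspace_M subD cvec.subspace_span _ v])
    fix x assume x: "x \<in> ?D"
    show "twist M 1 x \<in> cvec.span ?D"
    proof (cases "x \<in> ?B")
      case True
      then show ?thesis by (intro tw cvec.span_base)
    next
      case False
      then obtain z where z: "z \<in> ?B" "x = twist M 1 z" using x by blast
      have zM: "z \<in> mcarrier M" using subB z(1) by (rule subsetD)
      have "twist M 1 x = z" unfolding z(2) by (simp add: twist_twist[OF sM zM] twist_0[OF sM zM])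
      moreover have "z \<in> cvec.span ?D" using z(1) by (intro cvec.span_base) blast
      ultimately show ?thesis by simp
    qed
  qed
  have "twist M p v \<in> cvec.span ?D" if "v \<in> cvec.span ?D" for p v
    using twD[OF that] twist_0[OF sM subsetD[OF spanD that]] that by (cases "p = 0") auto
  moreover have "finite ?D" using assms(1) B by auto
  moreover have "A \<subseteq> cvec.span ?D"
  proof
    fix v assume v: "v \<in> A"
    have "cvec.span (B v) \<subseteq> cvec.span ?D" using v by (intro cvec.span_mono) blast
    with B[OF v] show "v \<in> cvec.span ?D" by blast
  qed
  ultimately show ?thesis using spanD upD by (intro exI[of _ ?D]) simp
qed

text \<open>The raising operators lower the height \<open>\<Sum> i \<mu>\<^sub>i\<close>.  The coefficients stay in a finite-dimensional subspace, in which
  only finitely many weights occur, so the height of a nonzero vector is bounded below.\<close>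

lemma exists_killed:
  assumes u: "u \<in> U" and weight: "Q.weight_vec \<mu> u"
  shows "\<exists>k. Q.killed k u"
proof -
  have "W = {w. set w \<subseteq> idx n \<and> length w = d}" by (auto simp: tensor_words_def)
  then have fin: "finite (u ` W)" using finite_lists_length_eq[OF finite_idx[of n], of d] by simp
  have "u ` W \<subseteq> mcarrier M" using U_at[OF u] by blast
  from locally_finite[OF fin this] obtain B where B: "finite B" "u ` W \<subseteq> cvec.span B" "cvec.span B \<subseteq> mcarrier M"
    and stable: "\<forall>v\<in>cvec.span B. (\<forall>a b. upper a b \<longrightarrow> act M (q_mat a b) v \<in> cvec.span B) \<and> (\<forall>p. twist M p v \<in> cvec.span B)"
    by (elim exE conjE)
  have up: "act M (q_mat a b) v \<in> cvec.span B" if "v \<in> cvec.span B" "upper a b" for v a b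
    using stable that by simp
  have tw: "twist M p v \<in> cvec.span B" if "v \<in> cvec.span B" for v p
    using stable that by simp
  define ht where "ht = (\<lambda>\<nu> :: int \<Rightarrow> int. \<Sum>i\<in>{1..int n}. i * \<nu> i)"
  let ?S = "{\<mu> \<in> wt_lattice n. \<exists>v\<in>cvec.span B. v \<noteq> 0 \<and> v \<in> weight_space n M \<mu>}"
  have "finite ?S" by (rule finite_weights[OF B(1,3)])
  then have "\<exists>L. \<forall>\<nu>\<in>?S. L \<le> ht \<nu>"
    by (intro exI[of _ "Min (insert 0 (ht ` ?S))"]) auto
  then obtain L where L: "\<And>\<nu>. \<nu> \<in> ?S \<Longrightarrow> L \<le> ht \<nu>" by blast
  have main: "u \<in> U \<Longrightarrow> \<forall>w\<in>W. u w \<in> cvec.span B \<Longrightarrow> Q.weight_vec \<mu> u \<Longrightarrow> ht \<mu> < L + int k \<Longrightarrow> Q.killed k u" for k u \<mu>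
  proof (induction k arbitrary: u \<mu>)
    case 0
    have "u w = 0" for w
    proof (cases "w \<in> W")
      case True
      show ?thesis
      proof (rule ccontr)
        assume "u w \<noteq> 0"
        moreover have "u w \<in> weight_space n M (word_shift n \<mu> w)"
          using 0 True by (simp add: weight_vec_iff)
        ultimately have "L \<le> ht (word_shift n \<mu> w)"
          using 0(2) True word_shift_lattice by (intro L) blast
        also have "\<dots> \<le> ht \<mu>"
          unfolding ht_def word_shift_def
          by (rule sum_mono) (auto intro!: mult_left_mono simp: count_letter_nonneg)
        finally show False using 0(4) by simp
      qed
    next
      case False
      then show ?thesis using 0(1) by (simp add: U_iff)
    qed
    then show ?case by auto
  next
    case (Suc k)
    have child: "Q.killed k (app (Y a j) u)"
      if ij: "i \<in> Q.I" "j \<in> Q.I" "i < j" and a: "a = i \<or> a = - i" for a i j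
    proof -
      have idx: "a \<in> idx n" "j \<in> idx n" and upper: "upper a j"
        using ij a by (auto simp: idx_def upper_def)
      show ?thesis
      proof (rule Suc.IH)
        show "app (Y a j) u \<in> U" by (rule shifts_U[OF shifts_Y[OF idx] Suc.prems(1)])
        show "Q.weight_vec (raise i j \<mu>) (app (Y a j) u)"
          using a Q.weight_vec_raise[OF Suc.prems(3) ij(1,2)] by (auto simp: Q.f_def)
        have "ht (raise i j \<mu>) = ht \<mu> + i - j" unfolding ht_def by (rule sum_raise[OF ij(1,2)])
        then show "ht (raise i j \<mu>) < L + int k" using Suc.prems(4) ij(3) by simp
        show "\<forall>w\<in>W. app (Y a j) u w \<in> cvec.span B"
        proof
          fix w assume w: "w \<in> W"
          have m: "app (m l b c) u w \<in> cvec.span B" if "l \<in> {1..d}" "b \<in> idx n" "c \<in> idx n" for l b c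
            using Suc.prems(2) words_update[OF w that(3)]
            by (auto simp: app_m[OF that Suc.prems(1)] mu_apply[OF that(2,3,1)] cvec.span_zero
                intro!: tw subspace_sg[OF cvec.subspace_span])
          have "app (dbl (m l) a j) u w \<in> cvec.span B" if "l \<in> {1..<d + 1}" for l
            unfolding dbl_def app_simps plus_fun_apply
            using that idx by (intro cvec.span_add m) auto
          then show "app (Y a j) u w \<in> cvec.span B"
            unfolding Y_def y_def app_simps app_sum plus_fun_apply sum_fun x_at[OF idx Suc.prems(1)]
            using up[OF _ upper] Suc.prems(2) w by (intro cvec.span_add cvec.span_sum) auto
        qed
      qed
    qed
    then show ?case unfolding Q.killed.simps Q.f_def by blast
  qed
  have "ht \<mu> < L + int (nat (ht \<mu> - L) + 1)" by simp
  from main[OF u _ weight this] show ?thesis using B(2) by (intro exI) blast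
qed

end

section \<open>Exactness\<close>

context tensor_hom
begin

lemma phi_weight_space: "v \<in> weight_space n M \<mu> \<Longrightarrow> \<phi> v \<in> weight_space n N \<mu>"
  unfolding A.weight_space_iff B.weight_space_iff
proof (intro conjI ballI)
  assume v: "v \<in> mcarrier M \<and> (\<forall>i\<in>{1..int n}. act M (q_mat i i) v = of_int (\<mu> i) *\<^sub>C v)"
  then show "\<phi> v \<in> mcarrier N" by (simp add: phi_carrier)
  fix i assume i: "i \<in> {1..int n}"
  then have "i \<in> idx n" by (simp add: idx_def)
  then have "act N (q_mat i i) (\<phi> v) = \<phi> (act M (q_mat i i) v)"
    using v by (simp add: phi_act)
  then show "act N (q_mat i i) (\<phi> v) = of_int (\<mu> i) *\<^sub>C \<phi> v"
    using v i linear_onD(2)[OF linear_phi] by simp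
qed

text \<open>Decompose any preimage into weight vectors.  Their images form the weight decomposition of \<open>v\<close>, which by
  uniqueness has \<open>v\<close> as its only component.\<close>

lemma weight_vector_lift:
  assumes cat: "category_O n M" "category_O n N" and surj: "\<phi> ` mcarrier M = mcarrier N"
    and v: "v \<in> weight_space n N \<nu>" and \<nu>: "\<nu> \<in> wt_lattice n"
  shows "\<exists>u\<in>weight_space n M \<nu>. \<phi> u = v"
proof -
  interpret AO: tensor_O n d M by unfold_locales (rule cat)
  interpret BO: tensor_O n d N by unfold_locales (rule cat)
  have vN: "v \<in> mcarrier N" using v by (simp only: B.weight_space_iff)
  then obtain u where u: "u \<in> mcarrier M" "\<phi> u = v" unfolding surj[symmetric] by (elim imageE) simp
  obtain f where f: "AO.decomposition u f" using AO.decomposition_ex1[OF u(1)] by (elim ex1E)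
  let ?S = "{\<mu>. f \<mu> \<noteq> 0}"
  have S: "finite ?S" "?S \<subseteq> wt_lattice n" "u = (\<Sum>\<mu>\<in>?S. f \<mu>)"
    and fw: "\<And>\<mu>. \<mu> \<in> wt_lattice n \<Longrightarrow> f \<mu> \<in> weight_space n M \<mu>"
    using f unfolding AO.decomposition_def by blast+
  have "v = (\<Sum>\<mu>\<in>?S. \<phi> (f \<mu>))"
    unfolding u(2)[symmetric] S(3)
    by (rule linear_on_sum[OF linear_phi A.subspace_M S(1)]) (use S(2) fw A.weight_space_iff in blast)
  moreover have "BO.decomposition (\<Sum>\<mu>\<in>?S. \<phi> (f \<mu>)) (\<lambda>\<mu>. \<phi> (f \<mu>))"
    using fw phi_weight_space phi_zero S(2) by (intro BO.decompositionI[OF S(1,2)]) auto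
  moreover have "BO.decomposition (\<Sum>\<mu>\<in>{\<nu>}. if \<mu> = \<nu> then v else 0) (\<lambda>\<mu>. if \<mu> = \<nu> then v else 0)"
    using v \<nu> by (intro BO.decompositionI) auto
  ultimately have "(\<lambda>\<mu>. \<phi> (f \<mu>)) = (\<lambda>\<mu>. if \<mu> = \<nu> then v else 0)"
    using BO.decomposition_unique[OF vN] by simp
  then have "\<phi> (f \<nu>) = v" by (simp add: fun_eq_iff)
  with fw[OF \<nu>] show ?thesis by blast
qed

text \<open>Lift \<open>v\<close> coefficient by coefficient to a weight vector, and apply to the lift a product of operators \<open>Z t - k\<close>
  that makes it singular.  The same product multiplies \<open>v\<close> by a nonzero scalar \<open>r\<close>.\<close>

lemma F_surj:
  assumes cat: "category_O n M" "category_O n N" and surj: "\<phi> ` mcarrier M = mcarrier N"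
    and lam: "lam \<in> dominant_typical n" and v: "v \<in> F_space n d lam N"
  shows "\<exists>u\<in>F_space n d lam M. \<Phi> u = v"
proof -
  interpret AO: tensor_O n d M by unfold_locales (rule cat)
  have vU: "v \<in> B.U" and vw: "B.Q.weight_vec lam v" and vs: "B.Q.singular v"
    using v by (simp_all add: B.F_space_iff)
  have "\<forall>w\<in>A.W. \<exists>z. z \<in> weight_space n M (word_shift n lam w) \<and> \<phi> z = v w"
    using weight_vector_lift[OF cat surj _ word_shift_lattice] vw unfolding B.weight_vec_iff[OF vU] by blast
  then obtain g where g: "\<And>w. w \<in> A.W \<Longrightarrow> g w \<in> weight_space n M (word_shift n lam w) \<and> \<phi> (g w) = v w"
    by metis
  define u where "u = (\<lambda>w. if w \<in> A.W then g w else 0)"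
  have uU: "u \<in> A.U" using g by (auto simp: A.U_iff u_def weight_space_def)
  have uw: "A.Q.weight_vec lam u" unfolding A.weight_vec_iff[OF uU] using g by (simp add: u_def)
  have uv: "\<Phi> u = v"
    using g vU by (auto simp: fun_eq_iff F_map_apply u_def phi_zero B.U_iff)
  obtain k where "A.Q.killed k u" using AO.exists_killed[OF uU uw] by blast
  then obtain cs where cs: "A.Q.separating lam cs" "A.Q.singular (A.Q.zprod cs u)"
    using A.Q.singular_projection[OF lam uw] by blast
  then obtain r where r: "r \<noteq> 0" "B.Q.zprod cs v = r *\<^sub>C v"
    using B.Q.zprod_eigen[OF vs vw] by blast
  have z: "A.Q.zprod cs u \<in> F_space n d lam M" "\<Phi> (A.Q.zprod cs u) = r *\<^sub>C v"
    using H.zprod_hom[OF uU, of cs] A.Q.weight_vec_zprod[OF uw] cs(2) uv r(2) by (simp_all add: A.F_space_iff)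
  \<comment> \<open>dividing by \<open>r\<close> gives a preimage of \<open>v\<close> itself\<close>
  have "inverse r *\<^sub>C A.Q.zprod cs u \<in> F_space n d lam M"
    by (rule cvec.subspace_scale[OF A.subspace_F z(1)])
  moreover have "\<Phi> (inverse r *\<^sub>C A.Q.zprod cs u) = v"
    using z r(1) by (simp add: H.\<Phi>_scale A.F_space_iff)
  ultimately show ?thesis by blast
qed

end

lemma short_exact_F:
  fixes L :: "(smatrix, 'a::complex_vector) supermod" and M :: "(smatrix, 'b::complex_vector) supermod"
    and N :: "(smatrix, 'c::complex_vector) supermod"
  assumes lam: "lam \<in> dominant_typical n"
    and cat: "category_O n L" "category_O n M" "category_O n N"
    and hom: "q_hom n p L M \<phi>" "q_hom n q M N \<psi>" and exact: "short_exact L \<phi> M \<psi> N"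
  shows "short_exact (F_obj n d lam L) (F_map \<phi>) (F_obj n d lam M) (F_map \<psi>) (F_obj n d lam N)"
proof -
  interpret LM: tensor_hom n d L M \<phi> p
    using cat hom by unfold_locales (auto simp: category_O_def)
  interpret MN: tensor_hom n d M N \<psi> q
    using cat hom by unfold_locales (auto simp: category_O_def)
  have inj: "inj_on \<phi> (mcarrier L)" and ker: "\<phi> ` mcarrier L = {m \<in> mcarrier M. \<psi> m = 0}"
    and surj: "\<psi> ` mcarrier M = mcarrier N"
    using exact by (simp_all add: short_exact_def)
  let ?F = "F_space n d lam"
  have "inj_on (F_map \<phi>) (?F L)"
  proof (rule inj_onI)
    fix u v assume "u \<in> ?F L" "v \<in> ?F L" and eq: "F_map \<phi> u = F_map \<phi> v"
    then have "u \<in> LM.A.U" "v \<in> LM.A.U" by (simp_all add: LM.A.F_space_iff)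
    then show "u = v"
      using inj_onD[OF inj fun_cong[OF eq, unfolded F_map_apply]] LM.A.U_at by blast
  qed
  moreover have "F_map \<phi> ` ?F L = {u \<in> ?F M. F_map \<psi> u = 0}"
  proof (intro set_eqI iffI)
    fix v assume "v \<in> F_map \<phi> ` ?F L"
    then obtain u where u: "u \<in> ?F L" "v = F_map \<phi> u" by blast
    then have "u \<in> LM.A.U" by (simp add: LM.A.F_space_iff)
    then have "\<psi> (\<phi> (u w)) = 0" for w using ker LM.A.U_at by blast
    then show "v \<in> {u \<in> ?F M. F_map \<psi> u = 0}"
      using LM.Phi_F u by (auto simp: F_map_def)
  next
    fix v assume v: "v \<in> {u \<in> ?F M. F_map \<psi> u = 0}"
    then have vU: "v \<in> LM.B.U" by (simp add: LM.B.F_space_iff)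
    have "\<psi> (v w) = 0" for w using v by (auto simp: F_map_def fun_eq_iff)
    then have "\<forall>w. \<exists>z. z \<in> mcarrier L \<and> \<phi> z = v w" using ker LM.B.U_at[OF vU] by (auto simp: image_iff set_eq_iff) metis
    then obtain g where g: "\<And>w. g w \<in> mcarrier L \<and> \<phi> (g w) = v w" by metis
    define u where "u = (\<lambda>w. if w \<in> tensor_words n d then g w else 0)"
    have u: "u \<in> LM.A.U" using g by (simp add: LM.A.U_iff u_def)
    have uv: "F_map \<phi> u = v"
      using g vU by (auto simp: fun_eq_iff F_map_apply u_def LM.phi_zero LM.B.U_iff)
    have "u \<in> ?F L" by (rule LM.F_reflect[OF inj u]) (use v uv in simp)
    with uv show "v \<in> F_map \<phi> ` ?F L" by blast
  qed
  moreover have "F_map \<psi> ` ?F M = ?F N"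
    using MN.Phi_F MN.F_surj[OF cat(2,3) surj lam] by blast
  ultimately show ?thesis
    by (simp add: short_exact_def F_obj_def)
qed

theorem corollary7p5p4:
  fixes n d :: nat and lam :: "int \<Rightarrow> int"
  assumes "n \<ge> 1" and "lam \<in> dominant_typical n"
  shows
    "(\<forall>M :: (smatrix, 'a::complex_vector) supermod.
        category_O n M \<longrightarrow> hecke_supermodule d (F_obj n d lam M)) \<and>
     (\<forall>(M :: (smatrix, 'a) supermod) (N :: (smatrix, 'b::complex_vector) supermod) p \<phi>.
        category_O n M \<and> category_O n N \<and> q_hom n p M N \<phi> \<longrightarrow>
        hecke_hom d p (F_obj n d lam M) (F_obj n d lam N) (F_map \<phi>)) \<and>
     (\<forall>M :: (smatrix, 'a) supermod. category_O n M \<longrightarrow>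
        (\<forall>u \<in> mcarrier (F_obj n d lam M). F_map (\<lambda>m. m) u = u)) \<and>
     (\<forall>(L :: (smatrix, 'a) supermod) (M :: (smatrix, 'b) supermod)
        (N :: (smatrix, 'c::complex_vector) supermod) p q \<phi> \<psi>.
        category_O n L \<and> category_O n M \<and> category_O n N \<and>
        q_hom n p L M \<phi> \<and> q_hom n q M N \<psi> \<longrightarrow>
        (\<forall>u \<in> mcarrier (F_obj n d lam L). F_map (\<lambda>m. \<psi> (\<phi> m)) u = F_map \<psi> (F_map \<phi> u))) \<and>
     (\<forall>(L :: (smatrix, 'a) supermod) (M :: (smatrix, 'b) supermod)
        (N :: (smatrix, 'c) supermod) p q \<phi> \<psi>.
        category_O n L \<and> category_O n M \<and> category_O n N \<and>
        q_hom n p L M \<phi> \<and> q_hom n q M N \<psi> \<and> short_exact L \<phi> M \<psi> N \<longrightarrow>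
        short_exact (F_obj n d lam L) (F_map \<phi>) (F_obj n d lam M) (F_map \<psi>) (F_obj n d lam N))"
proof (intro conjI allI impI ballI)
  fix M :: "(smatrix, 'a) supermod"
  assume "category_O n M"
  then interpret tensor n d M by unfold_locales (simp add: category_O_def)
  show "hecke_supermodule d (F_obj n d lam M)" by (rule hecke_supermodule_F)
next
  fix M :: "(smatrix, 'a) supermod" and N :: "(smatrix, 'b) supermod" and p \<phi>
  assume *: "category_O n M \<and> category_O n N \<and> q_hom n p M N \<phi>"
  then interpret tensor_hom n d M N \<phi> p by unfold_locales (auto simp: category_O_def)
  show "hecke_hom d p (F_obj n d lam M) (F_obj n d lam N) (F_map \<phi>)" by (rule hecke_hom_F)
next
  fix u :: "int list \<Rightarrow> 'a"
  show "F_map (\<lambda>m. m) u = u" by (simp add: F_map_def)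
next
  fix u :: "int list \<Rightarrow> 'a" and \<phi> :: "'a \<Rightarrow> 'b" and \<psi> :: "'b \<Rightarrow> 'c"
  show "F_map (\<lambda>m. \<psi> (\<phi> m)) u = F_map \<psi> (F_map \<phi> u)" by (simp add: F_map_def)
next
  fix L :: "(smatrix, 'a) supermod" and M :: "(smatrix, 'b) supermod" and N :: "(smatrix, 'c) supermod" and p q \<phi> \<psi>
  assume "category_O n L \<and> category_O n M \<and> category_O n N \<and>
        q_hom n p L M \<phi> \<and> q_hom n q M N \<psi> \<and> short_exact L \<phi> M \<psi> N"
  then show "short_exact (F_obj n d lam L) (F_map \<phi>) (F_obj n d lam M) (F_map \<psi>) (F_obj n d lam N)"
    by (intro short_exact_F[OF assms(2)]) blast+
qed

end
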